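(* Let $n\geq3$ and $(n-1)/2<p\leq n/2$. Let $C>0$ be a constant such that $$\big\|e^{\beta\langle(x,t),\nu\rangle}v\big\|_{L_{t,x}^2(|W|)} \leq C\,\|W\|_{\mathcal{F}^p}\,\big\|e^{\beta\langle(x,t),\nu\rangle}(i\partial_t+\Delta)v\big\|_{L_{t,x}^2(|W|^{-1})}$$ for all $W\in\mathcal{F}^p$, $\beta\in\mathbb{R}$, $\nu\in\mathbb{R}^{n+1}$ and $v\in C_0^\infty(\mathbb{R}^{n+1})$. Let $V\in\mathcal{F}^p$ with $\|V\|_{\mathcal{F}^p}<1/C$; if $p=n/2$, assume additionally that there is $\delta>0$ such that $|V(x)|\geq\delta/R^2$ for $|x|\leq 2R$ and all sufficiently large $R$. Let $g:\mathbb{R}\to\mathbb{R}$ be a differentiable function which is bounded below and satisfies $g(t)\to\infty$ as $|t|\to\infty$. Let $D$ be a half space of $\mathbb{R}^n$. If $u\in H^1_t\cap H^2_x$ is a solution of $$\partial_tu-\Delta u=(g'(t)+t+V(x))u\quad\text{in }\mathbb{R}^{n+1}$$ which vanishes in the half space $D\times\mathbb{R}$ of $\mathbb{R}^{n+1}$, then $u$ is identically zero.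
   Context: Points of $\mathbb{R}^{n+1}=\mathbb{R}^n\times\mathbb{R}$ are written $(x,t)$; $\Delta$ is the Laplacian in $x\in\mathbb{R}^n$; $\langle\cdot,\cdot\rangle$ is the usual inner product on $\mathbb{R}^{n+1}$. Functions are complex-valued unless said otherwise; equalities between measurable functions are understood almost everywhere. A half space of $\mathbb{R}^n$ is a set $\{x:x\cdot\omega>c\}$ with $\omega\in\mathbb{R}^n$ a unit vector and $c\in\mathbb{R}$. Fefferman-Phong class: for $1\le p\le n/2$, a function $V\in L^p_{\mathrm{loc}}(\mathbb{R}^n)$ belongs to $\mathcal{F}^p$ if $$\|V\|_{\mathcal{F}^p}=\sup_Q|Q|^{2/n}\bigg(\frac1{|Q|}\int_Q|V|^p\,dx\bigg)^{1/p}<\infty,$$ the supremum being over all cubes $Q\subset\mathbb{R}^n$. For a nonnegative weight $w=w(x)$ on $\mathbb{R}^n$, $\|F\|_{L^2_{t,x}(w)}=\big(\int_{\mathbb{R}}\int_{\mathbb{R}^n}|F(x,t)|^2w(x)\,dx\,dt\big)^{1/2}\in[0,\infty]$. Where $W(x)=0$ the weight $|W(x)|^{-1}$ is $+\infty$, with the convention $0\cdot\infty=0$. $H^1_t$ is the space of functions on $\mathbb{R}^{n+1}$ whose (weak) derivatives up to order $1$ with respect to $t$ belong to $L^2(\mathbb{R}^{n+1})$; $H^2_x$ is the space of functions on $\mathbb{R}^{n+1}$ whose (weak) derivatives up to order $2$ with respect to $x$ belong to $L^2(\mathbb{R}^{n+1})$. The paper proves that a constant $C$ as in the claim exists. *)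

theory Defs
  imports "HOL-Analysis.Analysis"
begin

text \<open>Measurable functions are Lebesgue measurable representatives, \<open>lebesgue\<close> being the
  completion of \<open>lborel\<close>. The space \<open>\<real>\<^sup>n \<times> \<real>\<close> is the product type with its product inner
  product, so that \<open>(b, 0)\<close> for \<open>b \<in> Basis\<close> are the space directions and \<open>(0, 1)\<close> is the
  time direction.\<close>

definition Lp_loc :: "real \<Rightarrow> ('a::euclidean_space \<Rightarrow> complex) \<Rightarrow> bool" where
  "Lp_loc p f \<longleftrightarrow> f \<in> borel_measurable lebesgue \<and>
     (\<forall>K. compact K \<longrightarrow> set_integrable lebesgue K (\<lambda>x. norm (f x) powr p))"

definition L2_fun :: "('a::euclidean_space \<Rightarrow> complex) \<Rightarrow> bool" where
  "L2_fun f \<longleftrightarrow> f \<in> borel_measurable lebesgue \<and> integrable lebesgue (\<lambda>x. (norm (f x))\<^sup>2)"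

text \<open>Cubes are taken with sides parallel to the coordinate axes.\<close>

definition cubes :: "'a::euclidean_space set set" where
  "cubes = {cbox a (a + s *\<^sub>R One) | a s. s > 0}"

text \<open>Each member of the supremum is meaningful only for \<open>V\<close> in \<open>Lp_loc p\<close>, because the
  Bochner integral of a non-integrable function is 0.\<close>

definition FP_norm :: "real \<Rightarrow> ('a::euclidean_space \<Rightarrow> complex) \<Rightarrow> ennreal" where
  "FP_norm p V =
     (SUP Q\<in>cubes. ennreal (measure lebesgue Q powr (2 / DIM('a)) *
        ((1 / measure lebesgue Q) * (LINT x:Q|lebesgue. norm (V x) powr p)) powr (1 / p)))"

definition FP_class :: "real \<Rightarrow> ('a::euclidean_space \<Rightarrow> complex) set" where
  "FP_class p = {V. Lp_loc p V \<and> FP_norm p V < \<infinity>}"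

text \<open>Weights take values in \<open>[0, \<infinity>]\<close>; in \<open>ennreal\<close> one has \<open>inverse 0 = \<infinity>\<close> and
  \<open>0 * \<infinity> = 0\<close>.\<close>

definition L2_weight_norm ::
    "('a::euclidean_space \<Rightarrow> ennreal) \<Rightarrow> ('a \<times> real \<Rightarrow> complex) \<Rightarrow> ennreal" where
  "L2_weight_norm w F =
     (let I = (\<integral>\<^sup>+t. (\<integral>\<^sup>+x. ennreal ((norm (F (x, t)))\<^sup>2) * w x \<partial>lebesgue) \<partial>lebesgue)
      in if I = \<infinity> then \<infinity> else ennreal (sqrt (enn2real I)))"

definition pd :: "'a::euclidean_space \<Rightarrow> ('a \<Rightarrow> complex) \<Rightarrow> 'a \<Rightarrow> complex" where
  "pd b f z = frechet_derivative f (at z) b"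

abbreviation pds :: "'a::euclidean_space list \<Rightarrow> ('a \<Rightarrow> complex) \<Rightarrow> 'a \<Rightarrow> complex" where
  "pds bs f \<equiv> foldr pd bs f"

definition test_fun :: "('a::euclidean_space \<Rightarrow> complex) \<Rightarrow> bool" where
  "test_fun f \<longleftrightarrow> (\<forall>bs. set bs \<subseteq> Basis \<longrightarrow> pds bs f differentiable_on UNIV) \<and>
     compact (closure {z. f z \<noteq> 0})"

definition schroedinger_op ::
    "('a::euclidean_space \<times> real \<Rightarrow> complex) \<Rightarrow> 'a \<times> real \<Rightarrow> complex" where
  "schroedinger_op v z = \<i> * pd (0, 1) v z + (\<Sum>b\<in>Basis. pd (b, 0) (pd (b, 0) v) z)"

definition has_weak_deriv ::
    "('a::euclidean_space \<Rightarrow> complex) \<Rightarrow> 'a list \<Rightarrow> ('a \<Rightarrow> complex) \<Rightarrow> bool" where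
  "has_weak_deriv f bs h \<longleftrightarrow> Lp_loc 1 f \<and> Lp_loc 1 h \<and>
     (\<forall>\<phi>. test_fun \<phi> \<longrightarrow>
        (LINT z|lebesgue. f z * pds bs \<phi> z) = (-1) ^ length bs * (LINT z|lebesgue. h z * \<phi> z))"

definition H1t :: "('a::euclidean_space \<times> real \<Rightarrow> complex) set" where
  "H1t = {u. L2_fun u \<and> (\<exists>h. has_weak_deriv u [(0, 1)] h \<and> L2_fun h)}"

definition H2x :: "('a::euclidean_space \<times> real \<Rightarrow> complex) set" where
  "H2x = {u. L2_fun u \<and>
     (\<forall>b\<in>Basis. \<exists>h. has_weak_deriv u [(b, 0)] h \<and> L2_fun h) \<and>
     (\<forall>b\<in>Basis. \<forall>c\<in>Basis. \<exists>h. has_weak_deriv u [(b, 0), (c, 0)] h \<and> L2_fun h)}"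

text \<open>The equation \<open>\<partial>\<^sub>t u - \<Delta>u = q u\<close> with weak derivatives, almost everywhere. Weak derivatives
  are unique up to null sets, so the choice of \<open>ut\<close> and \<open>uxx\<close> does not matter.\<close>

definition heat_solution ::
    "('a::euclidean_space \<times> real \<Rightarrow> complex) \<Rightarrow> ('a \<times> real \<Rightarrow> complex) \<Rightarrow> bool" where
  "heat_solution q u \<longleftrightarrow>
     (\<exists>ut uxx. has_weak_deriv u [(0, 1)] ut \<and>
        (\<forall>b\<in>Basis. has_weak_deriv u [(b, 0), (b, 0)] (uxx b)) \<and>
        (AE z in lebesgue. ut z - (\<Sum>b\<in>Basis. uxx b z) = q z * u z))"

definition half_spaces :: "'a::euclidean_space set set" where
  "half_spaces = {{x. x \<bullet> \<omega> > c} | \<omega> c. norm \<omega> = 1}"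

end

theory Submission
  imports Defs "HOL-Probability.Levy"
begin

text \<open>
  The equation has a potential that is independent of time, so it can be reduced to elliptic ones.
  With \<open>m t = exp (- g t - t\<^sup>2 / 2 + i \<sigma> t)\<close> put \<open>f x = \<integral> u (x, t) m t dt\<close>. Integration by parts in time turns the
  heat equation into \<open>\<Delta> f + i \<sigma> f = - V f\<close>, because the logarithmic derivative of \<open>m\<close> cancels
  \<open>g' t + t\<close>. On the other hand, inserting \<open>v (x, t) = F x exp (l t) \<theta> (t / T)\<close> into the Carleman
  estimate, with an exponential weight in time only, and letting \<open>T \<rightarrow> \<infinity>\<close> gives
  \<open>\<integral> |F|\<^sup>2 |W| \<le> A \<integral> |\<Delta> F + i l F|\<^sup>2 / |W|\<close> with \<open>A < 1\<close> for test functions \<open>F\<close>. If \<open>|W| \<ge> |V|\<close> and \<open>|W|\<close>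
  decays at most like \<open>1 / |x|\<^sup>2\<close>, this can be applied to mollifications of cut-offs of \<open>f\<close>: the
  cut-off errors vanish since \<open>f\<close> and its gradient are in \<open>L\<^sup>2\<close>, and the term \<open>V f\<close> is absorbed. Hence
  \<open>f = 0\<close> for every \<open>\<sigma>\<close>, and uniqueness of the Fourier transform in time gives \<open>u = 0\<close>.\<close>

section \<open>Smooth functions\<close>

text \<open>The cut-off \<open>\<xi> (x / n)\<close> costs a commutator of size 1/n, while the dual
  weight 1/|W| may reach n^2 on its support: after squaring the powers just cancel, so an inverse
  square is the fastest decay of W that can be afforded. Smallness must come from elsewhere: the
  gradient of \<open>\<xi>\<close> vanishes at 0, so the rescaled commutator tends to 0 in L^2.
  Since V may be small or zero when p < n/2, the weight there is the maximum of |V| and a small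
  multiple of a product version of 1/|x|^2; the gap between the norm of V and 1/C pays for this
  change and for every splitting parameter \<kappa>. When p = n/2, V is its own weight. Absorption
  needs the integral of |V||f|^2 to be finite, and it is, because V f = -(\<Delta> f + i \<sigma> f)
  lies in L^2 together with f. In time the obstacle is g', which exists everywhere but need not be
  integrable. Only the combination left after cancellation is integrable, so the integration by
  parts takes place on compact windows, slice by slice in x, with Henstock-Kurzweil integrals; weak
  derivatives are tested on a countable family so that the exceptional x form a null set.\<close>

lemma pd_eqI: "(f has_derivative f') (at z) \<Longrightarrow> pd b f z = f' b"
  unfolding pd_def by (metis frechet_derivative_at)

lemma has_derivative_frechet: "f differentiable_on UNIV \<Longrightarrow> (f has_derivative frechet_derivative f (at z)) (at z)"
  by (simp add: differentiable_on_def frechet_derivative_works)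

lemma pd_add: "f differentiable_on UNIV \<Longrightarrow> g differentiable_on UNIV \<Longrightarrow>
    pd b (\<lambda>z. f z + g z) = (\<lambda>z. pd b f z + pd b g z)"
  by (rule ext, subst pd_eqI[OF has_derivative_add[OF has_derivative_frechet has_derivative_frechet]])
     (auto simp: pd_def)

lemma pd_mult: "f differentiable_on UNIV \<Longrightarrow> g differentiable_on UNIV \<Longrightarrow>
    pd b (\<lambda>z. f z * g z) = (\<lambda>z. pd b f z * g z + f z * pd b g z)"
  by (rule ext, subst pd_eqI[OF has_derivative_mult[OF has_derivative_frechet has_derivative_frechet]])
     (auto simp: pd_def)

lemma pd_const: "pd b (\<lambda>z. c) = (\<lambda>z. 0)"
  by (rule ext, subst pd_eqI[OF has_derivative_const]) auto

lemma pd_cmult: "f differentiable_on UNIV \<Longrightarrow> pd b (\<lambda>z. c * f z) = (\<lambda>z. c * pd b f z)"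
  by (subst pd_mult) (auto simp: pd_const)

lemma pd_compose_linear:
  assumes "f differentiable_on UNIV" "bounded_linear l"
  shows "pd b (\<lambda>z. f (l z + c)) = (\<lambda>z. frechet_derivative f (at (l z + c)) (l b))"
proof
  fix z
  interpret bounded_linear l by fact
  have "((\<lambda>z. l z + c) has_derivative l) (at z)"
    by (auto intro!: derivative_eq_intros has_derivative bounded_linear_imp_has_derivative assms)
  from diff_chain_at[OF this has_derivative_frechet[OF assms(1)]]
  show "pd b (\<lambda>z. f (l z + c)) z = frechet_derivative f (at (l z + c)) (l b)"
    by (intro pd_eqI[THEN trans]) (auto simp: o_def)
qed

lemma differentiable_compose_linear:
  assumes "f differentiable_on UNIV" "bounded_linear l"
  shows "(\<lambda>z. f (l z + c)) differentiable_on UNIV"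
proof -
  have "(\<lambda>z. l z + c) differentiable_on UNIV"
    unfolding differentiable_on_def differentiable_def
    by (auto intro!: derivative_eq_intros bounded_linear_imp_has_derivative assms exI)
  then show ?thesis
    using assms(1) differentiable_chain_at[of "\<lambda>z. l z + c" _ f]
    by (auto simp: differentiable_on_def o_def)
qed

text \<open>The index is shifted: level 0 already asks for differentiability, so \<open>Ck k\<close>
  makes all partial derivatives of order up to k differentiable. Finite levels serve induction on k,
  which gives closure under sums and, by the Leibniz rule, under products; \<open>smooth\<close> is
  their conjunction.\<close>

primrec Ck :: "nat \<Rightarrow> ('a::euclidean_space \<Rightarrow> complex) \<Rightarrow> bool" where
  "Ck 0 f \<longleftrightarrow> f differentiable_on UNIV"
| "Ck (Suc k) f \<longleftrightarrow> f differentiable_on UNIV \<and> (\<forall>b\<in>Basis. Ck k (pd b f))"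

definition smooth :: "('a::euclidean_space \<Rightarrow> complex) \<Rightarrow> bool" where
  "smooth f \<longleftrightarrow> (\<forall>k. Ck k f)"

lemma Ck_diff: "Ck k f \<Longrightarrow> f differentiable_on UNIV"
  by (cases k) auto

lemma Ck_Suc_D: "Ck (Suc k) f \<Longrightarrow> Ck k f"
  by (induction k arbitrary: f) auto

lemma smooth_diff: "smooth f \<Longrightarrow> f differentiable_on UNIV"
  by (auto simp: smooth_def intro: Ck_diff)

lemma smooth_pd: "smooth f \<Longrightarrow> b \<in> Basis \<Longrightarrow> smooth (pd b f)"
  unfolding smooth_def using Ck.simps(2) by blast

lemma smoothI: "f differentiable_on UNIV \<Longrightarrow> (\<And>b. b \<in> Basis \<Longrightarrow> smooth (pd b f)) \<Longrightarrow> smooth f"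
  unfolding smooth_def by (metis Ck.simps not0_implies_Suc)

text \<open>Smoothness as a greatest fixed point: a class of differentiable functions that is stable
  under \<open>pd\<close> passes every level of \<open>Ck\<close>. This suits families whose
  derivatives are given by the same formula again, such as flat functions, exponentials and
  convolutions.\<close>

lemma smooth_coinduct:
  assumes "X f" "\<And>f. X f \<Longrightarrow> f differentiable_on UNIV"
    "\<And>f b. X f \<Longrightarrow> b \<in> Basis \<Longrightarrow> X (pd b f)"
  shows "smooth f"
proof -
  have "X f \<Longrightarrow> Ck k f" for k f
    by (induction k arbitrary: f) (use assms(2,3) in auto)
  then show ?thesis using assms(1) by (auto simp: smooth_def)
qed

lemma smooth_pds: "smooth f \<Longrightarrow> set bs \<subseteq> Basis \<Longrightarrow> smooth (pds bs f)"
  by (induction bs) (auto intro: smooth_pd)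

lemma smooth_iff_pds:
  "smooth f \<longleftrightarrow> (\<forall>bs. set bs \<subseteq> Basis \<longrightarrow> pds bs f differentiable_on UNIV)"
proof
  assume "smooth f" then show "\<forall>bs. set bs \<subseteq> Basis \<longrightarrow> pds bs f differentiable_on UNIV"
    by (auto intro!: smooth_diff smooth_pds)
next
  assume a: "\<forall>bs. set bs \<subseteq> Basis \<longrightarrow> pds bs f differentiable_on UNIV"
  show "smooth f"
  proof (rule smooth_coinduct[where X = "\<lambda>f. \<forall>bs. set bs \<subseteq> Basis \<longrightarrow> pds bs f differentiable_on UNIV"])
    show "\<forall>bs. set bs \<subseteq> Basis \<longrightarrow> pds bs f differentiable_on UNIV" by fact
  next
    fix f :: "'a \<Rightarrow> complex" assume "\<forall>bs. set bs \<subseteq> Basis \<longrightarrow> pds bs f differentiable_on UNIV"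
    then show "f differentiable_on UNIV" by (elim allE[of _ "[]"]) auto
  next
    fix f :: "'a \<Rightarrow> complex" and b :: 'a
    assume *: "\<forall>bs. set bs \<subseteq> Basis \<longrightarrow> pds bs f differentiable_on UNIV" "b \<in> Basis"
    show "\<forall>bs. set bs \<subseteq> Basis \<longrightarrow> pds bs (pd b f) differentiable_on UNIV"
    proof (intro allI impI)
      fix bs :: "'a list" assume "set bs \<subseteq> Basis"
      \<comment> \<open>\<open>foldr\<close> lets the last list entry act first, so the derivative
        already taken goes to the end of the list.\<close>
      then show "pds bs (pd b f) differentiable_on UNIV"
        using *(1)[rule_format, of "bs @ [b]"] *(2) by auto
    qed
  qed
qed

lemma Ck_const: "Ck k (\<lambda>z. c)"
  by (induction k arbitrary: c) (auto simp: pd_const)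

lemma smooth_const: "smooth (\<lambda>z. c)"
  by (auto simp: smooth_def Ck_const)

lemma Ck_add: "Ck k f \<Longrightarrow> Ck k g \<Longrightarrow> Ck k (\<lambda>z. f z + g z)"
  by (induction k arbitrary: f g) (auto simp: pd_add)

lemma Ck_mult: "Ck k f \<Longrightarrow> Ck k g \<Longrightarrow> Ck k (\<lambda>z. f z * g z)"
proof (induction k arbitrary: f g)
  case (Suc k)
  then show ?case
    using Ck_Suc_D[of k f] Ck_Suc_D[of k g] by (auto simp: pd_mult intro!: Ck_add)
qed auto

lemma smooth_add: "smooth f \<Longrightarrow> smooth g \<Longrightarrow> smooth (\<lambda>z. f z + g z)"
  by (auto simp: smooth_def Ck_add)

lemma smooth_mult: "smooth f \<Longrightarrow> smooth g \<Longrightarrow> smooth (\<lambda>z. f z * g z)"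
  by (auto simp: smooth_def Ck_mult)

lemma smooth_prod: "(\<And>i. i \<in> I \<Longrightarrow> smooth (f i)) \<Longrightarrow> smooth (\<lambda>z. \<Prod>i\<in>I. f i z)"
  by (induction I rule: infinite_finite_induct) (auto intro: smooth_const smooth_mult)

lemma smooth_compose_inner:
  fixes f :: "real \<Rightarrow> complex"
  assumes "smooth f"
  shows "smooth (\<lambda>x. f (x \<bullet> w + c))"
proof -
  have lin: "bounded_linear (\<lambda>x. x \<bullet> w)" by (rule bounded_linear_inner_left)
  have *: "Ck k f \<Longrightarrow> Ck k (\<lambda>x. f (x \<bullet> w + c))" for k f
  proof (induction k arbitrary: f)
    case 0 then show ?case using differentiable_compose_linear[OF _ lin] by simp
  next
    case (Suc k)
    have "pd b (\<lambda>x. f (x \<bullet> w + c)) = (\<lambda>x. of_real (b \<bullet> w) * pd 1 f (x \<bullet> w + c))" for b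
    proof
      fix x
      have "frechet_derivative f (at (x \<bullet> w + c)) (b \<bullet> w)
          = frechet_derivative f (at (x \<bullet> w + c)) ((b \<bullet> w) *\<^sub>R 1)" by simp
      also have "\<dots> = (b \<bullet> w) *\<^sub>R frechet_derivative f (at (x \<bullet> w + c)) 1"
        using Suc.prems by (intro linear_cmul linear_frechet_derivative)
           (auto simp: differentiable_on_def)
      finally show "pd b (\<lambda>x. f (x \<bullet> w + c)) x = of_real (b \<bullet> w) * pd 1 f (x \<bullet> w + c)"
        using pd_compose_linear[OF _ lin, of f] Suc.prems by (simp add: pd_def scaleR_conv_of_real)
    qed
    then show ?case using Suc differentiable_compose_linear[OF _ lin, of f]
      by (auto intro!: Ck_mult Ck_const)
  qed
  then show ?thesis using assms by (auto simp: smooth_def)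
qed

lemma pd_scale:
  fixes f :: "'a::euclidean_space \<Rightarrow> complex"
  assumes "f differentiable_on UNIV"
  shows "pd b (\<lambda>x. f (c *\<^sub>R x + a)) = (\<lambda>x. of_real c * pd b f (c *\<^sub>R x + a))"
proof
  fix x
  have lin: "bounded_linear (\<lambda>x::'a. c *\<^sub>R x)" by (rule bounded_linear_scaleR_right)
  have "frechet_derivative f (at (c *\<^sub>R x + a)) (c *\<^sub>R b)
      = c *\<^sub>R frechet_derivative f (at (c *\<^sub>R x + a)) b"
    using assms by (intro linear_cmul linear_frechet_derivative) (auto simp: differentiable_on_def)
  then show "pd b (\<lambda>x. f (c *\<^sub>R x + a)) x = of_real c * pd b f (c *\<^sub>R x + a)"
    using pd_compose_linear[OF assms lin] by (simp add: pd_def scaleR_conv_of_real)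
qed

lemma smooth_scale:
  fixes f :: "'a::euclidean_space \<Rightarrow> complex"
  assumes "smooth f"
  shows "smooth (\<lambda>x. f (c *\<^sub>R x + a))"
proof -
  have lin: "bounded_linear (\<lambda>x::'a. c *\<^sub>R x)" by (rule bounded_linear_scaleR_right)
  have *: "Ck k f \<Longrightarrow> Ck k (\<lambda>x. f (c *\<^sub>R x + a))" for k f
    by (induction k arbitrary: f)
       (auto simp: pd_scale differentiable_compose_linear[OF _ lin] intro!: Ck_mult Ck_const)
  then show ?thesis using assms by (auto simp: smooth_def)
qed

lemma pd_fst:
  fixes f :: "'a::euclidean_space \<Rightarrow> complex"
  assumes "f differentiable_on UNIV"
  shows "pd (b::'a \<times> real) (\<lambda>z. f (fst z)) = (\<lambda>z. frechet_derivative f (at (fst z)) (fst b))"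
  using pd_compose_linear[OF assms bounded_linear_fst, where c=0] by simp

lemma pd_snd:
  fixes f :: "real \<Rightarrow> complex"
  assumes "f differentiable_on UNIV"
  shows "pd (b::'a::euclidean_space \<times> real) (\<lambda>z. f (snd z)) = (\<lambda>z. frechet_derivative f (at (snd z)) (snd b))"
  using pd_compose_linear[OF assms bounded_linear_snd, where c=0] by simp

lemma frechet_zero: "f differentiable_on UNIV \<Longrightarrow> frechet_derivative f (at z) 0 = 0"
  by (intro linear_0 linear_frechet_derivative) (auto simp: differentiable_on_def)

lemma smooth_fst:
  fixes f :: "'a::euclidean_space \<Rightarrow> complex"
  assumes "smooth f"
  shows "smooth (\<lambda>z :: 'a \<times> real. f (fst z))"
proof -
  have *: "Ck k f \<Longrightarrow> Ck k (\<lambda>z :: 'a \<times> real. f (fst z))" for k and f :: "'a \<Rightarrow> complex"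
  proof (induction k arbitrary: f)
    case 0 then show ?case using differentiable_compose_linear[OF _ bounded_linear_fst, of f 0] by simp
  next
    case (Suc k)
    have "Ck k (pd b (\<lambda>z. f (fst z)))" if bB: "b \<in> Basis" for b :: "'a \<times> real"
    proof -
      have d: "f differentiable_on UNIV" using Suc.prems by simp
      consider "b = (fst b, 0)" "fst b \<in> Basis" | "b = (0, 1)" using bB by (cases b) (auto simp: Basis_prod_def zero_prod_def)
      then show ?thesis
      proof cases
        case 1
        then show ?thesis using Suc.IH[of "pd (fst b) f"] Suc.prems pd_fst[OF d, of b] by (auto simp: pd_def[abs_def])
      next
        case 2
        then show ?thesis using pd_fst[OF d, of b] by (simp add: frechet_zero[OF d] Ck_const)
      qed
    qed
    then show ?case using Suc.prems differentiable_compose_linear[OF _ bounded_linear_fst, of f 0] by simp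
  qed
  then show ?thesis using assms by (auto simp: smooth_def)
qed

lemma smooth_snd:
  fixes f :: "real \<Rightarrow> complex"
  assumes "smooth f"
  shows "smooth (\<lambda>z :: 'a::euclidean_space \<times> real. f (snd z))"
  using smooth_compose_inner[OF assms, of "(0,1) :: 'a \<times> real" 0] by (simp add: inner_prod_def)

section \<open>Flat functions and smooth bump functions\<close>

lemma pd_has_vector_derivative: "(f has_vector_derivative d) (at t) \<Longrightarrow> pd 1 f t = d"
  unfolding has_vector_derivative_def by (drule pd_eqI[where b=1]) simp

text \<open>The flat function exp(-1/t) with a polynomial in 1/t as prefactor; admitting all
  polynomials makes the family closed under differentiation.\<close>

definition exp_step :: "real poly \<Rightarrow> real \<Rightarrow> complex" where
  "exp_step p t = (if t > 0 then of_real (poly p (1 / t) * exp (- 1 / t)) else 0)"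

lemma poly_exp_tendsto_0: "((\<lambda>s. poly p s * exp (- s)) \<longlongrightarrow> (0::real)) at_top"
proof -
  have "((\<lambda>s. s ^ k / exp s) \<longlongrightarrow> (0::real)) at_top" for k by (rule tendsto_power_div_exp_0)
  then have "((\<lambda>s. \<Sum>i\<le>degree p. coeff p i * (s ^ i / exp s)) \<longlongrightarrow> (\<Sum>i\<le>degree p. coeff p i * 0)) at_top"
    by (intro tendsto_sum tendsto_mult tendsto_const)
  moreover have "(\<Sum>i\<le>degree p. coeff p i * (s ^ i / exp s)) = poly p s * exp (- s)" for s
    by (simp add: poly_altdef sum_distrib_right exp_minus divide_inverse mult.assoc)
  ultimately show ?thesis by simp
qed

lemma exp_step_tendsto_0: "((\<lambda>t. poly p (1 / t) * exp (- 1 / t)) \<longlongrightarrow> (0::real)) (at_right 0)"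
proof -
  have "filterlim (\<lambda>t::real. inverse t) at_top (at_right 0)" by (rule filterlim_inverse_at_top_right)
  from filterlim_compose[OF poly_exp_tendsto_0[of p] this] show ?thesis by (simp add: inverse_eq_divide)
qed

text \<open>With s = 1/t one has ds/dt = -s^2, so P(s) exp(-s) has the derivative (P - P')(s) s^2
  exp(-s); \<open>[:0,0,1:]\<close> is the factor s^2. At t = 0 both sides vanish because exp(-s)
  beats every polynomial.\<close>

lemma exp_step_derivative:
  "(exp_step p has_vector_derivative exp_step ((p - pderiv p) * [:0,0,1:]) t) (at t)"
proof -
  consider "t > 0" | "t < 0" | "t = 0" by linarith
  then show ?thesis
  proof cases
    case 1
    have "((\<lambda>t. poly p (1 / t) * exp (- 1 / t)) has_real_derivative
        poly ((p - pderiv p) * [:0,0,1:]) (1/t) * exp (-1/t)) (at t)"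
      using 1 by (auto intro!: derivative_eq_intros simp: field_simps power2_eq_square)
    then have "((\<lambda>t. complex_of_real (poly p (1 / t) * exp (- 1 / t))) has_vector_derivative
        of_real (poly ((p - pderiv p) * [:0,0,1:]) (1/t) * exp (-1/t))) (at t)"
      by (intro has_vector_derivative_of_real) (simp add: has_real_derivative_iff_has_vector_derivative)
    then have "(exp_step p has_vector_derivative
        of_real (poly ((p - pderiv p) * [:0,0,1:]) (1/t) * exp (-1/t))) (at t)"
      by (rule has_vector_derivative_transform_within_open[where S="{0<..}"]) (use 1 in \<open>auto simp: exp_step_def\<close>)
    then show ?thesis using 1 by (simp add: exp_step_def)
  next
    case 2
    have "(exp_step p has_vector_derivative 0) (at t)"
      by (rule has_vector_derivative_transform_within_open[where S="{..<0}" and f="\<lambda>_. 0"])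
         (use 2 in \<open>auto simp: exp_step_def\<close>)
    then show ?thesis using 2 by (simp add: exp_step_def)
  next
    case 3
    have "((\<lambda>t. exp_step p t /\<^sub>R t) \<longlongrightarrow> 0) (at 0)"
    proof (rule filterlim_split_at)
      show "((\<lambda>t. exp_step p t /\<^sub>R t) \<longlongrightarrow> 0) (at_left 0)"
        by (rule tendsto_eventually) (auto simp: exp_step_def eventually_at_filter)
      \<comment> \<open>The difference quotient at 0 divides by t, that is, multiplies by s = 1/t,
        which leads to an expression of the same form with one more factor s in the
        polynomial.\<close>
      have "((\<lambda>t. complex_of_real (poly (p * [:0,1:]) (1 / t) * exp (- 1 / t))) \<longlongrightarrow> of_real 0) (at_right 0)"
        by (intro tendsto_of_real exp_step_tendsto_0)
      then have "((\<lambda>t. complex_of_real (poly (p * [:0,1:]) (1 / t) * exp (- 1 / t))) \<longlongrightarrow> 0) (at_right 0)" by simp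
      then show "((\<lambda>t. exp_step p t /\<^sub>R t) \<longlongrightarrow> 0) (at_right 0)"
        by (rule Lim_transform_eventually)
           (auto simp: exp_step_def eventually_at_filter scaleR_conv_of_real field_simps)
    qed
    then have "((\<lambda>t. norm (exp_step p t /\<^sub>R t)) \<longlongrightarrow> 0) (at 0)"
      by (rule tendsto_norm_zero)
    then have "(exp_step p has_vector_derivative 0) (at 0)"
      unfolding has_vector_derivative_def has_derivative_iff_norm
      by (simp add: exp_step_def[of _ 0] divide_inverse mult.commute)
    then show ?thesis using 3 by (simp add: exp_step_def)
  qed
qed

lemma smooth_exp_step: "smooth (exp_step p)"
proof (rule smooth_coinduct[where X = "\<lambda>f. \<exists>p. f = exp_step p"])
  show "f differentiable_on UNIV" if "\<exists>p. f = exp_step p" for f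
    using that exp_step_derivative unfolding differentiable_on_def differentiable_def has_vector_derivative_def by blast
  show "\<exists>p. pd b f = exp_step p" if "\<exists>p. f = exp_step p" "b \<in> Basis" for f b
    using that pd_has_vector_derivative[OF exp_step_derivative] by (metis Basis_real_def singletonD ext)
qed auto

definition step :: "real \<Rightarrow> real" where
  "step t = (if t > 0 then exp (- 1 / t) else 0)"

lemma smooth_step: "smooth (\<lambda>t. of_real (step t))"
  using smooth_exp_step[of 1] by (simp add: exp_step_def[abs_def] step_def if_distrib cong: if_cong)

lemma step_bounds: "0 \<le> step t" "step t \<le> 1"
  by (auto simp: step_def)

text \<open>The parameter k is a steepness: as k grows the function converges to the indicator of
  the open box while staying between 0 and 1. Integrals over boxes are thus limits of integrals
  against test functions. At k = 0 it is identically 0.\<close>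

definition bump :: "nat \<Rightarrow> 'a::euclidean_space \<Rightarrow> 'a \<Rightarrow> 'a \<Rightarrow> real" where
  "bump k a b x = (\<Prod>i\<in>Basis. step (real k * (x \<bullet> i - a \<bullet> i)) * step (real k * (b \<bullet> i - x \<bullet> i)))"

lemma smooth_bump: "smooth (\<lambda>x. of_real (bump k a b x))"
proof -
  have "smooth (\<lambda>x::'a. complex_of_real (step (real k * (x \<bullet> i - a \<bullet> i))) * of_real (step (real k * (b \<bullet> i - x \<bullet> i))))" for i
    using smooth_mult[OF smooth_compose_inner[OF smooth_step, of "real k *\<^sub>R i" "- real k * (a \<bullet> i)"]
      smooth_compose_inner[OF smooth_step, of "- real k *\<^sub>R i" "real k * (b \<bullet> i)"]]
    by (simp add: algebra_simps)
  then show ?thesis unfolding bump_def of_real_prod of_real_mult by (intro smooth_prod)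
qed

lemma bump_bounds: "0 \<le> bump k a b x" "bump k a b x \<le> 1"
  unfolding bump_def by (auto intro!: prod_nonneg prod_le_1 mult_nonneg_nonneg mult_le_one step_bounds)

lemma bump_eq_0: "x \<notin> box a b \<Longrightarrow> bump k a b x = 0"
  unfolding bump_def mem_box by (auto simp: step_def zero_less_mult_iff)

lemma bump_pos: "x \<in> box a b \<Longrightarrow> k > 0 \<Longrightarrow> bump k a b x > 0"
  unfolding bump_def mem_box by (intro prod_pos) (auto simp: step_def)

lemma bump_tendsto: "(\<lambda>k. bump k a b x) \<longlonglongrightarrow> indicator (box a b) x"
proof (cases "x \<in> box a b")
  case True
  have *: "(\<lambda>k. step (real k * c)) \<longlonglongrightarrow> 1" if "c > 0" for c
  proof -
    have "(\<lambda>k. exp (- (1 / c) * (1 / real k))) \<longlonglongrightarrow> exp (- (1/c) * 0)"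
      by (intro tendsto_intros lim_1_over_n)
    then have "(\<lambda>k. exp (- (1 / c) * (1 / real k))) \<longlonglongrightarrow> 1" by simp
    then show ?thesis
      by (rule Lim_transform_eventually)
         (use that in \<open>auto simp: step_def field_simps intro!: eventually_mono[OF eventually_gt_at_top[of 0]]\<close>)
  qed
  have "(\<lambda>k. bump k a b x) \<longlonglongrightarrow> (\<Prod>i\<in>(Basis::'a set). 1 * 1)"
    unfolding bump_def by (intro tendsto_prod tendsto_mult *) (use True in \<open>auto simp: mem_box\<close>)
  then show ?thesis using True by simp
next
  case False then show ?thesis by (simp add: bump_eq_0)
qed

lemma test_fun_iff: "test_fun f \<longleftrightarrow> smooth f \<and> bounded {z. f z \<noteq> 0}"
  unfolding test_fun_def smooth_iff_pds by (auto simp: bounded_subset[OF compact_imp_bounded closure_subset])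

lemma test_fun_smooth: "test_fun f \<Longrightarrow> smooth f" by (simp add: test_fun_iff)

lemma test_fun_bump: "test_fun (\<lambda>x. of_real (bump k a b x))"
  unfolding test_fun_iff
  by (auto simp: smooth_bump intro!: bounded_subset[OF bounded_box[of a b]] dest: contrapos_nn[OF _ bump_eq_0] )

section \<open>Square-integrable functions and convolution\<close>

text \<open>The square of the L^2 norm, kept in \<open>ennreal\<close> so that Tonelli, Fatou and
  all inequalities need no integrability conditions.\<close>

definition n2 :: "('a::euclidean_space \<Rightarrow> complex) \<Rightarrow> ennreal" where
  "n2 f = (\<integral>\<^sup>+x. ennreal ((norm (f x))\<^sup>2) \<partial>lborel)"

text \<open>A Borel counterpart of \<open>L2_fun\<close>: slices of Borel functions are Borel,
  whereas slices of a Lebesgue measurable function need not be measurable.\<close>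

definition L2 :: "('a::euclidean_space \<Rightarrow> complex) \<Rightarrow> bool" where
  "L2 f \<longleftrightarrow> f \<in> borel_measurable borel \<and> n2 f < \<infinity>"

lemma L2_measurable[measurable_dest]: "L2 f \<Longrightarrow> f \<in> borel_measurable borel"
  by (simp add: L2_def)

lemma L2_iff_integrable:
  "L2 f \<longleftrightarrow> f \<in> borel_measurable borel \<and> integrable lborel (\<lambda>x. (norm (f x))\<^sup>2)"
  unfolding L2_def n2_def by (auto simp: integrable_iff_bounded)

lemma sq_sum_le: "(norm (a + b :: complex))\<^sup>2 \<le> 2 * (norm a)\<^sup>2 + 2 * (norm b)\<^sup>2"
proof -
  have "(norm (a + b))\<^sup>2 \<le> (norm a + norm b)\<^sup>2" by (intro power_mono norm_triangle_ineq) auto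
  also have "\<dots> \<le> 2 * (norm a)\<^sup>2 + 2 * (norm b)\<^sup>2"
    using sum_squares_bound[of "norm a" "norm b"] by (simp add: power2_sum)
  finally show ?thesis .
qed

text \<open>Young's inequality 2ab \<le> \<kappa> a^2 + b^2/\<kappa>. The factor 1 + \<kappa> on the
  main term can be brought as close to 1 as wanted, which is what absorption with a constant below 1
  demands.\<close>

lemma sq_sum_le_eps:
  assumes "\<kappa> > 0"
  shows "(norm (a + b :: complex))\<^sup>2 \<le> (1 + \<kappa>) * (norm a)\<^sup>2 + (1 + 1 / \<kappa>) * (norm b)\<^sup>2"
proof -
  have "(norm (a + b))\<^sup>2 \<le> (norm a + norm b)\<^sup>2" by (intro power_mono norm_triangle_ineq) auto
  also have "2 * norm a * norm b \<le> \<kappa> * (norm a)\<^sup>2 + (norm b)\<^sup>2 / \<kappa>"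
    using sum_squares_bound[of "sqrt \<kappa> * norm a" "norm b / sqrt \<kappa>"] assms
    by (simp add: power_mult_distrib power_divide)
  then have "(norm a + norm b)\<^sup>2 \<le> (1 + \<kappa>) * (norm a)\<^sup>2 + (1 + 1 / \<kappa>) * (norm b)\<^sup>2"
    by (simp add: power2_sum algebra_simps)
  finally show ?thesis .
qed

lemma n2_add:
  assumes [measurable]: "f \<in> borel_measurable borel" "g \<in> borel_measurable borel"
  shows "n2 (\<lambda>x. f x + g x) \<le> 2 * n2 f + 2 * n2 g"
proof -
  have "n2 (\<lambda>x. f x + g x) \<le> (\<integral>\<^sup>+x. 2 * ennreal ((norm (f x))\<^sup>2) + 2 * ennreal ((norm (g x))\<^sup>2) \<partial>lborel)"
    unfolding n2_def
    by (intro nn_integral_mono) (simp flip: ennreal_plus ennreal_mult'' ennreal_numeral add: sq_sum_le)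
  also have "\<dots> = 2 * n2 f + 2 * n2 g"
    unfolding n2_def by (simp add: nn_integral_add nn_integral_cmult)
  finally show ?thesis .
qed

lemma L2_add: "L2 f \<Longrightarrow> L2 g \<Longrightarrow> L2 (\<lambda>x. f x + g x)"
  using n2_add[of f g] by (auto simp: L2_def ennreal_mult_less_top intro: le_less_trans)

lemma L2_bound:
  assumes "L2 g" "f \<in> borel_measurable borel" "\<And>x. norm (f x) \<le> norm (g x)"
  shows "L2 f"
  using assms unfolding L2_iff_integrable
  by (auto intro!: Bochner_Integration.integrable_bound[of lborel "\<lambda>x. (norm (g x))\<^sup>2"] AE_I2 power_mono simp: power_mono)

lemma L2_cmult: "L2 f \<Longrightarrow> L2 (\<lambda>x. c * f x)"
  unfolding L2_iff_integrable by (auto simp: norm_mult power_mult_distrib)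

lemma L2_bounded_mult:
  assumes "L2 f" "g \<in> borel_measurable borel" "\<And>x. norm (g x) \<le> B"
  shows "L2 (\<lambda>x. g x * f x)"
proof (rule L2_bound[OF L2_cmult[OF assms(1), of "of_real B"]])
  have "B \<ge> 0" using assms(3)[of 0] norm_ge_zero order_trans by blast
  then show "norm (g x * f x) \<le> norm (of_real B * f x)" for x
    using assms(3)[of x] by (auto simp: norm_mult mult_right_mono)
qed (use assms in measurable)

lemma L2_diff: "L2 f \<Longrightarrow> L2 g \<Longrightarrow> L2 (\<lambda>x. f x - g x)"
  using L2_add[of f "\<lambda>x. (-1) * g x"] L2_cmult[of g "-1"] by simp

lemma L2_zero: "L2 (\<lambda>x. 0)"
  by (simp add: L2_def n2_def)

lemma L2_sum: "(\<And>i. i \<in> I \<Longrightarrow> L2 (f i)) \<Longrightarrow> L2 (\<lambda>x. \<Sum>i\<in>I. f i x)"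
  by (induction I rule: infinite_finite_induct) (auto intro: L2_add L2_zero)

lemma L2_mult_integrable:
  assumes "L2 f" "L2 g" shows "integrable lborel (\<lambda>x. f x * g x)"
proof (rule Bochner_Integration.integrable_bound[of lborel "\<lambda>x. (norm (f x))\<^sup>2 + (norm (g x))\<^sup>2"])
  show "AE x in lborel. norm (f x * g x) \<le> norm ((norm (f x))\<^sup>2 + (norm (g x))\<^sup>2)"
  proof (rule AE_I2)
    fix x
    have "2 * (norm (f x) * norm (g x)) \<le> (norm (f x))\<^sup>2 + (norm (g x))\<^sup>2"
      using sum_squares_bound[of "norm (f x)" "norm (g x)"] by simp
    moreover have "0 \<le> norm (f x) * norm (g x)" by simp
    ultimately have "norm (f x) * norm (g x) \<le> (norm (f x))\<^sup>2 + (norm (g x))\<^sup>2" by linarith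
    then show "norm (f x * g x) \<le> norm ((norm (f x))\<^sup>2 + (norm (g x))\<^sup>2)" by (simp add: norm_mult)
  qed
qed (use assms in \<open>auto simp: L2_iff_integrable\<close>)

lemma bounded_support_integrable:
  assumes "f \<in> borel_measurable borel" "\<And>x. norm (f x) \<le> B" "bounded {x. f x \<noteq> (0::complex)}"
  shows "integrable lborel f" "L2 f"
proof -
  obtain R where R: "{x. f x \<noteq> 0} \<subseteq> cball 0 R" using bounded_subset_ballD[OF assms(3)] ball_subset_cball by (metis subset_trans)
  define I where "I = (\<lambda>x::'a. if norm x \<le> R then 1 else (0::real))"
  have fin: "integrable lborel I"
  proof -
    have "I = indicator (cball 0 R)" by (auto simp: I_def indicator_def fun_eq_iff)
    then show ?thesis
      using integrable_real_indicator[of "cball 0 R :: 'a set" lborel] emeasure_bounded_finite[of "cball 0 R :: 'a set"]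
      by simp
  qed
  have B: "norm (f x) \<le> norm (B * I x)" for x
  proof (cases "f x = 0")
    case False
    then have "norm x \<le> R" using R by auto
    then show ?thesis using assms(2)[of x] by (simp add: I_def)
  qed simp
  show "integrable lborel f"
    by (rule Bochner_Integration.integrable_bound[OF integrable_mult_right[OF fin, of B]])
       (use assms(1) B in auto)
  have B2: "norm ((norm (f x))\<^sup>2) \<le> norm (B\<^sup>2 * I x)" for x
    using power_mono[OF B[of x], of 2] by (auto simp: I_def power_mult_distrib split: if_splits)
  have "integrable lborel (\<lambda>x. (norm (f x))\<^sup>2)"
    by (rule Bochner_Integration.integrable_bound[OF integrable_mult_right[OF fin, of "B\<^sup>2"]])
       (use assms(1) B2 in auto)
  then show "L2 f" using assms(1) by (simp add: L2_iff_integrable)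
qed

section \<open>Calculus and boundedness of test functions\<close>

lemma smooth_continuous: "smooth f \<Longrightarrow> continuous_on UNIV f"
  by (intro differentiable_imp_continuous_on smooth_diff)

lemma smooth_measurable: "smooth f \<Longrightarrow> f \<in> borel_measurable borel"
  by (intro borel_measurable_continuous_onI smooth_continuous)

lemma test_fun_mult: "test_fun f \<Longrightarrow> smooth g \<Longrightarrow> test_fun (\<lambda>x. f x * g x)"
  unfolding test_fun_iff by (auto intro!: smooth_mult elim: bounded_subset)

lemma test_fun_add: "test_fun f \<Longrightarrow> test_fun g \<Longrightarrow> test_fun (\<lambda>x. f x + g x)"
  unfolding test_fun_iff
  by (auto intro!: smooth_add intro: bounded_subset[of "{x. f x \<noteq> 0} \<union> {x. g x \<noteq> 0}"])

lemma test_fun_cmult: "test_fun f \<Longrightarrow> test_fun (\<lambda>x. c * f x)"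
  using test_fun_mult[OF _ smooth_const, of f c] by (simp add: mult.commute)

lemma test_fun_pd:
  assumes "test_fun f" "b \<in> Basis" shows "test_fun (pd b f)"
proof -
  have "pd b f z = 0" if "z \<notin> closure {z. f z \<noteq> 0}" for z
  proof -
    have "(f has_derivative (\<lambda>_. 0)) (at z)"
    proof (rule has_derivative_transform_within_open[where f="\<lambda>_. 0" and s="- closure {z. f z \<noteq> 0}"])
      show "0 = f x" if "x \<in> - closure {z. f z \<noteq> 0}" for x
        using that closure_subset[of "{z. f z \<noteq> 0}"] by auto
    qed (use that in auto)
    then show ?thesis by (rule pd_eqI)
  qed
  then have "{z. pd b f z \<noteq> 0} \<subseteq> closure {z. f z \<noteq> 0}" by blast
  then show ?thesis using assms unfolding test_fun_iff
    by (auto intro: smooth_pd bounded_subset bounded_closure)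
qed

lemma test_fun_scale:
  fixes f :: "'a::euclidean_space \<Rightarrow> complex"
  assumes "test_fun f" "c \<noteq> 0" shows "test_fun (\<lambda>x. f (c *\<^sub>R x + a))"
proof -
  have "{x. f (c *\<^sub>R x + a) \<noteq> 0} = (\<lambda>y. (1/c) *\<^sub>R y + (- (1/c) *\<^sub>R a)) ` {y. f y \<noteq> 0}"
  proof safe
    fix x assume "f (c *\<^sub>R x + a) \<noteq> 0"
    then show "x \<in> (\<lambda>y. (1/c) *\<^sub>R y + (- (1/c) *\<^sub>R a)) ` {y. f y \<noteq> 0}"
      using assms(2) by (intro image_eqI[of _ _ "c *\<^sub>R x + a"]) (auto simp: scaleR_add_right)
  qed (use assms(2) in \<open>auto simp: scaleR_add_right scaleR_diff_right\<close>)
  moreover have "bounded ((\<lambda>y. (1/c) *\<^sub>R y + (- (1/c) *\<^sub>R a)) ` {y. f y \<noteq> 0})"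
    using bounded_translation[OF bounded_scaling, of "{y. f y \<noteq> 0}" "- (1/c) *\<^sub>R a" "1/c"] assms(1)
    by (simp add: test_fun_iff image_image add.commute)
  ultimately show ?thesis using assms by (auto simp: test_fun_iff intro: smooth_scale)
qed

lemma test_fun_bounded:
  assumes "test_fun f" obtains B where "B > 0" "\<And>x. norm (f x) \<le> B"
proof -
  obtain R where R: "{x. f x \<noteq> 0} \<subseteq> cball 0 R" using assms bounded_subset_ballD ball_subset_cball unfolding test_fun_iff by (metis subset_trans)
  have "compact (f ` cball 0 R)"
    by (intro compact_continuous_image continuous_on_subset[OF smooth_continuous])
       (use assms in \<open>auto simp: test_fun_iff\<close>)
  then obtain B where B: "B > 0" "\<And>x. x \<in> cball 0 R \<Longrightarrow> norm (f x) \<le> B"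
    using compact_imp_bounded bounded_pos by (metis imageI)
  have "norm (f x) \<le> B" for x using B R by (cases "f x = 0") auto
  then show thesis using that B by blast
qed

lemma test_fun_measurable: "test_fun f \<Longrightarrow> f \<in> borel_measurable borel"
  by (simp add: test_fun_iff smooth_measurable)

lemma test_fun_integrable:
  assumes "test_fun f" shows "integrable lborel f"
  using test_fun_bounded[OF assms] bounded_support_integrable(1)[OF test_fun_measurable[OF assms]] assms
  unfolding test_fun_iff by metis

lemma test_fun_L2:
  assumes "test_fun f" shows "L2 f"
  using test_fun_bounded[OF assms] bounded_support_integrable(2)[OF test_fun_measurable[OF assms]] assms
  unfolding test_fun_iff by metis

lemma frechet_derivative_Basis:
  assumes "f differentiable_on UNIV"
  shows "frechet_derivative f (at x) k = (\<Sum>b\<in>Basis. of_real (k \<bullet> b) * pd b f x)"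
proof -
  have lin: "linear (frechet_derivative f (at x))"
    using assms by (intro linear_frechet_derivative) (auto simp: differentiable_on_def)
  have "frechet_derivative f (at x) k = frechet_derivative f (at x) (\<Sum>b\<in>Basis. (k \<bullet> b) *\<^sub>R b)"
    by (simp add: euclidean_representation)
  also have "\<dots> = (\<Sum>b\<in>Basis. (k \<bullet> b) *\<^sub>R frechet_derivative f (at x) b)"
    by (simp add: linear_sum[OF lin] linear_cmul[OF lin])
  finally show ?thesis by (simp add: pd_def scaleR_conv_of_real)
qed

text \<open>Partial derivatives of a test function are test functions, hence bounded; the mean value
  inequality then gives a global Lipschitz constant. It supplies the dominating function when an
  integral is differentiated.\<close>

lemma test_fun_lipschitz:
  fixes f :: "'a::euclidean_space \<Rightarrow> complex"
  assumes "test_fun f"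
  obtains B where "B > 0" "\<And>x y. norm (f x - f y) \<le> B * norm (x - y)"
    "\<And>x k. norm (frechet_derivative f (at x) k) \<le> B * norm k"
proof -
  have d: "f differentiable_on UNIV" using assms by (simp add: test_fun_iff smooth_diff)
  have "\<exists>C>0. \<forall>x. norm (pd b f x) \<le> C" if "b \<in> Basis" for b
    using test_fun_bounded[OF test_fun_pd[OF assms that]] by metis
  then obtain C where C: "\<And>b. b \<in> Basis \<Longrightarrow> C b > 0 \<and> (\<forall>x. norm (pd b f x) \<le> C b)" by metis
  define B where "B = (\<Sum>b\<in>(Basis::'a set). C b)"
  have B: "B > 0" unfolding B_def using C by (intro sum_pos) auto
  have D: "norm (frechet_derivative f (at x) k) \<le> B * norm k" for x k
  proof -
    have "norm (frechet_derivative f (at x) k) \<le> (\<Sum>b\<in>Basis. norm (of_real (k \<bullet> b) * pd b f x))"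
      unfolding frechet_derivative_Basis[OF d] by (rule norm_sum)
    also have "\<dots> \<le> (\<Sum>b\<in>Basis. C b * norm k)"
    proof (rule sum_mono)
      fix b :: 'a assume b: "b \<in> Basis"
      show "norm (of_real (k \<bullet> b) * pd b f x) \<le> C b * norm k"
        using mult_mono[OF C[OF b, THEN conjunct2, rule_format, of x] Basis_le_norm[OF b, of k]] C[OF b]
        by (simp add: norm_mult mult.commute)
    qed
    finally show ?thesis by (simp add: B_def sum_distrib_right)
  qed
  have "norm (f x - f y) \<le> B * norm (x - y)" for x y
    by (rule differentiable_bound[where S=UNIV and f'="\<lambda>x. frechet_derivative f (at x)"])
       (use D has_derivative_frechet[OF d] in \<open>auto intro!: onorm_bound B less_imp_le[OF B]\<close>)
  then show thesis using that B D by blast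
qed

section \<open>Convolution with a test function\<close>

definition conv :: "('a::euclidean_space \<Rightarrow> complex) \<Rightarrow> ('a \<Rightarrow> complex) \<Rightarrow> 'a \<Rightarrow> complex" where
  "conv \<psi> h x = (LINT y|lborel. \<psi> (x - y) * h y)"

lemma conv_integrable:
  assumes "test_fun \<psi>" "integrable lborel h"
  shows "integrable lborel (\<lambda>y. \<psi> (x - y) * h y)"
proof -
  obtain B where B: "\<And>x. norm (\<psi> x) \<le> B" using test_fun_bounded[OF assms(1)] by blast
  have [measurable]: "\<psi> \<in> borel_measurable borel" "h \<in> borel_measurable borel"
    using assms by (auto intro: smooth_measurable test_fun_smooth)
  show ?thesis
    by (rule Bochner_Integration.integrable_bound[OF integrable_mult_right[OF integrable_norm[OF assms(2)], of B]])
       (auto intro!: AE_I2 order_trans[OF mult_right_mono[OF B] abs_ge_self] simp: norm_mult)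
qed

text \<open>Differentiation under the integral sign. All regularity comes from \<psi>, since h is
  merely integrable; dominated convergence along sequences takes the place of a uniform Taylor
  estimate.\<close>

lemma conv_has_derivative:
  fixes \<psi> :: "'a::euclidean_space \<Rightarrow> complex"
  assumes \<psi>: "test_fun \<psi>" and h: "integrable lborel h"
  shows "(conv \<psi> h has_derivative (\<lambda>k. \<Sum>b\<in>Basis. of_real (k \<bullet> b) * conv (pd b \<psi>) h x)) (at x)"
proof -
  obtain B where B: "B > 0" "\<And>x y. norm (\<psi> x - \<psi> y) \<le> B * norm (x - y)"
    "\<And>x k. norm (frechet_derivative \<psi> (at x) k) \<le> B * norm k"
    using test_fun_lipschitz[OF \<psi>] by blast
  have d: "\<psi> differentiable_on UNIV" using \<psi> by (simp add: test_fun_iff smooth_diff)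
  have [measurable]: "\<psi> \<in> borel_measurable borel" "h \<in> borel_measurable borel"
    using assms by (auto intro: smooth_measurable test_fun_smooth)
  have pdm: "pd b \<psi> \<in> borel_measurable borel" if "b \<in> Basis" for b
    using test_fun_pd[OF \<psi> that] by (auto intro: smooth_measurable test_fun_smooth)
  let ?D = "\<lambda>k. \<Sum>b\<in>Basis. of_real (k \<bullet> b) * conv (pd b \<psi>) h x"
  have lin: "bounded_linear ?D"
    unfolding scaleR_conv_of_real[symmetric]
    by (rule bounded_linear_sum, rule bounded_linear_compose[OF bounded_linear_scaleR_left bounded_linear_inner_left])
  have "((\<lambda>y. norm (conv \<psi> h y - conv \<psi> h x - ?D (y - x)) / norm (y - x)) \<longlongrightarrow> 0) (at x)"
    unfolding tendsto_at_iff_sequentially comp_def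
  proof (intro allI impI)
    fix X :: "nat \<Rightarrow> 'a" assume X: "\<forall>i. X i \<in> UNIV - {x}" "X \<longlonglongrightarrow> x"
    \<comment> \<open>The first-order Taylor remainder of \<psi> at x - y, divided by the length of
      the increment. It tends to 0 for each y and is bounded by 2B: one B for the increment of
      \<psi>, one for its linear part.\<close>
    define r where "r i y = (\<psi> (X i - y) - \<psi> (x - y) - frechet_derivative \<psi> (at (x - y)) (X i - x)) / of_real (norm (X i - x))" for i y
    have r_meas: "r i \<in> borel_measurable borel" for i
      unfolding r_def frechet_derivative_Basis[OF d]
    proof -
      have m0: "(\<lambda>y. \<psi> (z - y)) \<in> borel_measurable borel" for z
        by (rule measurable_compose[of _ borel borel]) simp_all
      have that_m: "(\<lambda>y. pd b \<psi> (x - y)) \<in> borel_measurable borel" if "b \<in> Basis" for b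
        by (rule measurable_compose[OF _ pdm[OF that]]) simp
      have "(\<lambda>y. \<Sum>b\<in>Basis. of_real ((X i - x) \<bullet> b) * pd b \<psi> (x - y)) \<in> borel_measurable borel"
        by (rule borel_measurable_sum, rule borel_measurable_times[OF borel_measurable_const that_m])
      from borel_measurable_divide[OF borel_measurable_diff[OF borel_measurable_diff[OF m0 m0] this] borel_measurable_const]
      show "(\<lambda>y. (\<psi> (X i - y) - \<psi> (x - y) - (\<Sum>b\<in>Basis. of_real ((X i - x) \<bullet> b) * pd b \<psi> (x - y))) /
          of_real (norm (X i - x))) \<in> borel_measurable borel" .
    qed
    have "(\<lambda>i. LINT y|lborel. r i y * h y) \<longlonglongrightarrow> (LINT y|(lborel :: 'a measure). 0)"
    proof (rule integral_dominated_convergence[where s="\<lambda>i y. r i y * h y" and f="\<lambda>y. 0" and w="\<lambda>y. 2 * B * norm (h y)"])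
      show "AE y in lborel. norm (r i y * h y) \<le> 2 * B * norm (h y)" for i
      proof (rule AE_I2)
        fix y
        have "norm (\<psi> (X i - y) - \<psi> (x - y) - frechet_derivative \<psi> (at (x - y)) (X i - x))
          \<le> B * norm (X i - x) + B * norm (X i - x)"
          by (rule order_trans[OF norm_triangle_ineq4]) (use add_mono[OF B(2)[of "X i - y" "x - y"] B(3)[of "x - y" "X i - x"]] in simp)
        then have "norm (r i y) \<le> 2 * B"
          using X(1)[rule_format, of i] unfolding r_def by (simp add: norm_divide divide_le_eq)
        then show "norm (r i y * h y) \<le> 2 * B * norm (h y)" by (simp add: norm_mult mult_right_mono)
      qed
      have "(\<lambda>i. r i y) \<longlonglongrightarrow> 0" for y
      proof -
        have "((\<lambda>z. norm (\<psi> z - \<psi> (x - y) - frechet_derivative \<psi> (at (x - y)) (z - (x - y))) / norm (z - (x - y))) \<longlongrightarrow> 0) (at (x - y))"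
          using has_derivative_frechet[OF d, of "x - y"] by (simp add: has_derivative_iff_norm)
        moreover have "filterlim (\<lambda>i. X i - y) (at (x - y)) sequentially"
          using X by (auto simp: filterlim_at intro!: tendsto_diff tendsto_const always_eventually)
        ultimately have "(\<lambda>i. norm (\<psi> (X i - y) - \<psi> (x - y) - frechet_derivative \<psi> (at (x - y)) (X i - y - (x - y))) / norm (X i - y - (x - y))) \<longlonglongrightarrow> 0"
          by (rule filterlim_compose)
        then have "(\<lambda>i. norm (r i y)) \<longlonglongrightarrow> 0" unfolding r_def by (simp add: norm_divide)
        then show ?thesis by (rule tendsto_norm_zero_cancel)
      qed
      then show "AE y in lborel. (\<lambda>i. r i y * h y) \<longlonglongrightarrow> 0"
        by (intro AE_I2 tendsto_mult_left_zero)
      show "(\<lambda>y. r i y * h y) \<in> borel_measurable lborel" for i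
        using borel_measurable_times[OF r_meas, of h] by simp
    qed (use h in auto)
    then have "(\<lambda>i. norm (LINT y|lborel. r i y * h y)) \<longlonglongrightarrow> 0" by (simp add: tendsto_norm_zero)
    moreover have "norm (LINT y|lborel. r i y * h y) = norm (conv \<psi> h (X i) - conv \<psi> h x - ?D (X i - x)) / norm (X i - x)" for i
    proof -
      have I: "integrable lborel (\<lambda>y. of_real ((X i - x) \<bullet> b) * (pd b \<psi> (x - y) * h y))" if "b \<in> Basis" for b
        by (intro integrable_mult_right conv_integrable test_fun_pd \<psi> h that)
      have "(LINT y|lborel. r i y * h y) = (LINT y|lborel. (\<psi> (X i - y) * h y - \<psi> (x - y) * h y -
          (\<Sum>b\<in>Basis. of_real ((X i - x) \<bullet> b) * (pd b \<psi> (x - y) * h y))) / of_real (norm (X i - x)))"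
        unfolding r_def frechet_derivative_Basis[OF d]
        by (intro Bochner_Integration.integral_cong refl)
           (simp only: times_divide_eq_left left_diff_distrib sum_distrib_right mult.assoc)
      also have "\<dots> = (conv \<psi> h (X i) - conv \<psi> h x - ?D (X i - x)) / of_real (norm (X i - x))"
        unfolding conv_def using I
        by (simp add: conv_integrable[OF \<psi> h] Bochner_Integration.integral_sum)
      finally show ?thesis by (simp add: norm_divide)
    qed
    ultimately show "(\<lambda>i. norm (conv \<psi> h (X i) - conv \<psi> h x - ?D (X i - x)) / norm (X i - x)) \<longlonglongrightarrow> 0" by simp
  qed
  then show ?thesis using lin by (simp add: has_derivative_iff_norm)
qed

lemma pd_conv:
  assumes "test_fun \<psi>" "integrable lborel h" "b \<in> Basis"
  shows "pd b (conv \<psi> h) = conv (pd b \<psi>) h"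
proof
  fix x
  have "pd b (conv \<psi> h) x = (\<Sum>c\<in>Basis. of_real (b \<bullet> c) * conv (pd c \<psi>) h x)"
    by (rule pd_eqI[OF conv_has_derivative]) fact+
  also have "\<dots> = (\<Sum>c\<in>Basis. if c = b then conv (pd b \<psi>) h x else 0)"
    using assms(3) by (intro sum.cong) (auto simp: inner_Basis)
  finally show "pd b (conv \<psi> h) x = conv (pd b \<psi>) h x" using assms(3) by simp
qed

lemma smooth_conv:
  assumes "test_fun \<psi>" "integrable lborel h" shows "smooth (conv \<psi> h)"
proof (rule smooth_coinduct[where X="\<lambda>f. \<exists>\<psi>. test_fun \<psi> \<and> f = conv \<psi> h"])
  show "f differentiable_on UNIV" if "\<exists>\<psi>. test_fun \<psi> \<and> f = conv \<psi> h" for f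
    using conv_has_derivative[OF _ assms(2)] that unfolding differentiable_on_def differentiable_def by blast
  show "\<exists>\<psi>. test_fun \<psi> \<and> pd b f = conv \<psi> h" if "\<exists>\<psi>. test_fun \<psi> \<and> f = conv \<psi> h" "b \<in> Basis" for f b
    using that pd_conv[OF _ assms(2)] test_fun_pd by blast
qed (use assms in auto)

lemma test_fun_conv:
  assumes "test_fun \<psi>" "integrable lborel h" "bounded {x. h x \<noteq> 0}"
  shows "test_fun (conv \<psi> h)"
proof -
  have "{x. conv \<psi> h x \<noteq> 0} \<subseteq> {u + v |u v. u \<in> {x. \<psi> x \<noteq> 0} \<and> v \<in> {x. h x \<noteq> 0}}"
  proof (clarify, rule ccontr)
    fix x assume "conv \<psi> h x \<noteq> 0" and n: "\<not> (\<exists>u v. x = u + v \<and> u \<in> {x. \<psi> x \<noteq> 0} \<and> v \<in> {x. h x \<noteq> 0})"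
    have "\<psi> (x - y) * h y = 0" for y using n[simplified] by (metis add.commute add_diff_cancel_left' diff_add_cancel mult_eq_0_iff)
    then have "(\<lambda>y. \<psi> (x - y) * h y) = (\<lambda>_. 0)" by auto
    then have "conv \<psi> h x = 0" by (simp add: conv_def)
    then show False using \<open>conv \<psi> h x \<noteq> 0\<close> by simp
  qed
  moreover have "bounded {u + v |u v. u \<in> {x. \<psi> x \<noteq> 0} \<and> v \<in> {x. h x \<noteq> 0}}"
    using bounded_sums[of "{x. \<psi> x \<noteq> 0}" "{x. h x \<noteq> 0}"] assms by (auto simp: test_fun_iff elim!: bounded_subset)
  ultimately show ?thesis using assms by (auto simp: test_fun_iff intro: smooth_conv bounded_subset)
qed

section \<open>Mollification\<close>

lemma nn_integral_translate:
  fixes f :: "'a::euclidean_space \<Rightarrow> ennreal"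
  assumes [measurable]: "f \<in> borel_measurable borel"
  shows "(\<integral>\<^sup>+y. f (t + y) \<partial>lborel) = (\<integral>\<^sup>+y. f y \<partial>lborel)"
  by (subst (2) lborel_affine[of 1 t]) (simp_all add: nn_integral_density nn_integral_distr)

lemma nn_integral_reflect:
  fixes f :: "'a::euclidean_space \<Rightarrow> ennreal"
  assumes [measurable]: "f \<in> borel_measurable borel"
  shows "(\<integral>\<^sup>+y. f (t - y) \<partial>lborel) = (\<integral>\<^sup>+y. f y \<partial>lborel)"
  by (subst (2) lborel_affine[of "-1" t]) (simp_all add: nn_integral_density nn_integral_distr)

lemma integral_reflect:
  fixes f :: "'a::euclidean_space \<Rightarrow> complex"
  assumes [measurable]: "f \<in> borel_measurable borel"
  shows "(LINT y|lborel. f (t - y)) = (LINT y|lborel. f y)"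
    "integrable lborel (\<lambda>y. f (t - y)) \<longleftrightarrow> integrable lborel f"
proof -
  have *: "lborel = distr lborel borel (\<lambda>y::'a. t - y)"
    by (subst lborel_affine[of "-1" t]) (simp_all add: density_1)
  show "(LINT y|lborel. f (t - y)) = (LINT y|lborel. f y)"
    by (subst (2) *, subst integral_distr) simp_all
  show "integrable lborel (\<lambda>y. f (t - y)) \<longleftrightarrow> integrable lborel f"
    by (subst (2) *, subst integrable_distr_eq) simp_all
qed

lemma n2_translate: "f \<in> borel_measurable borel \<Longrightarrow> n2 (\<lambda>x. f (x - t)) = n2 f"
  using nn_integral_translate[of "\<lambda>x. ennreal ((norm (f x))\<^sup>2)" "- t"] by (simp add: n2_def)

lemma ennreal_norm_integral_le:
  fixes f :: "'a \<Rightarrow> complex"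
  shows "ennreal (norm (integral\<^sup>L M f)) \<le> (\<integral>\<^sup>+x. norm (f x) \<partial>M)"
proof (cases "integrable M f")
  case True then show ?thesis by (rule integral_norm_bound_ennreal)
qed (simp add: not_integrable_integral_eq)

text \<open>Splits \<rho> into two factors sqrt \<rho>. For \<rho> of total mass 1 this is Jensen's
  inequality for the square, which is how mollification errors are bounded.\<close>

lemma weighted_Cauchy_Schwarz:
  assumes [measurable]: "\<rho> \<in> borel_measurable M" "g \<in> borel_measurable M" and "\<And>x. \<rho> x \<ge> (0::real)"
  shows "ennreal ((norm (LINT x|M. of_real (\<rho> x) * (g x :: complex)))\<^sup>2)
    \<le> (\<integral>\<^sup>+x. \<rho> x \<partial>M) * (\<integral>\<^sup>+x. \<rho> x * (norm (g x))\<^sup>2 \<partial>M)"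
proof -
  have "ennreal ((norm (LINT x|M. of_real (\<rho> x) * g x))\<^sup>2) = (ennreal (norm (LINT x|M. of_real (\<rho> x) * g x)))\<^sup>2"
    by (simp add: ennreal_power)
  also have "\<dots> \<le> (\<integral>\<^sup>+x. norm (of_real (\<rho> x) * g x) \<partial>M)\<^sup>2"
    by (intro power_mono ennreal_norm_integral_le) simp
  also have "(\<integral>\<^sup>+x. norm (of_real (\<rho> x) * g x) \<partial>M) = (\<integral>\<^sup>+x. ennreal (sqrt (\<rho> x)) * ennreal (sqrt (\<rho> x) * norm (g x)) \<partial>M)"
    using assms(3) by (intro nn_integral_cong) (simp add: norm_mult flip: ennreal_mult mult.assoc)
  also have "\<dots>\<^sup>2 \<le> (\<integral>\<^sup>+x. (ennreal (sqrt (\<rho> x)))\<^sup>2 \<partial>M) * (\<integral>\<^sup>+x. (ennreal (sqrt (\<rho> x) * norm (g x)))\<^sup>2 \<partial>M)"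
    by (intro Cauchy_Schwarz_nn_integral) measurable
  also have "\<dots> = (\<integral>\<^sup>+x. \<rho> x \<partial>M) * (\<integral>\<^sup>+x. \<rho> x * (norm (g x))\<^sup>2 \<partial>M)"
    using assms(3) by (simp add: ennreal_power power_mult_distrib)
  finally show ?thesis .
qed

section \<open>Density of continuous functions and continuity of translations in L^2\<close>

lemma n2_tendsto_0:
  assumes m: "\<And>i. u i \<in> borel_measurable borel" and w: "(\<integral>\<^sup>+x. ennreal (w x) \<partial>lborel) < \<infinity>" "w \<in> borel_measurable borel"
    and b: "\<And>i x. (norm (u i x))\<^sup>2 \<le> w x" and l: "AE x in lborel. (\<lambda>i. u i x) \<longlonglongrightarrow> 0"
  shows "(\<lambda>i. n2 (u i)) \<longlonglongrightarrow> 0"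
proof -
  have "(\<lambda>i. \<integral>\<^sup>+x. ennreal ((norm (u i x))\<^sup>2) \<partial>lborel) \<longlonglongrightarrow> (\<integral>\<^sup>+x. 0 \<partial>(lborel :: 'a measure))"
  proof (rule nn_integral_dominated_convergence[where w="\<lambda>x. ennreal (w x)"])
    show "AE x in lborel. (\<lambda>i. ennreal ((norm (u i x))\<^sup>2)) \<longlonglongrightarrow> 0"
      using l
    proof eventually_elim
      case (elim x)
      have "(\<lambda>i. (norm (u i x))\<^sup>2) \<longlonglongrightarrow> (norm (0::complex))\<^sup>2" by (intro tendsto_intros elim)
      from tendsto_ennrealI[OF this] show ?case by simp
    qed
  qed (use m w b in \<open>auto simp: ennreal_leI intro!: measurable_compose[OF m]\<close>)
  then show ?thesis by (simp add: n2_def)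
qed

text \<open>A measurable h is an a.e. limit of continuous functions \<open>g n\<close>, but nothing
  bounds these. A cut-off in space and a truncation of values make them dominated: h is first
  replaced by its truncation, and then h inside the truncation by \<open>g n\<close>.\<close>

lemma L2_dense_continuous:
  fixes h :: "'a::euclidean_space \<Rightarrow> complex"
  assumes h: "L2 h" and e: "e > 0"
  obtains k where "continuous_on UNIV k" "bounded {x. k x \<noteq> 0}" "n2 (\<lambda>x. h x - k x) < e"
proof -
  have [measurable]: "h \<in> borel_measurable borel" using h by (simp add: L2_def)
  have "h \<in> borel_measurable lebesgue" by (rule measurable_completion) simp
  from lebesgue_measurable_imp_measurable_on[OF this, of UNIV]
  obtain N g where N: "negligible N" and g: "\<And>n::nat. continuous_on UNIV (g n)" "\<And>x. x \<notin> N \<Longrightarrow> (\<lambda>n. g n x) \<longlonglongrightarrow> h x"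
    by (auto simp: measurable_on_def)
  have "AE x in lebesgue. x \<notin> N" using N by (intro AE_not_in) (simp add: negligible_iff_null_sets)
  then have AE: "AE x in lborel. (\<lambda>n. g n x) \<longlonglongrightarrow> h x"
    unfolding AE_completion_iff by eventually_elim (rule g(2))
  define c where "c m x = complex_of_real (max 0 (min 1 (real m + 1 - norm x)))" for m :: nat and x :: 'a
  \<comment> \<open>Nearest-point projection onto the disc of radius m: a continuous truncation of
    complex values that fixes those already in the disc.\<close>
  define T where "T m = closest_point (cball (0::complex) (real m))" for m :: nat
  have T: "continuous_on UNIV (T m)" "norm (T m z) \<le> real m" for m z
    using continuous_on_closest_point[of "cball (0::complex) (real m)" UNIV]
      closest_point_in_set[of "cball (0::complex) (real m)" z]
    by (auto simp: T_def)
  have T_eq: "T m z = z" if "norm z \<le> real m" for m z using that by (simp add: T_def closest_point_self)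
  have T_le: "norm (T m z) \<le> norm z" for m z
  proof (cases "norm z \<le> real m")
    case False then show ?thesis using T(2)[of m z] by linarith
  qed (simp add: T_eq)
  have c_cont: "continuous_on UNIV (c m)" for m unfolding c_def by (intro continuous_intros)
  have c1: "norm (c m x) \<le> 1" for m x by (auto simp: c_def)
  have c0: "c m x = 0" if "norm x \<ge> real m + 1" for m x using that by (auto simp: c_def)
  have [measurable]: "c m \<in> borel_measurable borel" "T m \<in> borel_measurable borel" "g m \<in> borel_measurable borel" for m
    using T(1) c_cont g(1) by (auto intro: borel_measurable_continuous_onI)
  have "(\<lambda>m. n2 (\<lambda>x. h x - c m x * T m (h x))) \<longlonglongrightarrow> 0"
  proof (rule n2_tendsto_0[where w="\<lambda>x. 4 * (norm (h x))\<^sup>2"])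
    show "(norm (h x - c m x * T m (h x)))\<^sup>2 \<le> 4 * (norm (h x))\<^sup>2" for m x
    proof -
      have "norm (c m x * T m (h x)) \<le> norm (h x)"
        using mult_mono[OF c1[of m x] T_le[of m "h x"]] by (simp add: norm_mult)
      then have "norm (h x - c m x * T m (h x)) \<le> 2 * norm (h x)"
        using norm_triangle_ineq4[of "h x" "c m x * T m (h x)"] by linarith
      from power_mono[OF this, of 2] show ?thesis by (simp add: power_mult_distrib)
    qed
    show "AE x in lborel. (\<lambda>m. h x - c m x * T m (h x)) \<longlonglongrightarrow> 0"
    proof (rule AE_I2, rule tendsto_eventually)
      fix x
      have "eventually (\<lambda>m. real m \<ge> norm x) sequentially" "eventually (\<lambda>m. real m \<ge> norm (h x)) sequentially"
        by (auto intro: eventually_compose_filterlim[OF eventually_ge_at_top filterlim_real_sequentially])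
      then show "\<forall>\<^sub>F m in sequentially. h x - c m x * T m (h x) = 0"
        by eventually_elim (simp add: T_eq c_def)
    qed
  qed (use h in \<open>auto simp: L2_def n2_def nn_integral_cmult ennreal_mult ennreal_mult_less_top\<close>)
  then have "eventually (\<lambda>m. n2 (\<lambda>x. h x - c m x * T m (h x)) < e / 4) sequentially"
    using e by (intro order_tendstoD(2)) (auto simp: ennreal_zero_less_divide)
  then obtain m where m: "n2 (\<lambda>x. h x - c m x * T m (h x)) < e / 4" by (auto dest: eventually_happens)
  have "(\<lambda>n. n2 (\<lambda>x. c m x * T m (h x) - c m x * T m (g n x))) \<longlonglongrightarrow> 0"
  proof (rule n2_tendsto_0[where w="\<lambda>x. 4 * (real m)\<^sup>2 * indicator (cball 0 (real m + 1)) x"])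
    show "(norm (c m x * T m (h x) - c m x * T m (g n x)))\<^sup>2 \<le> 4 * (real m)\<^sup>2 * indicator (cball 0 (real m + 1)) x" for n x
    proof (cases "norm x \<le> real m + 1")
      case True
      have "norm (T m (h x) - T m (g n x)) \<le> 2 * real m"
        using norm_triangle_ineq4[of "T m (h x)" "T m (g n x)"] T(2)[of m "h x"] T(2)[of m "g n x"] by linarith
      then have "norm (c m x * (T m (h x) - T m (g n x))) \<le> 1 * (2 * real m)"
        unfolding norm_mult by (intro mult_mono c1) auto
      from power_mono[OF this, of 2] show ?thesis using True by (simp add: power_mult_distrib right_diff_distrib)
    qed (simp add: c0)
    show "AE x in lborel. (\<lambda>n. c m x * T m (h x) - c m x * T m (g n x)) \<longlonglongrightarrow> 0"
      using AE
    proof eventually_elim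
      case (elim x)
      have "isCont (T m) (h x)" using T(1) by (simp add: continuous_on_eq_continuous_at)
      then have "(\<lambda>n. T m (g n x)) \<longlonglongrightarrow> T m (h x)" using elim by (rule isCont_tendsto_compose)
      then have "(\<lambda>n. c m x * T m (h x) - c m x * T m (g n x)) \<longlonglongrightarrow> c m x * T m (h x) - c m x * T m (h x)"
        by (intro tendsto_intros)
      then show ?case by simp
    qed
    have "emeasure lborel (cball 0 (real m + 1) :: 'a set) < \<infinity>" by (intro emeasure_bounded_finite) simp
    then show "(\<integral>\<^sup>+x. ennreal (4 * (real m)\<^sup>2 * indicator (cball 0 (real m + 1) :: 'a set) x) \<partial>lborel) < \<infinity>"
      by (simp add: ennreal_mult ennreal_indicator nn_integral_cmult_indicator ennreal_mult_less_top)
    show "(\<lambda>x. 4 * (real m)\<^sup>2 * indicator (cball 0 (real m + 1)) x) \<in> borel_measurable borel"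
      by (intro borel_measurable_times borel_measurable_const borel_measurable_indicator) simp
  qed auto
  then have "eventually (\<lambda>n. n2 (\<lambda>x. c m x * T m (h x) - c m x * T m (g n x)) < e / 4) sequentially"
    using e by (intro order_tendstoD(2)) (auto simp: ennreal_zero_less_divide)
  then obtain n where n: "n2 (\<lambda>x. c m x * T m (h x) - c m x * T m (g n x)) < e / 4" by (auto dest: eventually_happens)
  show thesis
  proof
    show "continuous_on UNIV (\<lambda>x. c m x * T m (g n x))"
      by (intro continuous_intros c_cont continuous_on_compose2[OF T(1) g(1)]) auto
    have "{x. c m x * T m (g n x) \<noteq> 0} \<subseteq> cball 0 (real m + 1)"
      using c0[of m] by (auto simp: not_le[symmetric] intro: less_imp_le ccontr)
    then show "bounded {x. c m x * T m (g n x) \<noteq> 0}" by (rule bounded_subset[OF bounded_cball])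
    have "n2 (\<lambda>x. h x - c m x * T m (g n x)) = n2 (\<lambda>x. (h x - c m x * T m (h x)) + (c m x * T m (h x) - c m x * T m (g n x)))" by simp
    also have "\<dots> \<le> 2 * n2 (\<lambda>x. h x - c m x * T m (h x)) + 2 * n2 (\<lambda>x. c m x * T m (h x) - c m x * T m (g n x))"
      by (intro n2_add) measurable
    also have "\<dots> < 2 * (e / 4) + 2 * (e / 4)"
      using m n by (intro add_strict_mono ennreal_mult_strict_left_mono) auto
    also have "\<dots> = e"
    proof (cases e)
      case (real r) then show ?thesis by (simp add: divide_ennreal flip: ennreal_numeral ennreal_mult ennreal_plus)
    qed (simp add: ennreal_top_divide ennreal_mult_top)
    finally show "n2 (\<lambda>x. h x - c m x * T m (g n x)) < e" .
  qed
qed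

lemma L2_translation_continuous:
  fixes h :: "'a::euclidean_space \<Rightarrow> complex"
  assumes h: "L2 h" and e: "e > 0"
  shows "\<exists>d>0. \<forall>y. norm y < d \<longrightarrow> n2 (\<lambda>x. h (x - y) - h x) < e"
proof -
  have [measurable]: "h \<in> borel_measurable borel" using h by (simp add: L2_def)
  \<comment> \<open>Three differences are added below with weights 2, 4 and 4, so e/16 for each
    leaves a total of 10e/16.\<close>
  have e': "e / 16 > 0" using e by (simp add: ennreal_zero_less_divide)
  obtain k where k: "continuous_on UNIV k" "bounded {x. k x \<noteq> 0}" "n2 (\<lambda>x. h x - k x) < e / 16"
    using L2_dense_continuous[OF h e'] by metis
  have [measurable]: "k \<in> borel_measurable borel" using k(1) by (rule borel_measurable_continuous_onI)
  obtain R where R: "{x. k x \<noteq> 0} \<subseteq> cball 0 R"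
    using bounded_subset_ballD[OF k(2)] ball_subset_cball by (metis subset_trans)
  have "compact (k ` cball 0 R)"
    by (intro compact_continuous_image continuous_on_subset[OF k(1)]) auto
  then obtain B where B: "B > 0" "\<And>x. x \<in> cball 0 R \<Longrightarrow> norm (k x) \<le> B"
    using compact_imp_bounded bounded_pos by (metis imageI)
  have kB: "norm (k x) \<le> B" for x using B R by (cases "k x = 0") auto
  have "((\<lambda>y. n2 (\<lambda>x. k (x - y) - k x)) \<longlongrightarrow> 0) (at 0)"
    unfolding tendsto_at_iff_sequentially comp_def
  proof (intro allI impI)
    fix Y0 :: "nat \<Rightarrow> 'a" assume Y0: "\<forall>i. Y0 i \<in> UNIV - {0}" "Y0 \<longlonglongrightarrow> 0"
    then obtain N where N: "\<And>i. i \<ge> N \<Longrightarrow> norm (Y0 i) < 1"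
      using LIMSEQ_D[OF Y0(2), of 1] by auto
    define Y where "Y i = Y0 (i + N)" for i
    have Y: "Y \<longlonglongrightarrow> 0" "\<And>i. norm (Y i) < 1"
      using LIMSEQ_ignore_initial_segment[OF Y0(2), of N] N by (auto simp: Y_def[abs_def])
    have "(\<lambda>i. n2 (\<lambda>x. k (x - Y i) - k x)) \<longlonglongrightarrow> 0"
    proof (rule n2_tendsto_0[where w="\<lambda>x. 4 * B\<^sup>2 * indicator (cball 0 (R + 1)) x"])
      show "(norm (k (x - Y i) - k x))\<^sup>2 \<le> 4 * B\<^sup>2 * indicator (cball 0 (R + 1)) x" for i x
      proof (cases "norm x \<le> R + 1")
        case True
        have "norm (k (x - Y i) - k x) \<le> 2 * B"
          using norm_triangle_ineq4[of "k (x - Y i)" "k x"] kB[of x] kB[of "x - Y i"] by linarith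
        from power_mono[OF this, of 2] show ?thesis using True by (simp add: power_mult_distrib)
      next
        case False
        then have "norm (x - Y i) > R" "norm x > R" using Y(2)[of i] norm_triangle_ineq2[of x "Y i"] by linarith+
        then have "k (x - Y i) = 0" "k x = 0" using R by (auto simp: subset_eq not_le[symmetric])
        then show ?thesis by simp
      qed
      have "emeasure lborel (cball 0 (R + 1) :: 'a set) < \<infinity>" by (intro emeasure_bounded_finite) simp
      then show "(\<integral>\<^sup>+x. ennreal (4 * B\<^sup>2 * indicator (cball 0 (R + 1) :: 'a set) x) \<partial>lborel) < \<infinity>"
        by (simp add: ennreal_mult ennreal_indicator nn_integral_cmult_indicator ennreal_mult_less_top)
      show "AE x in lborel. (\<lambda>i. k (x - Y i) - k x) \<longlonglongrightarrow> 0"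
      proof (rule AE_I2)
        fix x
        have "isCont k x" using k(1) by (simp add: continuous_on_eq_continuous_at)
        moreover have "(\<lambda>i. x - Y i) \<longlonglongrightarrow> x" using tendsto_diff[OF tendsto_const Y(1), of x] by simp
        ultimately have "(\<lambda>i. k (x - Y i)) \<longlonglongrightarrow> k x" by (rule isCont_tendsto_compose)
        from tendsto_diff[OF this tendsto_const, of "k x"] show "(\<lambda>i. k (x - Y i) - k x) \<longlonglongrightarrow> 0" by simp
      qed
      show "(\<lambda>x. 4 * B\<^sup>2 * indicator (cball 0 (R + 1)) x) \<in> borel_measurable borel"
        by (intro borel_measurable_times borel_measurable_const borel_measurable_indicator) simp
    qed auto
    then show "(\<lambda>i. n2 (\<lambda>x. k (x - Y0 i) - k x)) \<longlonglongrightarrow> 0"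
      unfolding Y_def by (rule LIMSEQ_offset)
  qed
  then have "eventually (\<lambda>y. n2 (\<lambda>x. k (x - y) - k x) < e / 16) (at 0)"
    using e' by (intro order_tendstoD(2))
  then obtain d where d: "d > 0" "\<And>y. y \<noteq> 0 \<Longrightarrow> norm y < d \<Longrightarrow> n2 (\<lambda>x. k (x - y) - k x) < e / 16"
    by (auto simp: eventually_at)
  have "n2 (\<lambda>x. h (x - y) - h x) < e" if "norm y < d" for y
  proof -
    have a: "n2 (\<lambda>x. k (x - y) - k x) < e / 16"
      using d(2)[of y] that e' by (cases "y = 0") (auto simp: n2_def)
    have b: "n2 (\<lambda>x. h (x - y) - k (x - y)) < e / 16"
      using k(3) n2_translate[of "\<lambda>x. h x - k x" y] by simp
    have c: "n2 (\<lambda>x. k x - h x) < e / 16" using k(3) by (simp add: n2_def norm_minus_commute)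
    have "n2 (\<lambda>x. h (x - y) - h x) = n2 (\<lambda>x. (h (x - y) - k (x - y)) + ((k (x - y) - k x) + (k x - h x)))" by simp
    also have "\<dots> \<le> 2 * n2 (\<lambda>x. h (x - y) - k (x - y)) + 2 * n2 (\<lambda>x. (k (x - y) - k x) + (k x - h x))"
      by (intro n2_add) measurable
    also have "\<dots> \<le> 2 * n2 (\<lambda>x. h (x - y) - k (x - y)) + 2 * (2 * n2 (\<lambda>x. k (x - y) - k x) + 2 * n2 (\<lambda>x. k x - h x))"
      by (intro add_left_mono mult_left_mono n2_add) measurable
    also have "\<dots> < 2 * (e / 16) + 2 * (2 * (e / 16) + 2 * (e / 16))"
      using a b c by (intro add_strict_mono ennreal_mult_strict_left_mono) auto
    also have "\<dots> \<le> e"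
    proof (cases e)
      case (real r) then show ?thesis by (simp add: divide_ennreal flip: ennreal_numeral ennreal_mult ennreal_plus)
    qed simp
    finally show ?thesis .
  qed
  then show ?thesis using d(1) by blast
qed

lemma mollifier_exists:
  fixes d :: real
  assumes "d > 0"
  obtains \<rho> :: "'a::euclidean_space \<Rightarrow> real" where "test_fun (\<lambda>x. of_real (\<rho> x))" "\<And>x. \<rho> x \<ge> 0"
    "(\<integral>\<^sup>+x. ennreal (\<rho> x) \<partial>lborel) = 1" "\<And>x. \<rho> x \<noteq> 0 \<Longrightarrow> norm x < d"
proof -
  \<comment> \<open>Half the side of the box; the l^1 bound on the norm then gives at most
    \<open>DIM('a) * a\<close>, which is d/2, on the support.\<close>
  define a where "a = d / (2 * DIM('a))"
  have a: "a > 0" using assms by (simp add: a_def)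
  define b where "b = bump 1 (- a *\<^sub>R One) (a *\<^sub>R (One :: 'a))"
  have tf: "test_fun (\<lambda>x. of_real (b x))" unfolding b_def by (rule test_fun_bump)
  have int: "integrable lborel b"
    using test_fun_integrable[OF tf] by (simp add: complex_of_real_integrable_eq)
  have pos: "b x > 0" if "x \<in> box (- a *\<^sub>R One) (a *\<^sub>R One)" for x
    unfolding b_def using that by (intro bump_pos) auto
  have nn: "b x \<ge> 0" for x by (simp add: b_def bump_bounds)
  define c where "c = (LINT x|lborel. b x)"
  have "c \<noteq> 0"
  proof
    assume "c = 0"
    then have "AE x in lborel. b x = 0"
      using integral_nonneg_eq_0_iff_AE[OF int] nn by (auto simp: c_def)
    then have "AE x in lborel. x \<notin> box (- a *\<^sub>R One) (a *\<^sub>R (One :: 'a))"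
      by eventually_elim (use pos in force)
    then have "emeasure lborel (box (- a *\<^sub>R One) (a *\<^sub>R (One :: 'a))) = 0"
      by (subst (asm) AE_iff_measurable[OF _ refl]) auto
    then show False using a by (auto simp: emeasure_lborel_box_eq inner_simps split: if_splits)
  qed
  then have c: "c > 0" using integral_nonneg_AE[of b lborel] nn by (auto simp: c_def less_le)
  show thesis
  proof
    show "test_fun (\<lambda>x. complex_of_real (b x / c))"
      using test_fun_cmult[OF tf, of "of_real (1 / c)"] by simp
    show "b x / c \<ge> 0" for x using nn c by simp
    have "(\<integral>\<^sup>+x. ennreal (b x / c) \<partial>lborel) = ennreal (LINT x|lborel. b x / c)"
      using int c nn by (intro nn_integral_eq_integral) auto
    also have "\<dots> = 1" using c by (simp add: c_def)
    finally show "(\<integral>\<^sup>+x. ennreal (b x / c) \<partial>lborel) = 1" .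
    show "norm x < d" if "b x / c \<noteq> 0" for x
    proof -
      have "x \<in> box (- a *\<^sub>R One) (a *\<^sub>R One)"
        using that bump_eq_0[of x "- a *\<^sub>R One" "a *\<^sub>R One" 1] by (auto simp: b_def)
      then have *: "\<bar>x \<bullet> i\<bar> < a" if "i \<in> Basis" for i using that by (auto simp: mem_box inner_simps abs_less_iff)
      have "norm x \<le> (\<Sum>i\<in>Basis. \<bar>x \<bullet> i\<bar>)" by (rule norm_le_l1)
      also have "\<dots> \<le> (\<Sum>i\<in>(Basis::'a set). a)" using * by (intro sum_mono less_imp_le)
      also have "\<dots> < d" using assms by (simp add: a_def)
      finally show ?thesis .
    qed
  qed
qed

lemma L2_bounded_integrable:
  fixes h :: "'a::euclidean_space \<Rightarrow> complex"
  assumes "L2 h" "bounded {x. h x \<noteq> 0}" shows "integrable lborel h"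
proof -
  obtain R where R: "{x. h x \<noteq> 0} \<subseteq> cball 0 R"
    using bounded_subset_ballD[OF assms(2)] ball_subset_cball by (metis subset_trans)
  have "L2 (\<lambda>x::'a. complex_of_real (indicator (cball 0 R) x))"
    by (rule bounded_support_integrable(2)[where B=1])
       (auto simp: indicator_def intro: bounded_subset[OF bounded_cball, of _ 0 R])
  from L2_mult_integrable[OF this assms(1)]
  have "integrable lborel (\<lambda>x. complex_of_real (indicator (cball 0 R) x) * h x)" .
  also have "(\<lambda>x. complex_of_real (indicator (cball 0 R) x) * h x) = h"
    using R by (auto simp: fun_eq_iff indicator_def)
  finally show ?thesis .
qed

text \<open>Because \<rho> has mass 1, the error at x is the \<rho>-average over y of h(x - y) -
  h(x). Jensen's inequality and Tonelli turn its squared norm into an average of squared norms of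
  translation differences, and only shifts with |y| < d contribute.\<close>

lemma n2_conv_diff_le:
  fixes h :: "'a::euclidean_space \<Rightarrow> complex"
  assumes \<rho>: "test_fun (\<lambda>x. of_real (\<rho> x))" "\<And>x. \<rho> x \<ge> 0" "(\<integral>\<^sup>+x. ennreal (\<rho> x) \<partial>lborel) = 1" "\<And>x. \<rho> x \<noteq> 0 \<Longrightarrow> norm x < d"
    and h: "L2 h" "bounded {x. h x \<noteq> 0}" and e: "\<And>y. norm y < d \<Longrightarrow> n2 (\<lambda>x. h (x - y) - h x) \<le> e"
  shows "n2 (\<lambda>x. conv (\<lambda>x. of_real (\<rho> x)) h x - h x) \<le> e"
proof -
  have [measurable]: "h \<in> borel_measurable borel" using h by (simp add: L2_def)
  have "(\<lambda>x. Re (complex_of_real (\<rho> x))) \<in> borel_measurable borel"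
    using test_fun_measurable[OF \<rho>(1)] by measurable
  then have [measurable]: "\<rho> \<in> borel_measurable borel" by simp
  have hi: "integrable lborel h" by (rule L2_bounded_integrable) fact+
  have \<rho>i: "integrable lborel (\<lambda>x. complex_of_real (\<rho> x))" by (rule test_fun_integrable) fact
  have "integrable lborel \<rho>" using \<rho>i by (simp add: complex_of_real_integrable_eq)
  then have "ennreal (LINT x|lborel. \<rho> x) = 1" using nn_integral_eq_integral[of lborel \<rho>] \<rho> by simp
  then have \<rho>1: "(LINT x|lborel. complex_of_real (\<rho> x)) = 1"
    using \<rho>(2) by (simp add: ennreal_eq_1 integral_nonneg_AE)
  have eq: "conv (\<lambda>x. of_real (\<rho> x)) h x - h x = (LINT y|lborel. of_real (\<rho> y) * (h (x - y) - h x))" for x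
  proof -
    have "integrable lborel (\<lambda>y. of_real (\<rho> (x - (x - y))) * h (x - y))"
      using conv_integrable[OF \<rho>(1) hi, of x]
      by (subst (asm) integral_reflect(2)[symmetric, of _ x]) auto
    then have i: "integrable lborel (\<lambda>y. of_real (\<rho> y) * h (x - y))" by simp
    have "conv (\<lambda>x. of_real (\<rho> x)) h x = (LINT y|lborel. of_real (\<rho> (x - (x - y))) * h (x - y))"
      unfolding conv_def by (subst integral_reflect(1)[symmetric, of _ x]) auto
    then show ?thesis using i \<rho>i \<rho>1 by (simp add: right_diff_distrib)
  qed
  have "n2 (\<lambda>x. conv (\<lambda>x. of_real (\<rho> x)) h x - h x)
     \<le> (\<integral>\<^sup>+x. (\<integral>\<^sup>+y. \<rho> y * (norm (h (x - y) - h x))\<^sup>2 \<partial>lborel) \<partial>lborel)"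
    unfolding n2_def eq using weighted_Cauchy_Schwarz[of \<rho> lborel] \<rho>(2,3)
    by (intro nn_integral_mono order_trans[OF weighted_Cauchy_Schwarz]) auto
  also have "\<dots> = (\<integral>\<^sup>+y. (\<integral>\<^sup>+x. \<rho> y * (norm (h (x - y) - h x))\<^sup>2 \<partial>lborel) \<partial>lborel)"
    by (rule lborel_pair.Fubini') measurable
  also have "\<dots> = (\<integral>\<^sup>+y. \<rho> y * n2 (\<lambda>x. h (x - y) - h x) \<partial>lborel)"
    unfolding n2_def using \<rho>(2) by (simp add: ennreal_mult nn_integral_cmult)
  also have "\<dots> \<le> (\<integral>\<^sup>+y. \<rho> y * e \<partial>lborel)"
  proof (rule nn_integral_mono)
    fix y show "ennreal (\<rho> y) * n2 (\<lambda>x. h (x - y) - h x) \<le> ennreal (\<rho> y) * e"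
      using e \<rho>(4)[of y] by (cases "\<rho> y = 0") (auto intro: mult_left_mono)
  qed
  also have "\<dots> = e" using \<rho>(3) by (simp add: nn_integral_multc)
  finally show ?thesis .
qed

text \<open>One sequence serves every h, which matters because it is applied at once to a function
  and to its image under the operator. All supports lie in the unit ball, so convolution enlarges
  supports by at most 1, uniformly in k.\<close>

lemma mollification:
  obtains \<rho> :: "nat \<Rightarrow> 'a::euclidean_space \<Rightarrow> complex"
  where "\<And>k. test_fun (\<rho> k)" "\<And>k x. \<rho> k x \<noteq> 0 \<Longrightarrow> norm x < 1"
    "\<And>h. L2 h \<Longrightarrow> bounded {x. h x \<noteq> 0} \<Longrightarrow> (\<lambda>k. n2 (\<lambda>x. conv (\<rho> k) h x - h x)) \<longlonglongrightarrow> 0"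
proof -
  have "\<exists>\<rho> :: 'a \<Rightarrow> real. test_fun (\<lambda>x. of_real (\<rho> x)) \<and> (\<forall>x. \<rho> x \<ge> 0) \<and>
    (\<integral>\<^sup>+x. ennreal (\<rho> x) \<partial>lborel) = 1 \<and> (\<forall>x. \<rho> x \<noteq> 0 \<longrightarrow> norm x < 1 / Suc k)" for k :: nat
    using mollifier_exists[of "1 / Suc k"] by (metis zero_less_divide_1_iff of_nat_0_less_iff zero_less_Suc)
  then obtain \<rho> :: "nat \<Rightarrow> 'a \<Rightarrow> real" where \<rho>: "\<And>k. test_fun (\<lambda>x. of_real (\<rho> k x))" "\<And>k x. \<rho> k x \<ge> 0"
    "\<And>k. (\<integral>\<^sup>+x. ennreal (\<rho> k x) \<partial>lborel) = 1" "\<And>k x. \<rho> k x \<noteq> 0 \<Longrightarrow> norm x < 1 / Suc k" by metis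
  show thesis
  proof
    show "norm x < 1" if "complex_of_real (\<rho> k x) \<noteq> 0" for k x
    proof -
      have "norm x < 1 / Suc k" using \<rho>(4) that by simp
      also have "\<dots> \<le> 1" by simp
      finally show ?thesis .
    qed
    fix h :: "'a \<Rightarrow> complex" assume h: "L2 h" "bounded {x. h x \<noteq> 0}"
    show "(\<lambda>k. n2 (\<lambda>x. conv (\<lambda>x. of_real (\<rho> k x)) h x - h x)) \<longlonglongrightarrow> 0"
    proof (rule order_tendstoI)
      fix e :: ennreal assume "e > 0"
      then obtain e' where e': "0 < e'" "e' < e" using dense by blast
      obtain d where d: "d > 0" "\<And>y. norm y < d \<Longrightarrow> n2 (\<lambda>x. h (x - y) - h x) < e'"
        using L2_translation_continuous[OF h(1) e'(1)] by blast
      have "eventually (\<lambda>k. 1 / real (Suc k) < d) sequentially"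
        using order_tendstoD(2)[OF LIMSEQ_Suc[OF lim_1_over_n] d(1)] by simp
      then show "\<forall>\<^sub>F k in sequentially. n2 (\<lambda>x. conv (\<lambda>x. of_real (\<rho> k x)) h x - h x) < e"
      proof eventually_elim
        case (elim k)
        have "n2 (\<lambda>x. conv (\<lambda>x. of_real (\<rho> k x)) h x - h x) \<le> e'"
          by (rule n2_conv_diff_le[OF \<rho>(1-3) _ h, of _ d])
             (use \<rho>(4)[of k] elim d(2) in \<open>force intro: less_imp_le less_trans\<close>)+
        then show ?case using e'(2) by simp
      qed
    qed auto
  qed (rule \<rho>)
qed

section \<open>Functions all of whose integrals over boxes, or against test functions,
  vanish\<close>

lemma box_integral_of_bump:
  fixes q :: "'a::euclidean_space \<Rightarrow> complex"
  assumes q: "integrable lborel (\<lambda>x. indicator (cbox a b) x *\<^sub>R q x)"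
    and z: "\<And>k. (LINT x|lborel. of_real (bump k a b x) * q x) = 0"
    and [measurable]: "q \<in> borel_measurable borel"
  shows "(LINT x|lborel. indicator (box a b) x *\<^sub>R q x) = 0"
proof -
  have bm: "(\<lambda>x. complex_of_real (bump k a b x)) \<in> borel_measurable borel" for k and x :: 'a
    by (intro smooth_measurable smooth_bump)
  have "(\<lambda>k. LINT x|lborel. of_real (bump k a b x) * q x) \<longlonglongrightarrow> (LINT x|lborel. indicator (box a b) x *\<^sub>R q x)"
  proof (rule integral_dominated_convergence[where w="\<lambda>x. norm (indicator (cbox a b) x *\<^sub>R q x)"])
    show "AE x in lborel. (\<lambda>k. of_real (bump k a b x) * q x) \<longlonglongrightarrow> indicator (box a b) x *\<^sub>R q x"
      unfolding scaleR_conv_of_real by (intro AE_I2 tendsto_intros bump_tendsto)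
    show "AE x in lborel. norm (of_real (bump k a b x) * q x) \<le> norm (indicator (cbox a b) x *\<^sub>R q x)" for k
    proof (rule AE_I2)
      fix x show "norm (of_real (bump k a b x) * q x) \<le> norm (indicator (cbox a b) x *\<^sub>R q x)"
        using bump_eq_0[of x a b k] box_subset_cbox[of a b] mult_right_mono[OF bump_bounds(2)[of k a b x], of "norm (q x)"] bump_bounds(1)[of k a b x]
        by (cases "x \<in> box a b") (auto simp: norm_mult)
    qed
    show "(\<lambda>x. complex_of_real (bump k a b x) * q x) \<in> borel_measurable lborel" for k
      using borel_measurable_times[OF bm, of q] by simp
  qed (use integrable_norm[OF q] in auto)
  then show ?thesis unfolding z by (simp add: LIMSEQ_const_iff)
qed

text \<open>Lebesgue differentiation: outside a null set q(x) is the limit of its averages over the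
  cubes with lower corner x, and all these averages are 0.\<close>

lemma AE_zero_if_box_integrals:
  fixes q :: "'a::euclidean_space \<Rightarrow> complex"
  assumes q: "\<And>a b. integrable lborel (\<lambda>x. indicator (cbox a b) x *\<^sub>R q x)"
    and box: "\<And>a b. (LINT x|lborel. indicator (box a b) x *\<^sub>R q x) = 0"
    and [measurable]: "q \<in> borel_measurable borel"
  shows "AE x in lborel. q x = 0"
proof -
  have sib: "set_integrable lborel (box a b) q" for a b
    unfolding set_integrable_def
    by (rule Bochner_Integration.integrable_bound[OF q[of a b]])
       (use box_subset_cbox[of a b] in \<open>auto simp: indicator_def\<close>)
  have int: "integral (cbox a b) q = 0" for a b
    using set_borel_integral_eq_integral(2)[OF sib[of a b]] box[of a b]
    by (simp add: set_lebesgue_integral_def integral_open_interval)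
  have "q integrable_on cbox a b" for a b
    by (intro set_borel_integral_eq_integral(1)) (use q in \<open>simp add: set_integrable_def\<close>)
  from integrable_ccontinuous_explicit[OF this] obtain N where N: "negligible N"
    "\<And>x e. x \<notin> N \<Longrightarrow> 0 < e \<Longrightarrow> \<exists>d>0. \<forall>h. 0 < h \<and> h < d \<longrightarrow>
       norm (integral (cbox x (x + h *\<^sub>R One)) q /\<^sub>R h ^ DIM('a) - q x) < e" by blast
  have "q x = 0" if xN: "x \<notin> N" for x
  proof (rule ccontr)
    assume "q x \<noteq> 0"
    then have "\<exists>d>0. \<forall>h::real. 0 < h \<and> h < d \<longrightarrow> norm (0 - q x) < norm (q x)"
      using N(2)[OF xN, unfolded int scaleR_zero_right] zero_less_norm_iff by metis
    then obtain d :: real where d: "d > 0" "\<forall>h. 0 < h \<and> h < d \<longrightarrow> norm (0 - q x) < norm (q x)" by blast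
    from d(2)[rule_format, of "d/2"] d(1) show False by simp
  qed
  moreover have "AE x in lebesgue. x \<notin> N" using N(1) by (intro AE_not_in) (simp add: negligible_iff_null_sets)
  ultimately have "AE x in lebesgue. q x = 0" by (auto elim: eventually_mono)
  then show ?thesis by (simp add: AE_completion_iff)
qed

lemma fundamental_lemma:
  fixes q :: "'a::euclidean_space \<Rightarrow> complex"
  assumes q: "\<And>a b. integrable lborel (\<lambda>x. indicator (cbox a b) x *\<^sub>R q x)"
    and z: "\<And>\<phi>. test_fun \<phi> \<Longrightarrow> (LINT x|lborel. \<phi> x * q x) = 0"
    and "q \<in> borel_measurable borel"
  shows "AE x in lborel. q x = 0"
  by (intro AE_zero_if_box_integrals box_integral_of_bump z[OF test_fun_bump] q assms(3))

section \<open>Integration by parts\<close>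

text \<open>The derivative \<open>F'\<close> is only assumed to exist everywhere, so it need not be Lebesgue integrable;
  it is Henstock--Kurzweil integrable, and the second mean value theorem controls its product with the
  monotone function \<open>integral {a..t} w\<close> on short intervals.\<close>

lemma byparts_real_nonneg:
  fixes F F' w :: "real \<Rightarrow> real"
  assumes ab: "a \<le> b" and F: "\<And>t. (F has_real_derivative F' t) (at t)"
    and w: "set_integrable lborel {a..b} w" "\<And>t. w t \<ge> 0"
  shows "((\<lambda>t. F' t * integral {a..t} w + F t * w t) has_integral (F b * integral {a..b} w)) {a..b}"
proof -
  define P where "P t = integral {a..t} w" for t
  have wi: "w integrable_on {a..b}" using w(1) by (rule set_borel_integral_eq_integral)
  have wi': "w integrable_on {c..d}" if "a \<le> c" "d \<le> b" for c d
    using integrable_on_subinterval[OF wi, of c d] that by auto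
  have Pdiff: "P d - P c = integral {c..d} w" if "a \<le> c" "c \<le> d" "d \<le> b" for c d
    using Henstock_Kurzweil_Integration.integral_combine[of a c d w] that wi' by (simp add: P_def)
  have Pmono: "P c \<le> P d" if "a \<le> c" "c \<le> d" "d \<le> b" for c d
    using Pdiff[OF that] integral_nonneg[OF wi'[of c d]] that w(2) by simp
  have contF: "continuous_on S F" for S
    using F by (meson DERIV_continuous_on has_field_derivative_at_within)
  have F'i: "(F' has_integral (F d - F c)) {c..d}" if "c \<le> d" for c d
    using that F by (intro fundamental_theorem_of_calculus)
      (auto simp: has_real_derivative_iff_has_vector_derivative intro: has_vector_derivative_at_within)
  have mvt: "\<exists>\<xi>\<in>{c..d}. ((\<lambda>t. P t * F' t) has_integral (P c * (F \<xi> - F c) + P d * (F d - F \<xi>))) {c..d}"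
    if cd: "a \<le> c" "c \<le> d" "d \<le> b" for c d
  proof -
    have "F' integrable_on {c..d}" using F'i[OF cd(2)] by blast
    then obtain \<xi> where \<xi>: "\<xi> \<in> {c..d}" "((\<lambda>x. P x * F' x) has_integral (P c * integral {c..\<xi>} F' + P d * integral {\<xi>..d} F')) {c..d}"
      using second_mean_value_theorem_full[of F' c d P] Pmono cd by auto
    moreover have "integral {c..\<xi>} F' = F \<xi> - F c" "integral {\<xi>..d} F' = F d - F \<xi>"
      using F'i[of c \<xi>] F'i[of \<xi> d] \<xi>(1) by (auto intro: integral_unique)
    ultimately show ?thesis by auto
  qed
  obtain B where "\<forall>x\<in>F ` {a..b}. norm x \<le> B"
    using compact_imp_bounded[OF compact_continuous_image[OF contF compact_Icc]] unfolding bounded_iff by blast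
  then have B: "norm (F t) \<le> B" if "t \<in> {a..b}" for t using that by blast
  have Fm: "F \<in> borel_measurable borel" by (intro borel_measurable_continuous_onI contF)
  have "set_integrable lborel {a..b} (\<lambda>t. F t * w t)"
    unfolding set_integrable_def
  proof (rule Bochner_Integration.integrable_bound[OF integrable_mult_right[OF w(1)[unfolded set_integrable_def], of B]])
    have "(\<lambda>t. F t * (indicator {a..b} t *\<^sub>R w t)) \<in> borel_measurable lborel"
      using w(1) Fm by (intro borel_measurable_times) (auto simp: set_integrable_def)
    then show "(\<lambda>t. indicator {a..b} t *\<^sub>R (F t * w t)) \<in> borel_measurable lborel" by (simp add: mult.left_commute)
    show "AE t in lborel. norm (indicator {a..b} t *\<^sub>R (F t * w t)) \<le> norm (B * indicator {a..b} t *\<^sub>R w t)"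
    proof (rule AE_I2)
      fix t show "norm (indicator {a..b} t *\<^sub>R (F t * w t)) \<le> norm (B * indicator {a..b} t *\<^sub>R w t)"
        using B[of t] by (cases "t \<in> {a..b}") (auto simp: abs_mult intro!: mult_right_mono)
    qed
  qed
  then have Fw: "(\<lambda>t. F t * w t) integrable_on {a..b}" by (rule set_borel_integral_eq_integral)
  define H where "H t = F' t * P t + F t * w t" for t
  have Hi: "H integrable_on {a..b}"
    unfolding H_def using mvt[of a b] ab Fw by (intro integrable_add) (auto simp: mult.commute)
  \<comment> \<open>The defect of the formula on a subinterval. It is additive over adjacent
    intervals, as is P d - P c, so the bound \<epsilon> (P d - P c), once known on short intervals
    around every point, passes to [a, b]; \<open>Bolzano\<close> performs the bisection.\<close>
  define I where "I c d = integral {c..d} H - (F d * P d - F c * P c)" for c d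
  have "\<bar>I a b\<bar> \<le> \<epsilon> * (P b - P a)" if \<epsilon>: "\<epsilon> > 0" for \<epsilon>
  proof -
    define Q where "Q c d \<longleftrightarrow> (a \<le> c \<and> c \<le> d \<and> d \<le> b \<longrightarrow> \<bar>I c d\<bar> \<le> \<epsilon> * (P d - P c))" for c d
    have "Q a b"
      using ab
    proof (induction rule: Bolzano)
      case (trans c d e)
      show ?case unfolding Q_def
      proof
        assume *: "a \<le> c \<and> c \<le> e \<and> e \<le> b"
        have "H integrable_on {c..e}" using integrable_on_subinterval[OF Hi, of c e] * by auto
        then have "I c e = I c d + I d e"
          unfolding I_def using Henstock_Kurzweil_Integration.integral_combine[of c d e H] trans(3,4) by simp
        then show "\<bar>I c e\<bar> \<le> \<epsilon> * (P e - P c)"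
          using trans * by (simp add: Q_def algebra_simps)
      qed
    next
      case (local x)
      have "isCont F x" using F by (rule DERIV_isCont)
      then obtain \<delta> where \<delta>: "\<delta> > 0" "\<And>t. \<bar>t - x\<bar> < \<delta> \<Longrightarrow> \<bar>F t - F x\<bar> < \<epsilon> / 2"
        using \<epsilon> unfolding continuous_at_eps_delta by (metis dist_real_def half_gt_zero)
      show ?case unfolding Q_def
      proof (intro exI[of _ \<delta>] conjI allI impI \<delta>(1))
        fix c d assume 1: "c \<le> x \<and> x \<le> d \<and> d - c < \<delta>" and 2: "a \<le> c \<and> c \<le> d \<and> d \<le> b"
        obtain \<xi> where \<xi>: "\<xi> \<in> {c..d}" "((\<lambda>t. P t * F' t) has_integral (P c * (F \<xi> - F c) + P d * (F d - F \<xi>))) {c..d}"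
          using mvt[of c d] 2 by blast
        have Fwi: "(\<lambda>t. F t * w t) integrable_on {c..d}" using integrable_on_subinterval[OF Fw, of c d] 2 by auto
        have "integral {c..d} H = (P c * (F \<xi> - F c) + P d * (F d - F \<xi>)) + integral {c..d} (\<lambda>t. F t * w t)"
          unfolding H_def using \<xi>(2) Fwi
          by (subst Henstock_Kurzweil_Integration.integral_add) (auto simp: mult.commute dest: integral_unique)
        \<comment> \<open>The mean value theorem has removed F': what is left compares F with its
          value at the single point \<xi>, and continuity of F at x makes this small on short
          intervals.\<close>
        then have "I c d = integral {c..d} (\<lambda>t. F t * w t) - F \<xi> * (P d - P c)"
          by (simp add: I_def algebra_simps)
        also have "P d - P c = integral {c..d} w" using Pdiff 2 by blast
        also have "integral {c..d} (\<lambda>t. F t * w t) - F \<xi> * integral {c..d} w = integral {c..d} (\<lambda>t. F t * w t - F \<xi> * w t)"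
          using Fwi wi'[of c d] 2 by (subst Henstock_Kurzweil_Integration.integral_diff) (auto intro: integrable_cmul[where 'b=real, simplified])
        also have "norm \<dots> \<le> integral {c..d} (\<lambda>t. \<epsilon> * w t)"
        proof (rule integral_norm_bound_integral)
          show "(\<lambda>t. F t * w t - F \<xi> * w t) integrable_on {c..d}" "(\<lambda>t. \<epsilon> * w t) integrable_on {c..d}"
            using Fwi wi'[of c d] 2 by (auto intro!: integrable_diff integrable_cmul[where 'b=real, simplified])
          fix t assume t: "t \<in> {c..d}"
          have "\<bar>F t - F \<xi>\<bar> \<le> \<epsilon>"
          proof -
            have "\<bar>t - x\<bar> < \<delta>" "\<bar>\<xi> - x\<bar> < \<delta>" using t \<xi>(1) 1 by auto
            from this[THEN \<delta>(2)] show ?thesis by linarith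
          qed
          then show "norm (F t * w t - F \<xi> * w t) \<le> \<epsilon> * w t"
            using w(2)[of t] by (simp add: left_diff_distrib[symmetric] abs_mult mult_right_mono)
        qed
        finally show "\<bar>I c d\<bar> \<le> \<epsilon> * (P d - P c)" using Pdiff[of c d] 2 by simp
      qed
    qed
    then show ?thesis using ab by (simp add: Q_def)
  qed
  then have "\<bar>I a b\<bar> \<le> 0"
  proof -
    have "\<bar>I a b\<bar> \<le> e" if e: "e > 0" for e
    proof -
      have p: "P b - P a + 1 > 0" using Pmono[of a b] ab by simp
      have "\<bar>I a b\<bar> \<le> e / (P b - P a + 1) * (P b - P a)"
        by (rule \<open>\<And>\<epsilon>. \<epsilon> > 0 \<Longrightarrow> \<bar>I a b\<bar> \<le> \<epsilon> * (P b - P a)\<close>) (use e p in simp)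
      also have "\<dots> \<le> e" using e p by (simp add: divide_le_eq)
      finally show ?thesis .
    qed
    then show ?thesis using field_le_epsilon[of "\<bar>I a b\<bar>" 0] by simp
  qed
  then have "integral {a..b} H = F b * P b" by (simp add: I_def P_def)
  then show ?thesis using Hi by (metis (no_types, lifting) H_def P_def has_integral_cong integrable_integral)
qed

text \<open>The formula is linear in F and in w separately, so a complex w splits into four
  nonnegative parts and F into its real and imaginary part. The constant \<open>y0\<close> is the
  initial value of the primitive of w; its contribution is the fundamental theorem for F.\<close>

lemma byparts_complex:
  fixes F F' w :: "real \<Rightarrow> complex"
  assumes ab: "a \<le> b" and F: "\<And>t. (F has_vector_derivative F' t) (at t)"
    and w: "set_integrable lborel {a..b} w"
  shows "((\<lambda>t. F' t * (y0 + integral {a..t} w) + F t * w t) has_integral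
    (F b * (y0 + integral {a..b} w) - F a * y0)) {a..b}"
proof -
  define BP where "BP F F' w \<longleftrightarrow> set_integrable lborel {a..b} w \<and>
    ((\<lambda>t. F' t * integral {a..t} w + F t * w t) has_integral (F b * integral {a..b} w)) {a..b}"
    for F F' w :: "real \<Rightarrow> complex"
  have int: "w integrable_on {a..t}" if "set_integrable lborel {a..b} w" "t \<in> {a..b}" for w :: "real \<Rightarrow> complex" and t
    using integrable_on_subinterval[OF set_borel_integral_eq_integral(1)[OF that(1)], of a t] that(2) by auto
  have BP_addw: "BP F F' (\<lambda>t. w1 t + c * w2 t)" if "BP F F' w1" "BP F F' w2" for F F' w1 w2 c
  proof -
    have s: "set_integrable lborel {a..b} w1" "set_integrable lborel {a..b} w2" using that by (auto simp: BP_def)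
    have i: "integral {a..t} (\<lambda>t. w1 t + c * w2 t) = integral {a..t} w1 + c * integral {a..t} w2" if "t \<in> {a..b}" for t
      using int[OF s(1) that] int[OF s(2) that]
      by (subst Henstock_Kurzweil_Integration.integral_add) (auto intro: integrable_on_mult_right)
    have "((\<lambda>t. (F' t * integral {a..t} w1 + F t * w1 t) + c * (F' t * integral {a..t} w2 + F t * w2 t)) has_integral
      (F b * integral {a..b} w1) + c * (F b * integral {a..b} w2)) {a..b}"
      using that by (intro has_integral_add has_integral_mult_right) (auto simp: BP_def)
    then have "((\<lambda>t. F' t * integral {a..t} (\<lambda>t. w1 t + c * w2 t) + F t * (w1 t + c * w2 t)) has_integral
        (F b * integral {a..b} w1) + c * (F b * integral {a..b} w2)) {a..b}"
      by (rule has_integral_eq[rotated]) (simp add: i algebra_simps)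
    moreover have "(F b * integral {a..b} w1) + c * (F b * integral {a..b} w2) = F b * integral {a..b} (\<lambda>t. w1 t + c * w2 t)"
      using ab by (simp add: i algebra_simps)
    ultimately show ?thesis using s by (auto simp: BP_def intro!: set_integral_add set_integrable_mult_right)
  qed
  have BP_addF: "BP (\<lambda>t. F1 t + c * F2 t) (\<lambda>t. F1' t + c * F2' t) w" if "BP F1 F1' w" "BP F2 F2' w" for F1 F1' F2 F2' w c
  proof -
    have "((\<lambda>t. (F1' t * integral {a..t} w + F1 t * w t) + c * (F2' t * integral {a..t} w + F2 t * w t)) has_integral
      (F1 b * integral {a..b} w) + c * (F2 b * integral {a..b} w)) {a..b}"
      using that by (intro has_integral_add has_integral_mult_right) (auto simp: BP_def)
    then show ?thesis using that by (simp add: BP_def algebra_simps)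
  qed
  have real: "BP (\<lambda>t. of_real (f t)) (\<lambda>t. of_real (f' t)) (\<lambda>t. of_real (v t))"
    if f: "\<And>t. (f has_real_derivative f' t) (at t)" and v: "set_integrable lborel {a..b} v" "\<And>t. v t \<ge> 0" for f f' v
  proof -
    have i: "integral {a..t} (\<lambda>t. complex_of_real (v t)) = of_real (integral {a..t} v)" if "t \<in> {a..b}" for t
      using integral_linear[OF integrable_on_subinterval[OF set_borel_integral_eq_integral(1)[OF v(1)], of a t] bounded_linear_of_real]
        that by (auto simp: o_def)
    from has_integral_linear[OF byparts_real_nonneg[OF ab f v] bounded_linear_of_real]
    have "((\<lambda>t. complex_of_real (f' t * integral {a..t} v + f t * v t)) has_integral of_real (f b * integral {a..b} v)) {a..b}"
      by (simp add: o_def)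
    then have "((\<lambda>t. of_real (f' t) * integral {a..t} (\<lambda>t. complex_of_real (v t)) + of_real (f t) * of_real (v t)) has_integral
        of_real (f b * integral {a..b} v)) {a..b}"
      by (rule has_integral_eq[rotated]) (simp add: i)
    moreover have "complex_of_real (f b * integral {a..b} v) = of_real (f b) * integral {a..b} (\<lambda>t. complex_of_real (v t))"
      using ab by (simp add: i)
    ultimately show ?thesis using v(1) by (auto simp: BP_def set_integrable_def scaleR_conv_of_real complex_of_real_integrable_eq simp flip: of_real_mult)
  qed
  have rw: "BP (\<lambda>t. of_real (f t)) (\<lambda>t. of_real (f' t)) w"
    if f: "\<And>t. (f has_real_derivative f' t) (at t)" for f f'
  proof -
    have wi: "integrable lborel (\<lambda>t. indicator {a..b} t *\<^sub>R w t)" using w by (simp add: set_integrable_def)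
    have r: "set_integrable lborel {a..b} (\<lambda>t. Re (w t))" "set_integrable lborel {a..b} (\<lambda>t. Im (w t))"
      using integrable_Re[OF wi] integrable_Im[OF wi] by (auto simp: set_integrable_def)
    have p: "set_integrable lborel {a..b} (\<lambda>t. max 0 (v t))" if "set_integrable lborel {a..b} v" for v :: "real \<Rightarrow> real"
    proof -
      have "integrable lborel (\<lambda>t. max 0 (indicator {a..b} t *\<^sub>R v t))"
        using that by (intro integrable_max) (auto simp: set_integrable_def)
      also have "(\<lambda>t. max 0 (indicator {a..b} t *\<^sub>R v t)) = (\<lambda>t. indicator {a..b} t *\<^sub>R max 0 (v t))"
        by (auto simp: indicator_def fun_eq_iff)
      finally show ?thesis by (simp add: set_integrable_def)
    qed
    have m: "set_integrable lborel {a..b} (\<lambda>t. - v t)" if "set_integrable lborel {a..b} v" for v :: "real \<Rightarrow> real"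
      using that by (simp add: set_integrable_def)
    note BPr = real[OF f]
    have "BP (\<lambda>t. of_real (f t)) (\<lambda>t. of_real (f' t)) (\<lambda>t. ((of_real (max 0 (Re (w t))) + (-1) * of_real (max 0 (- Re (w t))))
      + \<i> * of_real (max 0 (Im (w t)))) + (- \<i>) * of_real (max 0 (- Im (w t))))"
      by (intro BP_addw BPr p r m) auto
    also have "(\<lambda>t. ((of_real (max 0 (Re (w t))) + (-1) * of_real (max 0 (- Re (w t))))
      + \<i> * of_real (max 0 (Im (w t)))) + (- \<i>) * of_real (max 0 (- Im (w t)))) = w"
      by (rule ext, rule complex_eqI) (auto simp: max_def)
    finally show ?thesis .
  qed
  have dr: "((\<lambda>t. Re (F t)) has_real_derivative Re (F' t)) (at t)" "((\<lambda>t. Im (F t)) has_real_derivative Im (F' t)) (at t)" for t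
    using bounded_linear.has_vector_derivative[OF bounded_linear_Re F[of t]] bounded_linear.has_vector_derivative[OF bounded_linear_Im F[of t]]
    by (auto simp: has_real_derivative_iff_has_vector_derivative)
  have "BP (\<lambda>t. of_real (Re (F t)) + \<i> * of_real (Im (F t))) (\<lambda>t. of_real (Re (F' t)) + \<i> * of_real (Im (F' t))) w"
    by (intro BP_addF rw dr)
  then have "BP F F' w" by (simp flip: complex_eq)
  then have "((\<lambda>t. F' t * integral {a..t} w + F t * w t) has_integral (F b * integral {a..b} w)) {a..b}" by (simp add: BP_def)
  moreover have "((\<lambda>t. F' t * y0) has_integral ((F b - F a) * y0)) {a..b}"
    using ab F by (intro has_integral_mult_left fundamental_theorem_of_calculus) (auto intro: has_vector_derivative_at_within)
  ultimately have "((\<lambda>t. (F' t * integral {a..t} w + F t * w t) + F' t * y0) has_integral (F b * integral {a..b} w + (F b - F a) * y0)) {a..b}"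
    by (rule has_integral_add)
  then show ?thesis by (simp add: algebra_simps)
qed

section \<open>Weak derivatives on the line\<close>

text \<open>A primitive that starts left of the support is constant to the right of it, and the
  constant is the total integral; mean zero is what makes it compactly supported.\<close>

lemma test_fun_primitive:
  fixes f :: "real \<Rightarrow> complex"
  assumes f: "test_fun f" and supp: "\<And>t. t \<notin> {A..B} \<Longrightarrow> f t = 0" and zero: "(LINT t|lborel. f t) = 0"
  obtains F where "test_fun F" "\<And>t. (F has_vector_derivative f t) (at t)" "\<And>t. t \<notin> {A..B} \<Longrightarrow> F t = 0"
proof -
  define F where "F t = integral {A - 1..t} f" for t
  have cont: "continuous_on S f" for S
    using smooth_continuous[OF test_fun_smooth[OF f]] by (rule continuous_on_subset) simp
  have F0: "F t = 0" if "t < A" for t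
  proof -
    have "F t = integral {A - 1..t} (\<lambda>_. 0)"
      unfolding F_def by (rule Henstock_Kurzweil_Integration.integral_cong) (use supp that in auto)
    then show ?thesis by simp
  qed
  have F1: "F t = 0" if "t > B" for t
  proof -
    have s: "set_integrable lborel {A - 1..t} f"
      unfolding set_integrable_def
      by (rule Bochner_Integration.integrable_bound[OF test_fun_integrable[OF f]])
         (use test_fun_measurable[OF f] in \<open>auto simp: indicator_def\<close>)
    have "F t = (LINT s:{A - 1..t}|lborel. f s)"
      unfolding F_def using set_borel_integral_eq_integral(2)[OF s] by simp
    also have "\<dots> = (LINT s|lborel. f s)"
      unfolding set_lebesgue_integral_def
      by (intro Bochner_Integration.integral_cong refl) (use supp that in \<open>force simp: indicator_def\<close>)
    finally show ?thesis using zero by simp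
  qed
  have d: "(F has_vector_derivative f t) (at t)" for t
  proof (cases "t < A")
    case True
    have "(F has_vector_derivative 0) (at t)"
      by (rule has_vector_derivative_transform_within_open[where S="{..<A}" and f="\<lambda>_. 0"])
         (use True F0 in auto)
    then show ?thesis using True supp[of t] by simp
  next
    case False
    have "(F has_vector_derivative f t) (at t within {A - 1..t + 1})"
      unfolding F_def by (intro integral_has_vector_derivative cont) (use False in auto)
    moreover have "t \<in> interior {A - 1..t + 1}" using False by simp
    ultimately show ?thesis using at_within_interior by metis
  qed
  have diff: "F differentiable_on UNIV"
    using d unfolding differentiable_on_def differentiable_def has_vector_derivative_def by blast
  have "pd b F = f" if "b \<in> Basis" for b
    using pd_has_vector_derivative[OF d] that by (auto simp: fun_eq_iff)
  then have "smooth F" using test_fun_smooth[OF f] by (intro smoothI[OF diff]) simp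
  moreover have supF: "{t. F t \<noteq> 0} \<subseteq> {A..B}" using F0 F1 by force
  ultimately have "test_fun F" by (auto simp: test_fun_iff intro: bounded_subset[OF bounded_closed_interval])
  moreover have "F t = 0" if "t \<notin> {A..B}" for t using supF that by blast
  ultimately show thesis using that d by blast
qed

lemma bump_integral_pos:
  fixes a b :: real
  assumes "a < b" "k > 0" shows "(LINT t|lborel. bump k a b t) > 0"
proof -
  have i: "integrable lborel (bump k a b)"
    using test_fun_integrable[OF test_fun_bump[of k a b]] by (simp add: complex_of_real_integrable_eq)
  have "(LINT t|lborel. bump k a b t) \<noteq> 0"
  proof
    assume "(LINT t|lborel. bump k a b t) = 0"
    then have "AE t in lborel. bump k a b t = 0"
      using integral_nonneg_eq_0_iff_AE[OF i] by (simp add: bump_bounds)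
    then have "AE t in lborel. t \<notin> {a<..<b}"
      by eventually_elim (use bump_pos[of _ a b k] assms in force)
    then have "emeasure lborel {a<..<b} = 0"
      using AE_iff_measurable[of "{a<..<b}" lborel "\<lambda>t. t \<notin> {a<..<b}"]
      by (auto simp: greaterThanLessThan_def greaterThan_def lessThan_def Collect_conj_eq)
    then show False using assms by simp
  qed
  then show ?thesis using integral_nonneg_AE[of "bump k a b" lborel] by (simp add: bump_bounds less_le)
qed

text \<open>A countable family of these primitives detects weak derivatives on the line.\<close>

definition bump_ratio :: "real \<Rightarrow> real \<Rightarrow> nat \<Rightarrow> real" where
  "bump_ratio a b k = (LINT t|lborel. bump k a b t) / (LINT t|lborel. bump 1 (-1) 1 (t::real))"

lemma bump_primitive_exists:
  "\<exists>F. test_fun F \<and>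
     (\<forall>t. (F has_vector_derivative of_real (bump k a b t - bump_ratio a b k * bump 1 (-1) 1 t)) (at t)) \<and>
     (\<forall>t. t \<notin> {min a (-1)..max b 1} \<longrightarrow> F t = 0)"
proof -
  let ?f = "\<lambda>t. complex_of_real (bump k a b t - bump_ratio a b k * bump 1 (-1) 1 t)"
  have tf: "test_fun ?f"
    using test_fun_add[OF test_fun_bump[of k a b] test_fun_cmult[OF test_fun_bump[of 1 "-1" "1::real"], of "- of_real (bump_ratio a b k)"]]
    by simp
  have i: "integrable lborel (bump k a b)" for k and a b :: real
    using test_fun_integrable[OF test_fun_bump[of k a b]] by (simp add: complex_of_real_integrable_eq)
  have "(LINT t|lborel. ?f t) = of_real ((LINT t|lborel. bump k a b t) - bump_ratio a b k * (LINT t|lborel. bump 1 (-1) 1 (t::real)))"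
    using i by (simp del: of_real_diff of_real_mult)
  also have "\<dots> = 0" using bump_integral_pos[of "-1" 1 1] by (simp add: bump_ratio_def)
  finally have z: "(LINT t|lborel. ?f t) = 0" .
  have s: "?f t = 0" if "t \<notin> {min a (-1)..max b 1}" for t
    using that bump_eq_0[of t a b k] bump_eq_0[of t "-1" 1 1] by (auto simp: min_def max_def split: if_splits)
  from test_fun_primitive[OF tf s z] show ?thesis by metis
qed

text \<open>\<open>SOME\<close> fixes one primitive for each triple a, b, k. With rational a and b
  there are countably many, so a property that each of them has for almost every x holds for all of
  them at once for almost every x.\<close>

definition bump_primitive :: "real \<Rightarrow> real \<Rightarrow> nat \<Rightarrow> real \<Rightarrow> complex" where
  "bump_primitive a b k = (SOME F. test_fun F \<and>
     (\<forall>t. (F has_vector_derivative of_real (bump k a b t - bump_ratio a b k * bump 1 (-1) 1 t)) (at t)) \<and>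
     (\<forall>t. t \<notin> {min a (-1)..max b 1} \<longrightarrow> F t = 0))"

lemma bump_primitive:
  "test_fun (bump_primitive a b k)"
  "(bump_primitive a b k has_vector_derivative of_real (bump k a b t - bump_ratio a b k * bump 1 (-1) 1 t)) (at t)"
  "t \<notin> {min a (-1)..max b 1} \<Longrightarrow> bump_primitive a b k t = 0"
  using someI_ex[OF bump_primitive_exists[of k a b]] unfolding bump_primitive_def[symmetric] by blast+

lemma L2_set_integrable:
  fixes y :: "real \<Rightarrow> complex"
  assumes "L2 y" shows "set_integrable lborel {a..b} y"
proof -
  have "L2 (\<lambda>t::real. complex_of_real (indicator {a..b} t))"
    by (rule bounded_support_integrable(2)[where B=1])
       (auto simp: indicator_def intro: bounded_subset[of "{a..b}"])
  from L2_mult_integrable[OF this assms] show ?thesis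
    by (simp add: set_integrable_def scaleR_conv_of_real)
qed

text \<open>The du Bois-Reymond lemma from countably many tests. The difference w of y and the
  primitive of y1 is orthogonal to \<open>bump k a b\<close> minus \<open>bump_ratio\<close> times
  the reference bump on (-1, 1). Hence w - c is orthogonal to all bumps with rational end points,
  and letting k grow it integrates to 0 over rational boxes; continuity of the indefinite integral
  reaches all boxes. The window must contain (-1, 1), where the reference bump lives.\<close>

lemma weak_derivative_absolutely_continuous:
  fixes y y1 :: "real \<Rightarrow> complex"
  assumes y: "L2 y" "L2 y1"
    and weak: "\<And>a b k. a \<in> \<rat> \<Longrightarrow> b \<in> \<rat> \<Longrightarrow>
      (LINT t|lborel. y t * pd 1 (bump_primitive a b k) t) = - (LINT t|lborel. y1 t * bump_primitive a b k t)"
    and N: "N > 1"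
  obtains c where "AE t in lborel. t \<in> {-N..N} \<longrightarrow> y t = c + integral {-N..t} y1"
proof -
  have [measurable]: "y \<in> borel_measurable borel" "y1 \<in> borel_measurable borel" using y by (auto simp: L2_def)
  define I where "I t = integral {-N..t} y1" for t
  have y1s: "set_integrable lborel {-N..N} y1" by (rule L2_set_integrable) fact
  then have y1i: "y1 integrable_on {-N..N}" by (rule set_borel_integral_eq_integral)
  have I_cont: "continuous_on {-N..N} I" unfolding I_def by (rule indefinite_integral_continuous_1[OF y1i])
  \<comment> \<open>The primitive is cut off to the window so as to be in L^2; pairings with
    functions supported there do not change.\<close>
  define J where "J t = indicator {-N..N} t *\<^sub>R I t" for t
  have [measurable]: "J \<in> borel_measurable borel"
    unfolding J_def[abs_def] by (intro borel_measurable_continuous_on_indicator I_cont) simp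
  obtain BI where "\<forall>x\<in>I ` {-N..N}. norm x \<le> BI"
    using compact_imp_bounded[OF compact_continuous_image[OF I_cont compact_Icc]] unfolding bounded_iff by blast
  then have JB: "norm (J t) \<le> max 0 BI" for t
    by (auto simp: J_def indicator_def intro: max.coboundedI2)
  have JL: "L2 J"
  proof (rule bounded_support_integrable(2)[OF _ JB])
    show "bounded {t. J t \<noteq> 0}" by (rule bounded_subset[of "{-N..N}"]) (auto simp: J_def indicator_def)
  qed simp
  define w where "w t = y t - J t" for t
  have w: "L2 w" unfolding w_def by (intro L2_diff y JL)
  \<comment> \<open>The only candidate for the constant: the mean of w weighted by the reference
    bump.\<close>
  define c where "c = (LINT t|lborel. w t * of_real (bump 1 (-1) 1 t)) / of_real (LINT t|lborel. bump 1 (-1) 1 (t::real))"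
  define q where "q t = indicator {-N..N} t *\<^sub>R (w t - c)" for t
  have [measurable]: "q \<in> borel_measurable borel" "w \<in> borel_measurable borel" unfolding q_def w_def by measurable
  have wb: "integrable lborel (\<lambda>t. w t * of_real (bump k a b t))" for a b k
    by (intro L2_mult_integrable w test_fun_L2 test_fun_bump)
  have bi: "integrable lborel (\<lambda>t. complex_of_real (bump k a b t))" for k and a b :: real
    by (intro test_fun_integrable test_fun_bump)
  have key: "(LINT t|lborel. of_real (bump k a b t) * q t) = 0"
    if ab: "a \<in> \<rat>" "b \<in> \<rat>" "-N < a" "a < b" "b < N" for a b k
  proof -
    define Z where "Z = bump_primitive a b k"
    define f where "f t = complex_of_real (bump k a b t - bump_ratio a b k * bump 1 (-1) 1 t)" for t :: real
    have Zd: "(Z has_vector_derivative f t) (at t)" for t unfolding Z_def f_def by (rule bump_primitive)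
    have Ztf: "test_fun Z" unfolding Z_def by (rule bump_primitive)
    have pdZ: "pd 1 Z t = f t" for t by (rule pd_has_vector_derivative[OF Zd])
    have Z0: "Z t = 0" "f t = 0" if "t \<notin> {-N<..<N}" for t
    proof -
      show "Z t = 0" unfolding Z_def using that ab N by (intro bump_primitive(3)) auto
      show "f t = 0" using that ab N bump_eq_0[of t a b k] bump_eq_0[of t "-1" 1 1] by (auto simp: f_def)
    qed
    have "((\<lambda>t. f t * (0 + integral {-N..t} y1) + Z t * y1 t) has_integral
      (Z N * (0 + integral {-N..N} y1) - Z (-N) * 0)) {-N..N}"
      using N by (intro byparts_complex Zd y1s) auto
    then have bp: "((\<lambda>t. f t * I t + Z t * y1 t) has_integral 0) {-N..N}"
      using Z0 N by (simp add: I_def)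
    have i1: "integrable lborel (\<lambda>t. f t * J t)"
      using L2_mult_integrable[OF test_fun_L2[OF test_fun_pd[OF Ztf, of 1]] JL] pdZ by simp
    have i2: "integrable lborel (\<lambda>t. Z t * y1 t)"
      by (intro L2_mult_integrable test_fun_L2 Ztf y)
    have i3: "integrable lborel (\<lambda>t. f t * J t + Z t * y1 t)" using i1 i2 by simp
    have "(LINT t|lborel. f t * J t + Z t * y1 t) = (LINT t:{-N..N}|lborel. f t * J t + Z t * y1 t)"
      unfolding set_lebesgue_integral_def
      by (intro Bochner_Integration.integral_cong refl) (use Z0 in \<open>auto simp: indicator_def\<close>)
    also have "\<dots> = integral {-N..N} (\<lambda>t. f t * J t + Z t * y1 t)"
      by (intro set_borel_integral_eq_integral)
         (auto simp: set_integrable_def intro!: integrable_mult_indicator i3)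
    also have "\<dots> = integral {-N..N} (\<lambda>t. f t * I t + Z t * y1 t)"
      by (intro Henstock_Kurzweil_Integration.integral_cong) (simp add: J_def)
    also have "\<dots> = 0" using bp by (rule integral_unique)
    finally have "(LINT t|lborel. f t * J t) = - (LINT t|lborel. Z t * y1 t)"
      using i1 i2 by (simp add: add_eq_0_iff)
    moreover have "(LINT t|lborel. y t * f t) = - (LINT t|lborel. Z t * y1 t)"
      using weak[OF ab(1,2), of k] by (simp add: Z_def[symmetric] pdZ mult.commute)
    moreover have "integrable lborel (\<lambda>t. y t * f t)"
      using L2_mult_integrable[OF y(1) test_fun_L2[OF test_fun_pd[OF Ztf, of 1]]] pdZ by simp
    ultimately have "(LINT t|lborel. w t * f t) = 0"
      using i1 by (simp add: w_def left_diff_distrib mult.commute[of _ "J _"])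
    moreover have "(\<lambda>t. w t * f t) = (\<lambda>t. w t * of_real (bump k a b t) - of_real (bump_ratio a b k) * (w t * of_real (bump 1 (-1) 1 t)))"
      by (simp add: f_def fun_eq_iff algebra_simps)
    ultimately have wk: "(LINT t|lborel. w t * of_real (bump k a b t)) = of_real (bump_ratio a b k) * (LINT t|lborel. w t * of_real (bump 1 (-1) 1 t))"
      using wb[of k a b] wb[of 1 "-1" 1] by simp
    have "(LINT t|lborel. of_real (bump k a b t) * q t) = (LINT t|lborel. w t * of_real (bump k a b t) - c * of_real (bump k a b t))"
    proof (intro Bochner_Integration.integral_cong refl)
      fix t show "of_real (bump k a b t) * q t = w t * of_real (bump k a b t) - c * of_real (bump k a b t)"
        using ab bump_eq_0[of t a b k] by (cases "t \<in> {-N..N}") (auto simp: q_def algebra_simps)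
    qed
    also have "\<dots> = of_real (bump_ratio a b k) * (LINT t|lborel. w t * of_real (bump 1 (-1) 1 t)) - c * of_real (LINT t|lborel. bump k a b t)"
      using wb bi by (simp add: wk)
    also have "\<dots> = 0" using bump_integral_pos[of "-1" 1 1] by (simp add: c_def bump_ratio_def)
    finally show ?thesis .
  qed
  have qi: "integrable lborel q"
  proof -
    have "set_integrable lborel {-N..N} w" by (rule L2_set_integrable[OF w])
    moreover have "set_integrable lborel {-N..N} (\<lambda>_. c)"
      unfolding set_integrable_def by (intro integrable_scaleR_left integrable_real_indicator) (simp_all add: emeasure_lborel_Icc_eq)
    ultimately have "set_integrable lborel {-N..N} (\<lambda>t. w t - c)" by (rule set_integral_diff)
    then show ?thesis by (simp add: q_def[abs_def] set_integrable_def)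
  qed
  have qc: "integrable lborel (\<lambda>t. indicator A t *\<^sub>R q t)" if "A \<in> sets borel" for A
    using integrable_mult_indicator[of A lborel q] qi that by simp
  have qh: "q integrable_on {a..b}" for a b
    by (intro set_borel_integral_eq_integral) (simp add: set_integrable_def qc)
  define \<Phi> where "\<Phi> t = integral {-N..t} q" for t
  have box: "(LINT t|lborel. indicator (box a b) t *\<^sub>R q t) = \<Phi> b - \<Phi> a" if "-N \<le> a" "a \<le> b" for a b
  proof -
    have "set_integrable lborel (box a b) q" using qc by (simp add: set_integrable_def)
    from set_borel_integral_eq_integral(2)[OF this]
    have "(LINT t|lborel. indicator (box a b) t *\<^sub>R q t) = integral {a..b} q"
      by (simp add: set_lebesgue_integral_def integral_open_interval_real)
    then show ?thesis
      using Henstock_Kurzweil_Integration.integral_combine[of "-N" a b q] that qh by (simp add: \<Phi>_def algebra_simps)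
  qed
  have \<Phi>rat: "\<Phi> b = \<Phi> a" if "a \<in> {-N<..<N} \<inter> \<rat>" "b \<in> {-N<..<N} \<inter> \<rat>" "a < b" for a b
    using box_integral_of_bump[of a b q, OF qc key] box[of a b] that by auto
  have \<Phi>0: "\<Phi> b = \<Phi> 0" if "b \<in> {-N<..<N} \<inter> \<rat>" for b
  proof -
    have "0 \<in> {-N<..<N} \<inter> \<rat>" using N by simp
    then show ?thesis using \<Phi>rat[of 0 b] \<Phi>rat[of b 0] that by (metis linorder_cases)
  qed
  \<comment> \<open>A continuous function is determined by its values at rational points, so \<Phi>
    is constant on the closed window.\<close>
  have cl: "closure ({-N<..<N} \<inter> \<rat>) = {-N..N}"
    using closure_open_Int_superset[of "{-N<..<N}" \<rat>] N by (simp add: Rats_closure_real)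
  have \<Phi>c: "\<Phi> t = \<Phi> 0" if "t \<in> {-N..N}" for t
  proof (rule continuous_constant_on_closure[of "{-N<..<N} \<inter> \<rat>" \<Phi> "\<Phi> 0" t, unfolded cl])
    show "continuous_on {-N..N} \<Phi>" unfolding \<Phi>_def by (rule indefinite_integral_continuous_1[OF qh])
  qed (fact \<Phi>0 that)+
  have "(LINT t|lborel. indicator (box a b) t *\<^sub>R q t) = 0" for a b
  proof -
    \<comment> \<open>As q vanishes outside the window, an arbitrary box may be intersected with it;
      the open box and the closed window disagree at most at the two end points.\<close>
    define a' b' where "a' = max a (-N)" and "b' = min b N"
    have eq: "indicator (box a b) t *\<^sub>R q t = indicator (box a' b') t *\<^sub>R q t" if "t \<noteq> N" "t \<noteq> -N" for t
      using that by (auto simp: q_def a'_def b'_def indicator_def)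
    have "AE t in lborel. t \<noteq> N" "AE t in lborel. t \<noteq> -N" by (rule AE_lborel_singleton)+
    then have "AE t in lborel. indicator (box a b) t *\<^sub>R q t = indicator (box a' b') t *\<^sub>R q t"
      by eventually_elim (rule eq)
    then have "(LINT t|lborel. indicator (box a b) t *\<^sub>R q t) = (LINT t|lborel. indicator (box a' b') t *\<^sub>R q t)"
      by (intro integral_cong_AE) auto
    also have "\<dots> = 0"
    proof (cases "a' \<le> b'")
      case True
      then have "-N \<le> a'" "a' \<in> {-N..N}" "b' \<in> {-N..N}" by (auto simp: a'_def b'_def)
      then show ?thesis using box[of a' b'] \<Phi>c[of a'] \<Phi>c[of b'] True by simp
    next
      case False
      then have "box a' b' = {}" by (auto simp: box_real)
      then show ?thesis by simp
    qed
    finally show ?thesis .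
  qed
  then have "AE t in lborel. q t = 0"
    by (intro AE_zero_if_box_integrals) (auto intro: qc)
  then have "AE t in lborel. t \<in> {-N..N} \<longrightarrow> y t = c + I t"
    by eventually_elim (auto simp: q_def w_def J_def)
  then show thesis unfolding I_def by (rule that)
qed

lemma exp_gaussian_bound_tendsto: "(\<lambda>n. (A + B * (real n + 2)) * exp (- (real n + 2)\<^sup>2 / 2)) \<longlonglongrightarrow> (0::real)"
proof (rule Lim_null_comparison)
  have lim: "((\<lambda>x::real. x ^ k / exp x) \<longlongrightarrow> 0) at_top" for k by (rule tendsto_power_div_exp_0)
  have fl: "filterlim (\<lambda>n. real n + 2) at_top sequentially"
    using filterlim_tendsto_add_at_top[OF tendsto_const[of "2::real"] filterlim_real_sequentially] by (simp add: add.commute)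
  have l: "(\<lambda>n. (real n + 2) ^ k / exp (real n + 2)) \<longlonglongrightarrow> 0" for k
    using filterlim_compose[OF lim fl] by simp
  have "(\<lambda>n. exp (1/2) * (\<bar>A\<bar> * ((real n + 2) ^ 0 / exp (real n + 2)) + \<bar>B\<bar> * ((real n + 2) ^ 1 / exp (real n + 2)))) \<longlonglongrightarrow> exp (1/2) * (\<bar>A\<bar> * 0 + \<bar>B\<bar> * 0)"
    by (intro tendsto_intros l)
  then show "(\<lambda>n. exp (1/2) * (\<bar>A\<bar> * ((real n + 2) ^ 0 / exp (real n + 2)) + \<bar>B\<bar> * ((real n + 2) ^ 1 / exp (real n + 2)))) \<longlonglongrightarrow> 0" by simp
  show "\<forall>\<^sub>F n in sequentially. norm ((A + B * (real n + 2)) * exp (- (real n + 2)\<^sup>2 / 2))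
     \<le> exp (1/2) * (\<bar>A\<bar> * ((real n + 2) ^ 0 / exp (real n + 2)) + \<bar>B\<bar> * ((real n + 2) ^ 1 / exp (real n + 2)))"
  proof (rule always_eventually, rule allI)
    fix n
    define x where "x = real n + 2"
    have x: "x > 0" by (simp add: x_def)
    \<comment> \<open>This is (x - 1)^2 \<ge> 0; it trades the Gaussian for a plain
      exponential.\<close>
    have "- x\<^sup>2 / 2 \<le> 1/2 - x" using zero_le_power2[of "x - 1"] by (simp add: power2_diff field_simps)
    then have "exp (- x\<^sup>2 / 2) \<le> exp (1/2 - x)" by simp
    then have e: "exp (- x\<^sup>2 / 2) \<le> exp (1/2) / exp x" by (simp add: exp_diff)
    have "\<bar>A + B * x\<bar> \<le> \<bar>A\<bar> + \<bar>B\<bar> * x" using abs_triangle_ineq[of A "B * x"] x by (simp add: abs_mult)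
    then have "norm ((A + B * x) * exp (- x\<^sup>2 / 2)) \<le> (\<bar>A\<bar> + \<bar>B\<bar> * x) * (exp (1/2) / exp x)"
      unfolding norm_mult using e x by (intro mult_mono) auto
    then show "norm ((A + B * (real n + 2)) * exp (- (real n + 2)\<^sup>2 / 2))
     \<le> exp (1/2) * (\<bar>A\<bar> * ((real n + 2) ^ 0 / exp (real n + 2)) + \<bar>B\<bar> * ((real n + 2) ^ 1 / exp (real n + 2)))"
      unfolding x_def[symmetric] by (simp add: field_simps)
  qed
qed

text \<open>The integrand r is the derivative of M y, so its integral over [-N, N] consists of
  boundary terms. As y and its weak derivative are in L^2, the values of y at the ends grow at most
  linearly in N, and the Gaussian bound on M wins. Integrability is demanded of r as a whole, since
  M' y by itself may fail to be integrable.\<close>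

lemma weak_product_integral_zero:
  fixes y y1 M M' r :: "real \<Rightarrow> complex"
  assumes y: "L2 y" "L2 y1"
    and weak: "\<And>a b k. a \<in> \<rat> \<Longrightarrow> b \<in> \<rat> \<Longrightarrow>
      (LINT t|lborel. y t * pd 1 (bump_primitive a b k) t) = - (LINT t|lborel. y1 t * bump_primitive a b k t)"
    and M: "\<And>t. (M has_vector_derivative M' t) (at t)" "\<And>t. norm (M t) \<le> K * exp (- t\<^sup>2 / 2)"
    and r: "AE t in lborel. M' t * y t + M t * y1 t = r t" "integrable lborel r"
  shows "(LINT t|lborel. r t) = 0"
proof -
  have K: "K \<ge> 0" using order_trans[OF norm_ge_zero M(2)[of 0]] by simp
  \<comment> \<open>The summand 1 comes from averaging over the unit interval [0, 1], the other two
    from the L^2 bounds on y and y1; A + 2N will bound y on the window.\<close>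
  define A where "A = 1 + (LINT t|lborel. (norm (y t))\<^sup>2) + (LINT t|lborel. (norm (y1 t))\<^sup>2)"
  have yi: "integrable lborel (\<lambda>t. (norm (y t))\<^sup>2)" "integrable lborel (\<lambda>t. (norm (y1 t))\<^sup>2)"
    using y by (auto simp: L2_iff_integrable)
  \<comment> \<open>Turns L^2 bounds into L^1 bounds on bounded intervals, at the cost of the length
    of the interval.\<close>
  have le_sq: "x \<le> 1 + x\<^sup>2" for x :: real
    using zero_le_power2[of "x - 1/2"] by (simp add: power2_diff field_simps)
  have bound: "norm (LINT t:{-N..N}|lborel. r t) \<le> 2 * K * ((A + 2 * N) * exp (- N\<^sup>2 / 2))" if N: "N > 1" for N
  proof -
    obtain c where c: "AE t in lborel. t \<in> {-N..N} \<longrightarrow> y t = c + integral {-N..t} y1"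
      using weak_derivative_absolutely_continuous[OF y weak N] by blast
    define I where "I t = integral {-N..t} y1" for t
    have s: "set_integrable lborel {-N..N} y1" by (rule L2_set_integrable) fact
    have sn: "set_integrable lborel {-N..N} (\<lambda>t. norm (y1 t))" using s by (rule set_integrable_norm)
    define S where "S = integral {-N..N} (\<lambda>t. norm (y1 t))"
    have "((\<lambda>t. M' t * (c + I t) + M t * y1 t) has_integral (M N * (c + I N) - M (-N) * c)) {-N..N}"
      unfolding I_def using N by (intro byparts_complex M s) auto
    moreover have ae: "AE t in lborel. t \<in> {-N..N} \<longrightarrow> M' t * (c + I t) + M t * y1 t = r t"
      using c r(1) by eventually_elim (auto simp: I_def)
    \<comment> \<open>Henstock-Kurzweil integrals ignore null sets, so the boundary formula passes
      to r; since r is Lebesgue integrable, this is also its Lebesgue integral.\<close>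
    ultimately have hr: "(r has_integral (M N * (c + I N) - M (-N) * c)) {-N..N}"
      by (simp only: has_integral_AE[OF ae])
    have "set_integrable lborel {-N..N} r"
      unfolding set_integrable_def by (intro integrable_mult_indicator r) auto
    from set_borel_integral_eq_integral(2)[OF this] integral_unique[OF hr]
    have eq: "(LINT t:{-N..N}|lborel. r t) = M N * (c + I N) - M (-N) * c" by simp
    have S: "S \<le> 2 * N + (LINT t|lborel. (norm (y1 t))\<^sup>2)"
    proof -
      have "S = (LINT t:{-N..N}|lborel. norm (y1 t))" unfolding S_def using set_borel_integral_eq_integral(2)[OF sn] by simp
      also have "\<dots> \<le> (LINT t|lborel. indicator {-N..N} t + (norm (y1 t))\<^sup>2)"
        unfolding set_lebesgue_integral_def
      proof (rule integral_mono)
        show "integrable lborel (\<lambda>t. indicator {-N..N} t + (norm (y1 t))\<^sup>2)"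
          using N by (intro Bochner_Integration.integrable_add yi integrable_real_indicator) auto
        show "indicator {-N..N} t *\<^sub>R norm (y1 t) \<le> indicator {-N..N} t + (norm (y1 t))\<^sup>2" for t
          using le_sq[of "norm (y1 t)"] by (auto simp: indicator_def)
      qed (use sn in \<open>simp add: set_integrable_def\<close>)
      also have "\<dots> = 2 * N + (LINT t|lborel. (norm (y1 t))\<^sup>2)"
        using N yi by (subst Bochner_Integration.integral_add) auto
      finally show ?thesis .
    qed
    have osc: "norm (I t - I s) \<le> S" if st: "s \<in> {-N..N}" "t \<in> {-N..N}" "s \<le> t" for s t
    proof -
      have i: "y1 integrable_on {a..b}" "(\<lambda>t. norm (y1 t)) integrable_on {a..b}" if "a \<ge> -N" "b \<le> N" for a b
        using integrable_on_subinterval[OF set_borel_integral_eq_integral(1)[OF s], of a b] that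
          integrable_on_subinterval[OF set_borel_integral_eq_integral(1)[OF sn], of a b] by auto
      have "I t - I s = integral {s..t} y1"
        using Henstock_Kurzweil_Integration.integral_combine[of "-N" s t y1] st i[of "-N" t] by (simp add: I_def algebra_simps)
      also have "norm \<dots> \<le> integral {s..t} (\<lambda>t. norm (y1 t))"
        using i[of s t] st by (intro integral_norm_bound_integral) auto
      also have "\<dots> \<le> S" unfolding S_def using i st by (intro integral_subset_le) auto
      finally show ?thesis .
    qed
    \<comment> \<open>A pointwise bound from an L^2 bound: every value of c + I differs from those
      on [0, 1] by at most S, the integral of |y1| over the window, and those on [0, 1] are
      controlled by averaging.\<close>
    have Y: "norm (c + I \<tau>) \<le> A + 2 * N" if \<tau>: "\<tau> \<in> {-N..N}" for \<tau>
    proof -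
      have "(LINT t|lborel. (norm (c + I \<tau>) - S) * indicator {0..1} (t::real)) \<le> (LINT t|lborel. indicator {0..1} t + (norm (y t))\<^sup>2)"
      proof (rule integral_mono_AE)
        show "integrable lborel (\<lambda>t. (norm (c + I \<tau>) - S) * indicator {0..1::real} t)"
          by (intro integrable_mult_right integrable_real_indicator) auto
        show "integrable lborel (\<lambda>t. indicator {0..1} t + (norm (y t))\<^sup>2)"
          by (intro Bochner_Integration.integrable_add yi integrable_real_indicator) auto
        show "AE t in lborel. (norm (c + I \<tau>) - S) * indicator {0..1} t \<le> indicator {0..1} t + (norm (y t))\<^sup>2"
          using c
        proof eventually_elim
          case (elim t)
          show ?case
          proof (cases "t \<in> {0..1}")
            case True
            then have t: "t \<in> {-N..N}" using N by auto
            have "norm (I \<tau> - I t) \<le> S"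
              using osc[of t \<tau>] osc[of \<tau> t] t \<tau> by (cases "t \<le> \<tau>") (auto simp: norm_minus_commute)
            moreover have "c + I \<tau> = y t + (I \<tau> - I t)" using elim t by (simp add: I_def)
            ultimately have "norm (c + I \<tau>) \<le> norm (y t) + S" using norm_triangle_ineq[of "y t" "I \<tau> - I t"] by (metis add_left_mono order_trans)
            then show ?thesis using True le_sq[of "norm (y t)"] by simp
          qed simp
        qed
      qed
      then have "norm (c + I \<tau>) - S \<le> 1 + (LINT t|lborel. (norm (y t))\<^sup>2)"
        using yi by (subst (asm) Bochner_Integration.integral_add) auto
      then show ?thesis using S by (simp add: A_def)
    qed
    have A: "A + 2 * N \<ge> 0" using order_trans[OF norm_ge_zero Y[of N]] N by simp
    have I0: "I (-N) = 0" by (simp add: I_def)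
    have "norm (M N * (c + I N)) \<le> (K * exp (- N\<^sup>2 / 2)) * (A + 2 * N)"
      unfolding norm_mult using M(2)[of N] Y[of N] N K by (intro mult_mono) auto
    moreover have "norm (M (-N) * c) \<le> (K * exp (- N\<^sup>2 / 2)) * (A + 2 * N)"
      unfolding norm_mult using M(2)[of "-N"] Y[of "-N"] N K I0 by (intro mult_mono) auto
    ultimately show ?thesis
      unfolding eq using norm_triangle_ineq4[of "M N * (c + I N)" "M (-N) * c"] by (simp add: algebra_simps)
  qed
  have "(\<lambda>n. LINT t:{-(real n + 2)..real n + 2}|lborel. r t) \<longlonglongrightarrow> (LINT t|lborel. r t)"
    unfolding set_lebesgue_integral_def
  proof (rule integral_dominated_convergence[where w="\<lambda>t. norm (r t)"])
    show "AE t in lborel. (\<lambda>n. indicator {-(real n + 2)..real n + 2} t *\<^sub>R r t) \<longlonglongrightarrow> r t"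
    proof (rule AE_I2, rule tendsto_eventually)
      fix t :: real
      have "eventually (\<lambda>n. real n \<ge> \<bar>t\<bar>) sequentially"
        by (rule eventually_compose_filterlim[OF eventually_ge_at_top filterlim_real_sequentially])
      then show "\<forall>\<^sub>F n in sequentially. indicator {-(real n + 2)..real n + 2} t *\<^sub>R r t = r t"
        by eventually_elim (auto simp: indicator_def)
    qed
    show "AE t in lborel. norm (indicator {-(real n + 2)..real n + 2} t *\<^sub>R r t) \<le> norm (r t)" for n
      by (auto simp: indicator_def)
  qed (use r(2) in auto)
  moreover have "(\<lambda>n. LINT t:{-(real n + 2)..real n + 2}|lborel. r t) \<longlonglongrightarrow> 0"
  proof (rule Lim_null_comparison)
    show "\<forall>\<^sub>F n in sequentially. norm (LINT t:{-(real n + 2)..real n + 2}|lborel. r t) \<le> 2 * K * ((A + 2 * (real n + 2)) * exp (- (real n + 2)\<^sup>2 / 2))"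
      by (intro always_eventually allI bound) simp
    show "(\<lambda>n. 2 * K * ((A + 2 * (real n + 2)) * exp (- (real n + 2)\<^sup>2 / 2))) \<longlonglongrightarrow> 0"
      using tendsto_mult[OF tendsto_const[of "2 * K"] exp_gaussian_bound_tendsto[of A 2]] by simp
  qed
  ultimately show ?thesis by (rule LIMSEQ_unique)
qed

section \<open>Uniqueness of the Fourier transform\<close>

lemma integrable_mult_iexp:
  fixes y :: "real \<Rightarrow> complex"
  assumes "integrable lborel y" shows "integrable lborel (\<lambda>t. y t * iexp (\<sigma> * t))"
  by (rule Bochner_Integration.integrable_bound[OF assms])
     (use assms in \<open>auto simp: norm_mult\<close>)

text \<open>The positive and the negative part of r have equal transforms and, at \<sigma> = 0,
  equal mass m. If m > 0, dividing by m gives two probability densities with the same characteristic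
  function, and \<open>Levy_uniqueness\<close> identifies them.\<close>

lemma fourier_unique_real:
  fixes r :: "real \<Rightarrow> real"
  assumes r: "integrable lborel r" and z: "\<And>\<sigma>. (LINT t|lborel. of_real (r t) * iexp (\<sigma> * t)) = 0"
  shows "AE t in lborel. r t = 0"
proof -
  have [measurable]: "r \<in> borel_measurable borel" using r by auto
  define p where "p t = max 0 (r t)" for t
  define n where "n t = max 0 (- r t)" for t
  have pn: "integrable lborel p" "integrable lborel n" "\<And>t. p t \<ge> 0" "\<And>t. n t \<ge> 0"
    unfolding p_def n_def using r by auto
  have [measurable]: "p \<in> borel_measurable borel" "n \<in> borel_measurable borel" using pn by auto
  have eq: "(LINT t|lborel. of_real (p t) * iexp (\<sigma> * t)) = (LINT t|lborel. of_real (n t) * iexp (\<sigma> * t))" for \<sigma>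
  proof -
    have "integrable lborel (\<lambda>t. complex_of_real (p t) * iexp (\<sigma> * t))" "integrable lborel (\<lambda>t. complex_of_real (n t) * iexp (\<sigma> * t))"
      using pn by (auto intro!: integrable_mult_iexp simp: complex_of_real_integrable_eq simp del: of_real_mult)
    then have "(LINT t|lborel. of_real (p t) * iexp (\<sigma> * t)) - (LINT t|lborel. of_real (n t) * iexp (\<sigma> * t))
       = (LINT t|lborel. of_real (p t) * iexp (\<sigma> * t) - of_real (n t) * iexp (\<sigma> * t))" by simp
    also have "\<dots> = (LINT t|lborel. of_real (r t) * iexp (\<sigma> * t))"
      by (intro Bochner_Integration.integral_cong refl) (auto simp: p_def n_def max_def simp flip: left_diff_distrib)
    finally show ?thesis using z by simp
  qed
  define m where "m = (LINT t|lborel. p t)"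
  have m: "m = (LINT t|lborel. n t)" using eq[of 0] pn by (simp add: m_def)
  show ?thesis
  proof (cases "m = 0")
    case True
    then have "AE t in lborel. p t = 0" "AE t in lborel. n t = 0"
      using integral_nonneg_eq_0_iff_AE[OF pn(1)] integral_nonneg_eq_0_iff_AE[OF pn(2)] pn m by (auto simp: m_def)
    then show ?thesis by eventually_elim (auto simp: p_def n_def max_def split: if_splits)
  next
    case False
    then have mp: "m > 0" using integral_nonneg_AE[of p lborel] pn by (simp add: m_def less_le)
    have rd: "real_distribution (density lborel (\<lambda>t. ennreal (v t / m)))"
      if v: "integrable lborel v" "\<And>t. v t \<ge> 0" "(LINT t|lborel. v t) = m" for v :: "real \<Rightarrow> real"
    proof -
      have [measurable]: "v \<in> borel_measurable borel" using v(1) by auto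
      have "(\<integral>\<^sup>+t. ennreal (v t / m) \<partial>lborel) = ennreal (LINT t|lborel. v t / m)"
        using v mp by (intro nn_integral_eq_integral) auto
      then have "(\<integral>\<^sup>+t. ennreal (v t / m) \<partial>lborel) = 1" using v(3) mp by simp
      then have "prob_space (density lborel (\<lambda>t. ennreal (v t / m)))"
        by (intro prob_spaceI) (simp add: emeasure_density)
      then show ?thesis by (simp add: real_distribution_def real_distribution_axioms_def)
    qed
    have ch: "char (density lborel (\<lambda>t. ennreal (v t / m))) \<sigma> = (LINT t|lborel. of_real (v t) * iexp (\<sigma> * t)) / of_real m"
      if v: "integrable lborel v" "\<And>t. v t \<ge> 0" for v :: "real \<Rightarrow> real" and \<sigma>
    proof -
      have [measurable]: "v \<in> borel_measurable borel" using v(1) by auto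
      have "char (density lborel (\<lambda>t. ennreal (v t / m))) \<sigma> = (LINT t|lborel. (v t / m) *\<^sub>R iexp (\<sigma> * t))"
        unfolding char_def using v mp by (subst integral_density) auto
      also have "\<dots> = (LINT t|lborel. (of_real (v t) * iexp (\<sigma> * t)) / of_real m)"
        by (simp add: scaleR_conv_of_real)
      finally show ?thesis by simp
    qed
    have "density lborel (\<lambda>t. ennreal (p t / m)) = density lborel (\<lambda>t. ennreal (n t / m))"
    proof (rule Levy_uniqueness)
      show "real_distribution (density lborel (\<lambda>t. ennreal (p t / m)))" "real_distribution (density lborel (\<lambda>t. ennreal (n t / m)))"
        by (rule rd[OF pn(1,3) m_def[symmetric]], rule rd[OF pn(2,4) m[symmetric]])
      show "char (density lborel (\<lambda>t. ennreal (p t / m))) = char (density lborel (\<lambda>t. ennreal (n t / m)))"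
        by (rule ext) (simp only: ch[OF pn(1,3)] ch[OF pn(2,4)] eq)
    qed
    then have "AE t in lborel. ennreal (p t / m) = ennreal (n t / m)"
      by (subst (asm) sigma_finite_measure.density_unique_iff[OF lborel.sigma_finite_measure_axioms]) auto
    then show ?thesis
      by eventually_elim (use mp pn in \<open>auto simp: p_def n_def max_def field_simps split: if_splits\<close>)
  qed
qed

text \<open>Rational frequencies suffice because the transform of an integrable function is
  continuous; this keeps exceptional sets of x null in the application. Conjugation replaces
  \<sigma> by -\<sigma>, so the transforms of the real and imaginary part vanish as well.\<close>

lemma fourier_unique:
  fixes y :: "real \<Rightarrow> complex"
  assumes y: "integrable lborel y" and z: "\<And>\<sigma>. \<sigma> \<in> \<rat> \<Longrightarrow> (LINT t|lborel. y t * iexp (\<sigma> * t)) = 0"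
  shows "AE t in lborel. y t = 0"
proof -
  have [measurable]: "y \<in> borel_measurable borel" using y by auto
  define Y where "Y \<sigma> = (LINT t|lborel. y t * iexp (\<sigma> * t))" for \<sigma>
  have "continuous_on UNIV Y"
    unfolding continuous_on_sequentially comp_def
  proof (intro ballI allI impI, elim conjE)
    fix X :: "nat \<Rightarrow> real" and \<sigma> assume X: "X \<longlonglongrightarrow> \<sigma>"
    show "(\<lambda>n. Y (X n)) \<longlonglongrightarrow> Y \<sigma>"
      unfolding Y_def
    proof (rule integral_dominated_convergence[where w="\<lambda>t. norm (y t)"])
      show "AE t in lborel. (\<lambda>n. y t * iexp (X n * t)) \<longlonglongrightarrow> y t * iexp (\<sigma> * t)"
        by (intro AE_I2 tendsto_intros X)
    qed (use y in \<open>auto simp: norm_mult simp del: of_real_mult\<close>)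
  qed
  then have Y0: "Y \<sigma> = 0" for \<sigma>
    using continuous_constant_on_closure[of "\<rat>" Y 0 \<sigma>] z by (simp add: Rats_closure_real Y_def)
  have cnjY: "(LINT t|lborel. cnj (y t) * iexp (\<sigma> * t)) = 0" for \<sigma>
  proof -
    have "(LINT t|lborel. cnj (y t) * iexp (\<sigma> * t)) = (LINT t|lborel. cnj (y t * iexp ((- \<sigma>) * t)))"
      by (intro Bochner_Integration.integral_cong refl) (simp add: exp_cnj)
    also have "\<dots> = cnj (Y (- \<sigma>))" unfolding Y_def by (simp del: complex_cnj_mult flip: integral_cnj)
    finally show ?thesis using Y0 by simp
  qed
  have yc: "integrable lborel (\<lambda>t. cnj (y t))" using y by simp
  have "(LINT t|lborel. of_real (Re (y t)) * iexp (\<sigma> * t)) = 0" for \<sigma>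
  proof -
    have "(LINT t|lborel. of_real (Re (y t)) * iexp (\<sigma> * t)) = (LINT t|lborel. (1/2) * (y t * iexp (\<sigma> * t) + cnj (y t) * iexp (\<sigma> * t)))"
      by (intro Bochner_Integration.integral_cong refl) (simp add: complex_add_cnj flip: distrib_right)
    also have "\<dots> = (1/2) * (Y \<sigma> + (LINT t|lborel. cnj (y t) * iexp (\<sigma> * t)))"
      unfolding Y_def integral_mult_right_zero
      by (subst Bochner_Integration.integral_add[OF integrable_mult_iexp[OF y] integrable_mult_iexp[OF yc]]) (rule refl)
    finally show ?thesis using Y0 cnjY by simp
  qed
  then have "AE t in lborel. Re (y t) = 0" using y by (intro fourier_unique_real) auto
  moreover have "(LINT t|lborel. of_real (Im (y t)) * iexp (\<sigma> * t)) = 0" for \<sigma>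
  proof -
    have "(LINT t|lborel. of_real (Im (y t)) * iexp (\<sigma> * t)) = (LINT t|lborel. (- \<i>/2) * (y t * iexp (\<sigma> * t) - cnj (y t) * iexp (\<sigma> * t)))"
    proof (intro Bochner_Integration.integral_cong refl)
      fix t
      have "of_real (Im (y t)) = (- \<i>/2) * (y t - cnj (y t))" by (simp add: complex_eq_iff)
      then show "of_real (Im (y t)) * iexp (\<sigma> * t) = (- \<i>/2) * (y t * iexp (\<sigma> * t) - cnj (y t) * iexp (\<sigma> * t))"
        by (simp only: left_diff_distrib mult.assoc)
    qed
    also have "\<dots> = (- \<i>/2) * (Y \<sigma> - (LINT t|lborel. cnj (y t) * iexp (\<sigma> * t)))"
      unfolding Y_def integral_mult_right_zero
      by (subst Bochner_Integration.integral_diff[OF integrable_mult_iexp[OF y] integrable_mult_iexp[OF yc]]) (rule refl)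
    finally show ?thesis using Y0 cnjY by simp
  qed
  then have "AE t in lborel. Im (y t) = 0" using y by (intro fourier_unique_real) auto
  ultimately show ?thesis by eventually_elim (simp add: complex_eq_iff)
qed

section \<open>From the space-time estimate to an elliptic estimate\<close>

text \<open>The weight may take the value \<infinity>, as 1/|W| does where W vanishes; a function
  that is 0 there contributes nothing.\<close>

definition wn2 :: "('a::euclidean_space \<Rightarrow> ennreal) \<Rightarrow> ('a \<Rightarrow> complex) \<Rightarrow> ennreal" where
  "wn2 w f = (\<integral>\<^sup>+x. ennreal ((norm (f x))\<^sup>2) * w x \<partial>lborel)"

lemma wn2_add:
  assumes [measurable]: "f \<in> borel_measurable borel" "g \<in> borel_measurable borel" "w \<in> borel_measurable borel"
    and \<kappa>: "\<kappa> > 0"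
  shows "wn2 w (\<lambda>x. f x + g x) \<le> ennreal (1 + \<kappa>) * wn2 w f + ennreal (1 + 1 / \<kappa>) * wn2 w g"
proof -
  have "wn2 w (\<lambda>x. f x + g x) \<le> (\<integral>\<^sup>+x. ennreal (1 + \<kappa>) * (ennreal ((norm (f x))\<^sup>2) * w x) +
      ennreal (1 + 1 / \<kappa>) * (ennreal ((norm (g x))\<^sup>2) * w x) \<partial>lborel)"
    unfolding wn2_def
  proof (rule nn_integral_mono)
    fix x
    have "ennreal ((norm (f x + g x))\<^sup>2) \<le> ennreal ((1 + \<kappa>) * (norm (f x))\<^sup>2 + (1 + 1 / \<kappa>) * (norm (g x))\<^sup>2)"
      by (intro ennreal_leI sq_sum_le_eps \<kappa>)
    also have "\<dots> = ennreal (1 + \<kappa>) * ennreal ((norm (f x))\<^sup>2) + ennreal (1 + 1 / \<kappa>) * ennreal ((norm (g x))\<^sup>2)"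
      using \<kappa> by (simp add: ennreal_mult)
    finally have "ennreal ((norm (f x + g x))\<^sup>2) * w x \<le> (ennreal (1 + \<kappa>) * ennreal ((norm (f x))\<^sup>2) + ennreal (1 + 1 / \<kappa>) * ennreal ((norm (g x))\<^sup>2)) * w x"
      by (rule mult_right_mono) simp
    then show "ennreal ((norm (f x + g x))\<^sup>2) * w x \<le> ennreal (1 + \<kappa>) * (ennreal ((norm (f x))\<^sup>2) * w x) +
      ennreal (1 + 1 / \<kappa>) * (ennreal ((norm (g x))\<^sup>2) * w x)"
      by (simp only: distrib_right mult.assoc)
  qed
  also have "\<dots> = ennreal (1 + \<kappa>) * wn2 w f + ennreal (1 + 1 / \<kappa>) * wn2 w g"
    unfolding wn2_def by (simp add: nn_integral_add nn_integral_cmult)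
  finally show ?thesis .
qed

lemma test_fun_tensor:
  fixes F :: "'a::euclidean_space \<Rightarrow> complex" and \<phi> :: "real \<Rightarrow> complex"
  assumes "test_fun F" "test_fun \<phi>"
  shows "test_fun (\<lambda>z. F (fst z) * \<phi> (snd z))"
proof -
  have "{z. F (fst z) * \<phi> (snd z) \<noteq> 0} \<subseteq> {x. F x \<noteq> 0} \<times> {t. \<phi> t \<noteq> 0}" by auto
  moreover have "bounded ({x. F x \<noteq> 0} \<times> {t. \<phi> t \<noteq> 0})"
    using assms by (intro bounded_Times) (auto simp: test_fun_iff)
  ultimately show ?thesis using assms
    by (auto simp: test_fun_iff intro!: smooth_mult smooth_fst smooth_snd intro: bounded_subset)
qed

lemma pd_tensor_time:
  fixes F :: "'a::euclidean_space \<Rightarrow> complex" and \<phi> :: "real \<Rightarrow> complex"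
  assumes "smooth F" "smooth \<phi>"
  shows "pd (0, 1) (\<lambda>z. F (fst z) * \<phi> (snd z)) = (\<lambda>z. F (fst z) * pd 1 \<phi> (snd z))"
  using assms
  by (subst pd_mult) (auto simp: pd_fst pd_snd smooth_diff frechet_zero pd_def intro!: smooth_diff smooth_fst smooth_snd)

lemma pd_tensor_space:
  fixes F :: "'a::euclidean_space \<Rightarrow> complex" and \<phi> :: "real \<Rightarrow> complex"
  assumes "smooth F" "smooth \<phi>"
  shows "pd (b, 0) (\<lambda>z. F (fst z) * \<phi> (snd z)) = (\<lambda>z. pd b F (fst z) * \<phi> (snd z))"
  using assms
  by (subst pd_mult) (auto simp: pd_fst pd_snd smooth_diff frechet_zero pd_def intro!: smooth_diff smooth_fst smooth_snd)

definition lap :: "('a::euclidean_space \<Rightarrow> complex) \<Rightarrow> 'a \<Rightarrow> complex" where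
  "lap F x = (\<Sum>b\<in>Basis. pd b (pd b F) x)"

lemma schroedinger_op_tensor:
  fixes F :: "'a::euclidean_space \<Rightarrow> complex" and \<phi> :: "real \<Rightarrow> complex"
  assumes "smooth F" "smooth \<phi>"
  shows "schroedinger_op (\<lambda>z. F (fst z) * \<phi> (snd z)) (x, t) = \<i> * F x * pd 1 \<phi> t + lap F x * \<phi> t"
proof -
  have "pd (b, 0) (pd (b, 0) (\<lambda>z. F (fst z) * \<phi> (snd z))) = (\<lambda>z. pd b (pd b F) (fst z) * \<phi> (snd z))" if "b \<in> Basis" for b
    using assms that by (simp add: pd_tensor_space smooth_pd)
  then show ?thesis using assms by (simp add: schroedinger_op_def pd_tensor_time lap_def sum_distrib_right)
qed

lemma smooth_exp: "smooth (\<lambda>t. complex_of_real (exp (l * t)))"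
proof (rule smooth_coinduct[where X="\<lambda>f. \<exists>c. f = (\<lambda>t. c * complex_of_real (exp (l * t)))"])
  show "\<exists>c. (\<lambda>t. complex_of_real (exp (l * t))) = (\<lambda>t. c * complex_of_real (exp (l * t)))"
    by (intro exI[of _ 1]) simp
  have d: "((\<lambda>t. c * complex_of_real (exp (l * t))) has_vector_derivative (c * of_real l) * of_real (exp (l * t))) (at t)" for c t
    by (rule derivative_eq_intros has_vector_derivative_mult_right has_vector_derivative_of_real refl |
        simp add: has_real_derivative_iff_has_vector_derivative[symmetric] mult_ac)+
  show "f differentiable_on UNIV" if "\<exists>c. f = (\<lambda>t. c * complex_of_real (exp (l * t)))" for f
    using that d unfolding differentiable_on_def differentiable_def has_vector_derivative_def by blast
  show "\<exists>c. pd b f = (\<lambda>t. c * complex_of_real (exp (l * t)))"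
    if "\<exists>c. f = (\<lambda>t. c * complex_of_real (exp (l * t)))" "b \<in> Basis" for f b
    using that pd_has_vector_derivative[OF d] by (metis Basis_real_def singletonD ext)
qed

lemma pd_exp: "pd 1 (\<lambda>t. complex_of_real (exp (l * t))) t = of_real l * of_real (exp (l * t))"
proof (rule pd_has_vector_derivative)
  show "((\<lambda>t. complex_of_real (exp (l * t))) has_vector_derivative of_real l * of_real (exp (l * t))) (at t)"
    unfolding of_real_mult[symmetric]
    by (intro has_vector_derivative_of_real)
       (auto intro!: derivative_eq_intros simp: has_real_derivative_iff_has_vector_derivative[symmetric])
qed

text \<open>Squaring removes the case distinction inside \<open>L2_weight_norm\<close>, and
  completion is dropped on the way. The value Q = 0 needs its own argument when I2 is infinite,
  since the right-hand side is then 0.\<close>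

lemma L2_weight_norm_le_sq:
  assumes "L2_weight_norm w1 F1 \<le> ennreal Q * L2_weight_norm w2 F2" "Q \<ge> 0"
    and i1: "I1 = (\<integral>\<^sup>+t. (\<integral>\<^sup>+x. ennreal ((norm (F1 (x, t)))\<^sup>2) * w1 x \<partial>lborel) \<partial>lborel)"
    and i2: "I2 = (\<integral>\<^sup>+t. (\<integral>\<^sup>+x. ennreal ((norm (F2 (x, t)))\<^sup>2) * w2 x \<partial>lborel) \<partial>lborel)"
  shows "I1 \<le> ennreal (Q\<^sup>2) * I2"
proof -
  have N: "L2_weight_norm w1 F1 = (if I1 = \<infinity> then \<infinity> else ennreal (sqrt (enn2real I1)))"
    "L2_weight_norm w2 F2 = (if I2 = \<infinity> then \<infinity> else ennreal (sqrt (enn2real I2)))"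
    unfolding L2_weight_norm_def i1 i2 nn_integral_completion Let_def by simp_all
  show ?thesis
  proof (cases "I2 = \<infinity>")
    case True
    show ?thesis
    proof (cases "Q = 0")
      case True
      then have "I1 = 0"
        using assms(1) unfolding N by (cases I1) (auto simp: ennreal_eq_0_iff split: if_splits)
      then show ?thesis by simp
    next
      case False
      then show ?thesis using True assms(2) by (simp add: ennreal_mult_top)
    qed
  next
    case False
    then obtain r2 where r2: "I2 = ennreal r2" "r2 \<ge> 0" by (cases I2) auto
    have "L2_weight_norm w1 F1 < \<infinity>"
      using assms(1) False unfolding N(2) by (auto simp: le_less_trans ennreal_mult_less_top)
    then obtain r1 where r1: "I1 = ennreal r1" "r1 \<ge> 0" unfolding N(1) by (cases I1) auto
    have "ennreal (sqrt r1) \<le> ennreal (Q * sqrt r2)"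
      using assms(1,2) r1 r2 unfolding N by (simp add: ennreal_mult)
    then have "sqrt r1 \<le> Q * sqrt r2" using assms(2) r2 by (simp add: ennreal_le_iff)
    from power_mono[OF this, of 2] have "r1 \<le> Q\<^sup>2 * r2" using r1 r2 by (simp add: power_mult_distrib)
    then show ?thesis using r1 r2 by (simp add: ennreal_mult[symmetric] ennreal_leI)
  qed
qed

lemma nn_integral_scale_real:
  assumes [measurable]: "f \<in> borel_measurable borel" and T: "T > (0::real)"
  shows "(\<integral>\<^sup>+t. f (t / T) \<partial>lborel) = ennreal T * (\<integral>\<^sup>+t. f t \<partial>lborel)"
  using nn_integral_real_affine[of "\<lambda>t. f (t / T)" T 0] T by simp

lemma nn_integral_tensor:
  assumes [measurable]: "f \<in> borel_measurable borel" "g \<in> borel_measurable borel"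
  shows "(\<integral>\<^sup>+(t::real). (\<integral>\<^sup>+(x::'a::euclidean_space). f x * g t \<partial>lborel) \<partial>lborel) = (\<integral>\<^sup>+x. f x \<partial>lborel) * (\<integral>\<^sup>+t. g t \<partial>lborel)"
  by (simp add: nn_integral_multc nn_integral_cmult)

lemma ennreal_le_vanishing:
  assumes "\<And>T. T > 0 \<Longrightarrow> x \<le> y + ennreal (c / T\<^sup>2)"
  shows "x \<le> y"
proof (rule ennreal_le_epsilon)
  fix e :: real assume e: "e > 0"
  \<comment> \<open>T \<ge> 1 gives c/T^2 \<le> |c|/T, and T \<ge> |c|/e makes this at most
    e.\<close>
  define T where "T = max 1 (\<bar>c\<bar> / e)"
  have T: "T > 0" "T \<ge> 1" by (auto simp: T_def)
  have "c / T\<^sup>2 \<le> \<bar>c\<bar> / T" using T by (intro frac_le) (auto simp: power2_eq_square)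
  also have "\<dots> \<le> e" using T e by (simp add: divide_le_eq) (metis T_def max.cobounded2 mult.commute pos_divide_le_eq)
  finally have "c / T\<^sup>2 \<le> e" .
  then show "x \<le> y + ennreal e" using assms[OF T(1)] by (meson add_left_mono ennreal_leI order_trans)
qed

text \<open>A time-independent function is inserted into the space-time estimate by multiplying it with
  \<open>exp (l t)\<close> and a cut-off \<open>\<theta> (t / T)\<close>; the exponential weight in time absorbs the former, and
  the error made by the latter disappears as \<open>T\<close> grows.\<close>

lemma elliptic_carleman:
  fixes W :: "'a::euclidean_space \<Rightarrow> complex"
  assumes car: "\<And>\<beta> \<nu> v. test_fun v \<Longrightarrow>
         L2_weight_norm (\<lambda>x. ennreal (norm (W x))) (\<lambda>z. exp (\<beta> * (z \<bullet> \<nu>)) *\<^sub>R v z)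
         \<le> ennreal Q * L2_weight_norm (\<lambda>x. inverse (ennreal (norm (W x))))
             (\<lambda>z. exp (\<beta> * (z \<bullet> \<nu>)) *\<^sub>R schroedinger_op v z)"
    and Q: "Q \<ge> 0" and [measurable]: "W \<in> borel_measurable borel"
    and F: "test_fun F" and fin: "wn2 (\<lambda>x. inverse (ennreal (norm (W x)))) F < \<infinity>" and \<kappa>: "\<kappa> > 0"
  shows "wn2 (\<lambda>x. ennreal (norm (W x))) F
    \<le> ennreal (Q\<^sup>2 * (1 + \<kappa>)) * wn2 (\<lambda>x. inverse (ennreal (norm (W x)))) (\<lambda>x. lap F x + \<i> * of_real l * F x)"
proof -
  define \<theta> where "\<theta> t = complex_of_real (bump 1 (-1) 1 t)" for t :: real
  have \<theta>: "test_fun \<theta>" unfolding \<theta>_def by (rule test_fun_bump)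
  have \<theta>': "test_fun (pd 1 \<theta>)" by (rule test_fun_pd[OF \<theta>]) simp
  have sF: "smooth F" using F by (rule test_fun_smooth)
  have [measurable]: "F \<in> borel_measurable borel" using F by (rule test_fun_measurable)
  have pdm: "pd b (pd b F) \<in> borel_measurable borel" if "b \<in> Basis" for b
    by (intro test_fun_measurable test_fun_pd F that)
  have [measurable]: "lap F \<in> borel_measurable borel"
    unfolding lap_def[abs_def] using pdm by (intro borel_measurable_sum)
  have [measurable]: "\<theta> \<in> borel_measurable borel" "pd 1 \<theta> \<in> borel_measurable borel"
    using \<theta> \<theta>' by (auto intro: test_fun_measurable)
  let ?w = "\<lambda>x. ennreal (norm (W x))" and ?i = "\<lambda>x. inverse (ennreal (norm (W x)))"
  define H where "H x = lap F x + \<i> * of_real l * F x" for x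
  have [measurable]: "H \<in> borel_measurable borel" unfolding H_def[abs_def] by measurable
  \<comment> \<open>The error of the time cut-off is a multiple of F measured with the weight 1/|W|;
    its finiteness lets this error tend to 0.\<close>
  obtain X3 where X3: "wn2 ?i F = ennreal X3" "X3 \<ge> 0" using fin by (cases "wn2 ?i F") auto
  obtain \<tau> where \<tau>: "n2 \<theta> = ennreal \<tau>" "\<tau> \<ge> 0" using test_fun_L2[OF \<theta>] by (cases "n2 \<theta>") (auto simp: L2_def)
  obtain \<tau>' where \<tau>': "n2 (pd 1 \<theta>) = ennreal \<tau>'" "\<tau>' \<ge> 0" using test_fun_L2[OF \<theta>'] by (cases "n2 (pd 1 \<theta>)") (auto simp: L2_def)
  have "\<tau> \<noteq> 0"
  proof
    assume "\<tau> = 0"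
    then have "(\<integral>\<^sup>+t. ennreal ((norm (\<theta> t))\<^sup>2) \<partial>lborel) = 0" using \<tau>(1) by (simp add: n2_def)
    then have "AE t in lborel. \<theta> t = 0" by (subst (asm) nn_integral_0_iff_AE) (auto simp: ennreal_eq_0_iff)
    then have "(LINT t|lborel. bump 1 (-1) 1 (t::real)) = 0" by (intro integral_eq_zero_AE) (auto simp: \<theta>_def)
    then show False using bump_integral_pos[of "-1" 1 1] by simp
  qed
  then have \<tau>0: "\<tau> > 0" using \<tau> by simp
  have "wn2 ?w F \<le> ennreal (Q\<^sup>2 * (1 + \<kappa>)) * wn2 ?i H + ennreal ((Q\<^sup>2 * (1 + 1/\<kappa>) * X3 * \<tau>' / \<tau>) / T\<^sup>2)" if T: "T > 0" for T
  proof -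
    \<comment> \<open>The factor exp(l t) produces the term i l F under the operator, and the
      Carleman weight with \<beta> = -l and \<nu> = (0, 1) then removes the factor from both
      norms.\<close>
    define \<phi> where "\<phi> t = complex_of_real (exp (l * t)) * \<theta> (t / T)" for t
    have \<theta>T: "test_fun (\<lambda>t. \<theta> (t / T))" using test_fun_scale[OF \<theta>, of "1/T" 0] T by simp
    have \<phi>: "test_fun \<phi>" using test_fun_mult[OF \<theta>T smooth_exp[of l]] by (simp add: \<phi>_def[abs_def] mult.commute)
    have s\<phi>: "smooth \<phi>" using \<phi> by (rule test_fun_smooth)
    have pd\<theta>T: "pd 1 (\<lambda>t. \<theta> (t / T)) t = of_real (1/T) * pd 1 \<theta> (t / T)" for t
      using pd_scale[OF smooth_diff[OF test_fun_smooth[OF \<theta>]], of 1 "1/T" 0] by (simp add: fun_eq_iff)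
    have pd\<phi>: "pd 1 \<phi> t = of_real (exp (l * t)) * (of_real l * \<theta> (t / T) + pd 1 \<theta> (t / T) / of_real T)" for t
      unfolding \<phi>_def[abs_def]
      using pd_mult[OF smooth_diff[OF smooth_exp[of l]] smooth_diff[OF test_fun_smooth[OF \<theta>T]], of 1]
      by (simp only: pd_exp pd\<theta>T) (simp add: algebra_simps)
    let ?v = "\<lambda>z. F (fst z) * \<phi> (snd z)"
    let ?e = "\<lambda>z::'a \<times> real. exp ((- l) * (z \<bullet> (0, 1)))"
    have e1: "?e (x, t) *\<^sub>R ?v (x, t) = F x * \<theta> (t / T)" for x t
      by (simp add: \<phi>_def scaleR_conv_of_real exp_minus field_simps)
    have e2: "?e (x, t) *\<^sub>R schroedinger_op ?v (x, t) = H x * \<theta> (t / T) + (\<i> / of_real T) * F x * pd 1 \<theta> (t / T)" for x t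
    proof -
      have "of_real (exp (- (l * t))) * (of_real (exp (l * t)) * c) = c" for c :: complex
        by (simp add: exp_minus field_simps)
      moreover have "schroedinger_op ?v (x, t) = of_real (exp (l * t)) * (H x * \<theta> (t / T) + (\<i> / of_real T) * F x * pd 1 \<theta> (t / T))"
        by (rule trans[OF schroedinger_op_tensor[OF sF s\<phi>]]) (simp add: pd\<phi> H_def \<phi>_def algebra_simps)
      ultimately show ?thesis by (simp add: scaleR_conv_of_real)
    qed
    define I1 where "I1 = (\<integral>\<^sup>+t. (\<integral>\<^sup>+x. ennreal ((norm (?e (x, t) *\<^sub>R ?v (x, t)))\<^sup>2) * ?w x \<partial>lborel) \<partial>lborel)"
    define I2 where "I2 = (\<integral>\<^sup>+t. (\<integral>\<^sup>+x. ennreal ((norm (?e (x, t) *\<^sub>R schroedinger_op ?v (x, t)))\<^sup>2) * ?i x \<partial>lborel) \<partial>lborel)"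
    have le: "I1 \<le> ennreal (Q\<^sup>2) * I2"
      by (rule L2_weight_norm_le_sq[OF car[OF test_fun_tensor[OF F \<phi>], of "- l" "(0, 1)"] Q I1_def I2_def])
    have n\<theta>: "(\<integral>\<^sup>+t. ennreal ((norm (\<theta> (t / T)))\<^sup>2) \<partial>lborel) = ennreal (T * \<tau>)"
      using nn_integral_scale_real[of "\<lambda>t. ennreal ((norm (\<theta> t))\<^sup>2)" T] T \<tau> by (simp add: n2_def ennreal_mult)
    have n\<theta>': "(\<integral>\<^sup>+t. ennreal ((norm (pd 1 \<theta> (t / T)))\<^sup>2) \<partial>lborel) = ennreal (T * \<tau>')"
      using nn_integral_scale_real[of "\<lambda>t. ennreal ((norm (pd 1 \<theta> t))\<^sup>2)" T] T \<tau>' by (simp add: n2_def ennreal_mult)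
    have I1: "I1 = wn2 ?w F * ennreal (T * \<tau>)"
    proof -
      have "I1 = (\<integral>\<^sup>+t. (\<integral>\<^sup>+x. (ennreal ((norm (F x))\<^sup>2) * ?w x) * ennreal ((norm (\<theta> (t / T)))\<^sup>2) \<partial>lborel) \<partial>lborel)"
        unfolding I1_def e1 by (simp add: norm_mult power_mult_distrib ennreal_mult mult_ac)
      also have "\<dots> = wn2 ?w F * ennreal (T * \<tau>)"
        unfolding wn2_def n\<theta>[symmetric] by (rule nn_integral_tensor) measurable
      finally show ?thesis .
    qed
    have I2: "I2 \<le> ennreal (1 + \<kappa>) * (wn2 ?i H * ennreal (T * \<tau>)) + ennreal (1 + 1/\<kappa>) * (ennreal (1 / T\<^sup>2) * (wn2 ?i F * ennreal (T * \<tau>')))"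
    proof -
      have "I2 \<le> (\<integral>\<^sup>+t. (ennreal (1 + \<kappa>) * wn2 ?i (\<lambda>x. H x * \<theta> (t / T)) + ennreal (1 + 1/\<kappa>) * wn2 ?i (\<lambda>x. (\<i> / of_real T) * F x * pd 1 \<theta> (t / T))) \<partial>lborel)"
        unfolding I2_def e2 by (intro nn_integral_mono wn2_add[unfolded wn2_def[of _ "\<lambda>x. _ x + _ x"]] \<kappa>) measurable
      also have "\<dots> = (\<integral>\<^sup>+t. ennreal (1 + \<kappa>) * (wn2 ?i H * ennreal ((norm (\<theta> (t / T)))\<^sup>2)) +
          ennreal (1 + 1/\<kappa>) * (ennreal (1 / T\<^sup>2) * (wn2 ?i F * ennreal ((norm (pd 1 \<theta> (t / T)))\<^sup>2))) \<partial>lborel)"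
      proof -
        have a: "wn2 ?i (\<lambda>x. H x * \<theta> (t / T)) = wn2 ?i H * ennreal ((norm (\<theta> (t / T)))\<^sup>2)" for t
          unfolding wn2_def
          by (subst nn_integral_multc[symmetric])
             (auto intro!: nn_integral_cong simp: norm_mult power_mult_distrib ennreal_mult mult_ac)
        have b: "wn2 ?i (\<lambda>x. (\<i> / of_real T) * F x * pd 1 \<theta> (t / T)) = ennreal (1 / T\<^sup>2) * (wn2 ?i F * ennreal ((norm (pd 1 \<theta> (t / T)))\<^sup>2))" for t
        proof -
          have "wn2 ?i (\<lambda>x. (\<i> / of_real T) * F x * pd 1 \<theta> (t / T)) = (\<integral>\<^sup>+x. ennreal (1 / T\<^sup>2) * ((ennreal ((norm (F x))\<^sup>2) * ?i x) * ennreal ((norm (pd 1 \<theta> (t / T)))\<^sup>2)) \<partial>lborel)"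
            unfolding wn2_def
          proof (rule nn_integral_cong)
            fix x
            have "(norm ((\<i> / of_real T) * F x * pd 1 \<theta> (t / T)))\<^sup>2 = (1 / T\<^sup>2) * ((norm (F x))\<^sup>2 * (norm (pd 1 \<theta> (t / T)))\<^sup>2)"
              by (simp add: norm_mult norm_divide power_mult_distrib power_divide)
            then have "ennreal ((norm ((\<i> / of_real T) * F x * pd 1 \<theta> (t / T)))\<^sup>2) = ennreal (1 / T\<^sup>2) * (ennreal ((norm (F x))\<^sup>2) * ennreal ((norm (pd 1 \<theta> (t / T)))\<^sup>2))"
              by (simp only: ennreal_mult mult_nonneg_nonneg zero_le_power2 zero_le_divide_1_iff)
            then show "ennreal ((norm ((\<i> / of_real T) * F x * pd 1 \<theta> (t / T)))\<^sup>2) * ?i x = ennreal (1 / T\<^sup>2) * ((ennreal ((norm (F x))\<^sup>2) * ?i x) * ennreal ((norm (pd 1 \<theta> (t / T)))\<^sup>2))"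
              by (simp only: mult_ac)
          qed
          also have "\<dots> = ennreal (1 / T\<^sup>2) * (wn2 ?i F * ennreal ((norm (pd 1 \<theta> (t / T)))\<^sup>2))"
            unfolding wn2_def by (simp add: nn_integral_cmult nn_integral_multc)
          finally show ?thesis .
        qed
        show ?thesis unfolding a b ..
      qed
      also have "\<dots> = ennreal (1 + \<kappa>) * (wn2 ?i H * ennreal (T * \<tau>)) + ennreal (1 + 1/\<kappa>) * (ennreal (1 / T\<^sup>2) * (wn2 ?i F * ennreal (T * \<tau>')))"
        unfolding n\<theta>[symmetric] n\<theta>'[symmetric] by (simp add: nn_integral_add nn_integral_cmult)
      finally show ?thesis .
    qed
    \<comment> \<open>Division by T \<tau>, the squared norm of the stretched cut-off: both main
      terms lose their dependence on T, while the error keeps the factor 1/T^2 of the squared time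
      derivative.\<close>
    have "wn2 ?w F = (wn2 ?w F * ennreal (T * \<tau>)) * ennreal (1 / (T * \<tau>))"
      using T \<tau>0 by (simp add: mult.assoc flip: ennreal_mult)
    also have "\<dots> \<le> (ennreal (Q\<^sup>2) * (ennreal (1 + \<kappa>) * (wn2 ?i H * ennreal (T * \<tau>)) + ennreal (1 + 1/\<kappa>) * (ennreal (1 / T\<^sup>2) * (wn2 ?i F * ennreal (T * \<tau>'))))) * ennreal (1 / (T * \<tau>))"
      using order_trans[OF le mult_left_mono[OF I2]] unfolding I1 by (intro mult_right_mono) auto
    also have "\<dots> = (ennreal (Q\<^sup>2) * ennreal (1 + \<kappa>)) * wn2 ?i H * (ennreal (T * \<tau>) * ennreal (1 / (T * \<tau>))) +
        ennreal (Q\<^sup>2) * ennreal (1 + 1/\<kappa>) * ennreal (1 / T\<^sup>2) * ennreal X3 * ennreal (T * \<tau>') * ennreal (1 / (T * \<tau>))"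
      unfolding X3(1) by (simp only: distrib_left distrib_right mult_ac)
    also have "ennreal (T * \<tau>) * ennreal (1 / (T * \<tau>)) = 1" using T \<tau>0 by (simp flip: ennreal_mult)
    also have "ennreal (Q\<^sup>2) * ennreal (1 + \<kappa>) = ennreal (Q\<^sup>2 * (1 + \<kappa>))" using \<kappa> by (intro ennreal_mult[symmetric]) auto
    also have "ennreal (Q\<^sup>2) * ennreal (1 + 1/\<kappa>) * ennreal (1 / T\<^sup>2) * ennreal X3 * ennreal (T * \<tau>') * ennreal (1 / (T * \<tau>)) = ennreal ((Q\<^sup>2 * (1 + 1/\<kappa>) * X3 * \<tau>' / \<tau>) / T\<^sup>2)"
    proof -
      have "ennreal (Q\<^sup>2) * ennreal (1 + 1/\<kappa>) * ennreal (1 / T\<^sup>2) * ennreal X3 * ennreal (T * \<tau>') * ennreal (1 / (T * \<tau>))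
        = ennreal (Q\<^sup>2 * (1 + 1/\<kappa>) * (1 / T\<^sup>2) * X3 * (T * \<tau>') * (1 / (T * \<tau>)))"
        using T \<tau>0 \<tau>' X3 \<kappa> by (simp only: ennreal_mult[symmetric] mult_nonneg_nonneg zero_le_power2 add_nonneg_nonneg zero_le_one less_imp_le zero_le_divide_1_iff)
      also have "Q\<^sup>2 * (1 + 1/\<kappa>) * (1 / T\<^sup>2) * X3 * (T * \<tau>') * (1 / (T * \<tau>)) = (Q\<^sup>2 * (1 + 1/\<kappa>) * X3 * \<tau>' / \<tau>) / T\<^sup>2"
        using T \<tau>0 by (simp add: mult_ac)
      finally show ?thesis .
    qed
    finally show ?thesis by simp
  qed
  then show ?thesis unfolding H_def by (rule ennreal_le_vanishing)
qed

section \<open>Uniqueness for the elliptic equation\<close>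

lemma pd_zero_if_even:
  fixes f :: "'a::euclidean_space \<Rightarrow> complex"
  assumes "f differentiable_on UNIV" "\<And>x. f (- x) = f x"
  shows "pd b f 0 = 0"
proof -
  have "pd b (\<lambda>x. f ((-1) *\<^sub>R x + 0)) = (\<lambda>x. of_real (-1) * pd b f ((-1) *\<^sub>R x + 0))" by (rule pd_scale) fact
  from fun_cong[OF this, of 0] have "pd b (\<lambda>x. f (- x)) 0 = - pd b f 0" by simp
  moreover have "(\<lambda>x. f (- x)) = f" using assms(2) by auto
  ultimately show ?thesis by simp
qed

text \<open>The bump of a box symmetric about 0 is even, so its gradient vanishes there. Hence n
  times the gradient of the dilate x -> \<xi>(x/n) tends to 0 at every point.\<close>

lemma cutoff_exists:
  obtains \<xi> :: "'a::euclidean_space \<Rightarrow> complex"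
  where "test_fun \<xi>" "\<xi> 0 = 1" "\<And>b. b \<in> Basis \<Longrightarrow> pd b \<xi> 0 = 0"
proof -
  define c where "c = bump 1 (- One) One (0 :: 'a)"
  have c: "c > 0" unfolding c_def by (rule bump_pos) (auto simp: mem_box)
  define \<xi> where "\<xi> x = complex_of_real (1 / c) * of_real (bump 1 (- One) One (x :: 'a))" for x
  have t: "test_fun \<xi>" unfolding \<xi>_def by (intro test_fun_cmult test_fun_bump)
  have e: "\<xi> (- x) = \<xi> x" for x
    by (simp add: \<xi>_def bump_def mult.commute add.commute)
  show thesis
  proof (rule that[OF t])
    show "\<xi> 0 = 1" using c by (simp add: \<xi>_def c_def)
    show "pd b \<xi> 0 = 0" for b by (rule pd_zero_if_even[OF smooth_diff[OF test_fun_smooth[OF t]] e])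
  qed
qed

text \<open>The product rule for a cut-off of a function with weak derivatives, in mollified form.
  For fixed x the mollifier y -> \<rho>(x - y) is itself a test function \<psi>, so the weak
  derivatives of f apply directly.\<close>

lemma conv_lap_cutoff:
  fixes f :: "'a::euclidean_space \<Rightarrow> complex"
  assumes f: "L2 f" "\<And>b. b \<in> Basis \<Longrightarrow> L2 (f1 b)" "\<And>b. b \<in> Basis \<Longrightarrow> L2 (f2 b)"
    and w1: "\<And>b \<phi>. b \<in> Basis \<Longrightarrow> test_fun \<phi> \<Longrightarrow> (LINT x|lborel. f x * pd b \<phi> x) = - (LINT x|lborel. f1 b x * \<phi> x)"
    and w2: "\<And>b \<phi>. b \<in> Basis \<Longrightarrow> test_fun \<phi> \<Longrightarrow> (LINT x|lborel. f x * pd b (pd b \<phi>) x) = (LINT x|lborel. f2 b x * \<phi> x)"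
    and \<xi>: "test_fun \<xi>" and \<rho>: "test_fun \<rho>"
  shows "lap (conv \<rho> (\<lambda>x. \<xi> x * f x)) x = conv \<rho> (\<lambda>x. \<xi> x * (\<Sum>b\<in>Basis. f2 b x)
           + (\<Sum>b\<in>Basis. 2 * pd b \<xi> x * f1 b x) + lap \<xi> x * f x) x"
proof -
  have L2t: "L2 (\<lambda>x. t x * h x)" if "test_fun t" "L2 h" for t h :: "'a \<Rightarrow> complex"
    using test_fun_bounded[OF that(1)] L2_bounded_mult[OF that(2) test_fun_measurable[OF that(1)]] by metis
  have it: "integrable lborel (\<lambda>x. t x * h x)" if "test_fun t" "L2 h" for t h :: "'a \<Rightarrow> complex"
    using L2_mult_integrable[OF test_fun_L2[OF that(1)] that(2)] .
  define \<psi> where "\<psi> y = \<rho> (x - y)" for y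
  have \<psi>: "test_fun \<psi>" using test_fun_scale[OF \<rho>, of "-1" x] by (simp add: \<psi>_def[abs_def])
  have s: "smooth \<xi>" "smooth \<psi>" using \<xi> \<psi> by (auto intro: test_fun_smooth)
  have pd\<psi>: "pd b (pd b \<psi>) y = pd b (pd b \<rho>) (x - y)" if "b \<in> Basis" for b y
  proof -
    have "pd b \<psi> = (\<lambda>y. - pd b \<rho> (x - y))"
      using pd_scale[OF smooth_diff[OF test_fun_smooth[OF \<rho>]], of b "-1" x] by (simp add: \<psi>_def[abs_def])
    then have "pd b (pd b \<psi>) = pd b (\<lambda>y. (-1) * pd b \<rho> ((-1) *\<^sub>R y + x))" by simp
    also have "\<dots> = (\<lambda>y. (-1) * (of_real (-1) * pd b (pd b \<rho>) ((-1) *\<^sub>R y + x)))"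
      using smooth_diff[OF smooth_pd[OF test_fun_smooth[OF \<rho>] that]]
      by (subst pd_cmult, intro differentiable_compose_linear bounded_linear_scaleR_right, assumption, subst pd_scale, assumption) simp
    finally show ?thesis by simp
  qed
  have hi: "integrable lborel (\<lambda>x. \<xi> x * f x)" by (intro it \<xi> f)
  have part: "conv (pd b (pd b \<rho>)) (\<lambda>x. \<xi> x * f x) x = (LINT y|lborel. \<psi> y * (\<xi> y * f2 b y)) + (LINT y|lborel. \<psi> y * (2 * pd b \<xi> y * f1 b y)) + (LINT y|lborel. \<psi> y * (pd b (pd b \<xi>) y * f y))"
    if b: "b \<in> Basis" for b
  proof -
    have t: "test_fun (\<lambda>y. \<xi> y * \<psi> y)" "test_fun (\<lambda>y. pd b \<xi> y * \<psi> y)" "test_fun (\<lambda>y. pd b (pd b \<xi>) y * \<psi> y)"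
      using \<xi> b s by (auto intro!: test_fun_mult test_fun_pd)
    have d: "\<xi> differentiable_on UNIV" "\<psi> differentiable_on UNIV" "pd b \<xi> differentiable_on UNIV" "pd b \<psi> differentiable_on UNIV"
      using s b by (auto intro: smooth_diff smooth_pd)
    have p1: "pd b (\<lambda>y. \<xi> y * \<psi> y) = (\<lambda>y. pd b \<xi> y * \<psi> y + \<xi> y * pd b \<psi> y)" by (rule pd_mult) fact+
    have d': "(\<lambda>y. pd b \<xi> y * \<psi> y) differentiable_on UNIV" "(\<lambda>y. \<xi> y * pd b \<psi> y) differentiable_on UNIV"
      using s b by (auto intro!: smooth_diff smooth_mult smooth_pd)
    have p2: "pd b (pd b (\<lambda>y. \<xi> y * \<psi> y)) = (\<lambda>y. (pd b (pd b \<xi>) y * \<psi> y + pd b \<xi> y * pd b \<psi> y) + (pd b \<xi> y * pd b \<psi> y + \<xi> y * pd b (pd b \<psi>) y))"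
      unfolding p1 by (subst pd_add[OF d']) (simp only: pd_mult[OF d(3) d(2)] pd_mult[OF d(1) d(4)])
    have p3: "pd b (\<lambda>y. pd b \<xi> y * \<psi> y) = (\<lambda>y. pd b (pd b \<xi>) y * \<psi> y + pd b \<xi> y * pd b \<psi> y)" by (rule pd_mult) fact+
    have i1: "integrable lborel (\<lambda>y. f y * pd b (pd b (\<lambda>y. \<xi> y * \<psi> y)) y)" "integrable lborel (\<lambda>y. f y * pd b (\<lambda>y. pd b \<xi> y * \<psi> y) y)"
      "integrable lborel (\<lambda>y. f y * (pd b (pd b \<xi>) y * \<psi> y))"
      using b t by (auto intro!: L2_mult_integrable f test_fun_L2 test_fun_pd)
    \<comment> \<open>The identity \<xi> \<psi>'' = (\<xi> \<psi>)'' - 2 (\<xi>' \<psi>)' + \<xi>''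
      \<psi> lets f meet either a full derivative of a test function or no derivative at
      all.\<close>
    have "conv (pd b (pd b \<rho>)) (\<lambda>x. \<xi> x * f x) x = (LINT y|lborel. f y * pd b (pd b (\<lambda>y. \<xi> y * \<psi> y)) y - 2 * (f y * pd b (\<lambda>y. pd b \<xi> y * \<psi> y) y) + f y * (pd b (pd b \<xi>) y * \<psi> y))"
      unfolding conv_def p2 p3 pd\<psi>[OF b, symmetric] by (intro Bochner_Integration.integral_cong refl) (simp add: algebra_simps)
    also have "\<dots> = (LINT y|lborel. f y * pd b (pd b (\<lambda>y. \<xi> y * \<psi> y)) y) - 2 * (LINT y|lborel. f y * pd b (\<lambda>y. pd b \<xi> y * \<psi> y) y) + (LINT y|lborel. f y * (pd b (pd b \<xi>) y * \<psi> y))"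
      using i1 by simp
    also have "\<dots> = (LINT y|lborel. f2 b y * (\<xi> y * \<psi> y)) + 2 * (LINT y|lborel. f1 b y * (pd b \<xi> y * \<psi> y)) + (LINT y|lborel. f y * (pd b (pd b \<xi>) y * \<psi> y))"
      using w1[OF b t(2)] w2[OF b t(1)] by simp
    finally show ?thesis by (simp add: mult_ac integral_mult_right_zero[symmetric] del: integral_mult_right_zero integral_mult_left_zero)
  qed
  have I1: "integrable lborel (\<lambda>y. \<psi> y * (\<xi> y * f2 b y))" if "b \<in> Basis" for b by (intro it \<psi> L2t \<xi> f that)
  have I2: "integrable lborel (\<lambda>y. \<psi> y * (2 * pd b \<xi> y * f1 b y))" if "b \<in> Basis" for b
    using it[OF \<psi> L2_cmult[OF L2t[OF test_fun_pd[OF \<xi> that] f(2)[OF that]], of 2]] by (simp add: mult.assoc)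
  have I3: "integrable lborel (\<lambda>y. \<psi> y * (pd b (pd b \<xi>) y * f y))" if "b \<in> Basis" for b by (intro it \<psi> L2t test_fun_pd \<xi> f that)
  have "lap (conv \<rho> (\<lambda>x. \<xi> x * f x)) x = (\<Sum>b\<in>Basis. conv (pd b (pd b \<rho>)) (\<lambda>x. \<xi> x * f x) x)"
    unfolding lap_def using pd_conv[OF \<rho> hi] pd_conv[OF test_fun_pd[OF \<rho>] hi] by (intro sum.cong) auto
  also have "\<dots> = (\<Sum>b\<in>Basis. (LINT y|lborel. \<psi> y * (\<xi> y * f2 b y)) + (LINT y|lborel. \<psi> y * (2 * pd b \<xi> y * f1 b y)) + (LINT y|lborel. \<psi> y * (pd b (pd b \<xi>) y * f y)))"
    by (intro sum.cong refl part)
  also have "\<dots> = (LINT y|lborel. (\<Sum>b\<in>Basis. \<psi> y * (\<xi> y * f2 b y) + \<psi> y * (2 * pd b \<xi> y * f1 b y) + \<psi> y * (pd b (pd b \<xi>) y * f y)))"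
    using I1 I2 I3 by (subst Bochner_Integration.integral_sum) (auto intro!: sum.cong)
  also have "\<dots> = conv \<rho> (\<lambda>x. \<xi> x * (\<Sum>b\<in>Basis. f2 b x) + (\<Sum>b\<in>Basis. 2 * pd b \<xi> x * f1 b x) + lap \<xi> x * f x) x"
    unfolding conv_def \<psi>_def[symmetric] lap_def
    by (intro Bochner_Integration.integral_cong refl) (simp add: sum.distrib sum_distrib_left sum_distrib_right distrib_left mult_ac)
  finally show ?thesis .
qed

lemma conv_add:
  assumes "test_fun \<psi>" "integrable lborel g" "integrable lborel h"
  shows "conv \<psi> (\<lambda>y. g y + c * h y) x = conv \<psi> g x + c * conv \<psi> h x"
proof -
  have "conv \<psi> (\<lambda>y. g y + c * h y) x = (LINT y|lborel. \<psi> (x - y) * g y + c * (\<psi> (x - y) * h y))"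
    unfolding conv_def by (intro Bochner_Integration.integral_cong refl) (simp add: algebra_simps)
  then show ?thesis using conv_integrable[OF assms(1,2)] conv_integrable[OF assms(1,3)] by (simp add: conv_def)
qed

lemma conv_eq_0:
  assumes "\<And>y. \<psi> y \<noteq> 0 \<Longrightarrow> norm y < 1" "\<And>y. h y \<noteq> 0 \<Longrightarrow> norm y \<le> S" "norm x > S + 1"
  shows "conv \<psi> h x = 0"
proof -
  have "\<psi> (x - y) * h y = 0" for y
  proof (rule ccontr)
    assume "\<psi> (x - y) * h y \<noteq> 0"
    then have "norm (x - y) < 1" "norm y \<le> S" using assms by auto
    then show False using assms(3) norm_triangle_sub[of x y] by linarith
  qed
  then have "(\<lambda>y. \<psi> (x - y) * h y) = (\<lambda>_. 0)" by auto
  then show ?thesis by (simp add: conv_def)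
qed

text \<open>Where the weight is bounded below, mollification extends the estimate from test functions to
  compactly supported \<open>f\<close> with \<open>(\<Delta> + i l) f\<close> in \<open>L\<^sup>2\<close>; only strong convergence on the right-hand
  side and Fatou's lemma on the left-hand side are needed.\<close>

lemma carleman_mollified:
  fixes W :: "'a::euclidean_space \<Rightarrow> complex"
  assumes E: "\<And>F. test_fun F \<Longrightarrow> wn2 (\<lambda>x. inverse (ennreal (norm (W x)))) F < \<infinity> \<Longrightarrow>
      wn2 (\<lambda>x. ennreal (norm (W x))) F \<le> ennreal A * wn2 (\<lambda>x. inverse (ennreal (norm (W x)))) (\<lambda>x. lap F x + \<i> * of_real l * F x)"
    and [measurable]: "W \<in> borel_measurable borel"
    and W: "AE x in lborel. norm x \<le> S + 1 \<longrightarrow> inverse (ennreal (norm (W x))) \<le> ennreal K"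
    and \<rho>: "\<And>k. test_fun (\<rho> k)" "\<And>k x. \<rho> k x \<noteq> 0 \<Longrightarrow> norm x < 1"
      "\<And>h. L2 h \<Longrightarrow> bounded {x. h x \<noteq> 0} \<Longrightarrow> (\<lambda>k. n2 (\<lambda>x. conv (\<rho> k) h x - h x)) \<longlonglongrightarrow> 0"
    and f: "L2 f" "\<And>x. f x \<noteq> 0 \<Longrightarrow> norm x \<le> S" and H: "L2 H" "\<And>x. H x \<noteq> 0 \<Longrightarrow> norm x \<le> S"
    and lapf: "\<And>k x. lap (conv (\<rho> k) f) x + \<i> * of_real l * conv (\<rho> k) f x = conv (\<rho> k) H x"
    and \<kappa>: "\<kappa> > 0"
  shows "wn2 (\<lambda>x. ennreal (norm (W x))) f \<le> ennreal A * (ennreal (1 + \<kappa>) * wn2 (\<lambda>x. inverse (ennreal (norm (W x)))) H)"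
proof -
  let ?w = "\<lambda>x. ennreal (norm (W x))" and ?i = "\<lambda>x. inverse (ennreal (norm (W x)))"
  have bf: "bounded {x. f x \<noteq> 0}" "bounded {x. H x \<noteq> 0}"
    using f(2) H(2) by (auto intro!: bounded_subset[OF bounded_cball, of _ 0 S])
  have fi: "integrable lborel f" "integrable lborel H" using L2_bounded_integrable f(1) H(1) bf by blast+
  have [measurable]: "f \<in> borel_measurable borel" "H \<in> borel_measurable borel" using f H by (auto simp: L2_def)
  have tF: "test_fun (conv (\<rho> k) f)" "test_fun (conv (\<rho> k) H)" for k by (intro test_fun_conv \<rho> fi bf)+
  have [measurable]: "conv (\<rho> k) f \<in> borel_measurable borel" "conv (\<rho> k) H \<in> borel_measurable borel" for k
    using tF by (auto intro: test_fun_measurable)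
  have iK: "wn2 ?i h \<le> ennreal K * n2 h" if "h \<in> borel_measurable borel" "\<And>x. norm x > S + 1 \<Longrightarrow> h x = 0" for h
  proof -
    have "wn2 ?i h \<le> (\<integral>\<^sup>+x. ennreal K * ennreal ((norm (h x))\<^sup>2) \<partial>lborel)"
      unfolding wn2_def
    proof (rule nn_integral_mono_AE)
      show "AE x in lborel. ennreal ((norm (h x))\<^sup>2) * ?i x \<le> ennreal K * ennreal ((norm (h x))\<^sup>2)"
        using W
      proof eventually_elim
        case (elim x)
        show ?case
        proof (cases "norm x \<le> S + 1")
          case True then show ?thesis using elim by (simp add: mult.commute[of "ennreal ((norm (h x))\<^sup>2)"] mult_right_mono)
        next
          case False then show ?thesis using that(2)[of x] by simp
        qed
      qed
    qed
    also have "\<dots> = ennreal K * n2 h" unfolding n2_def using that(1) by (simp add: nn_integral_cmult)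
    finally show ?thesis .
  qed
  \<comment> \<open>Mollification enlarges supports by less than 1, which is why the weight is
    controlled on the ball of radius S + 1.\<close>
  have c0: "conv (\<rho> k) f x = 0" "conv (\<rho> k) H x = 0" "f x = 0" "H x = 0" if "norm x > S + 1" for k x
    using conv_eq_0[OF \<rho>(2) f(2) that] conv_eq_0[OF \<rho>(2) H(2) that] f(2)[of x] H(2)[of x] that by force+
  define e where "e k = ennreal (1 + 1/\<kappa>) * (ennreal K * n2 (\<lambda>x. conv (\<rho> k) H x - H x))" for k
  have e: "e \<longlonglongrightarrow> 0"
    unfolding e_def using \<rho>(3)[OF H(1) bf(2)] by (intro ennreal_tendsto_cmult[THEN tendsto_eq_rhs]) auto
  have step: "wn2 ?w (conv (\<rho> k) f) \<le> ennreal A * (ennreal (1 + \<kappa>) * wn2 ?i H + e k)" for k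
  proof -
    have "n2 (conv (\<rho> k) f) < \<infinity>" using test_fun_L2[OF tF(1)[of k]] by (simp add: L2_def)
    then have "wn2 ?i (conv (\<rho> k) f) < \<infinity>"
      using iK[of "conv (\<rho> k) f"] c0 by (auto intro: le_less_trans simp: ennreal_mult_less_top)
    from E[OF tF(1) this] have "wn2 ?w (conv (\<rho> k) f) \<le> ennreal A * wn2 ?i (\<lambda>x. H x + (conv (\<rho> k) H x - H x))"
      unfolding lapf by simp
    also have "\<dots> \<le> ennreal A * (ennreal (1 + \<kappa>) * wn2 ?i H + ennreal (1 + 1/\<kappa>) * wn2 ?i (\<lambda>x. conv (\<rho> k) H x - H x))"
      by (intro mult_left_mono wn2_add \<kappa>) auto
    also have "\<dots> \<le> ennreal A * (ennreal (1 + \<kappa>) * wn2 ?i H + e k)"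
      unfolding e_def using c0 by (intro mult_left_mono add_left_mono iK) auto
    finally show ?thesis .
  qed
  \<comment> \<open>Convergence in L^2 gives a.e. convergence along a subsequence, which is enough
    for Fatou; there is no upper bound on |W| that would allow convergence of the left-hand
    norms.\<close>
  obtain r where r: "strict_mono r" "AE x in lborel. (\<lambda>k. conv (\<rho> (r k)) f x) \<longlonglongrightarrow> f x"
  proof -
    define u where "u k x = (norm (conv (\<rho> k) f x - f x))\<^sup>2" for k x
    have ui: "integrable lborel (u k)" for k
      using L2_diff[OF test_fun_L2[OF tF(1)[of k]] f(1)] by (simp add: L2_iff_integrable u_def[abs_def])
    have "ennreal (LINT x|lborel. norm (u k x)) = n2 (\<lambda>x. conv (\<rho> k) f x - f x)" for k
      using nn_integral_eq_integral[OF ui[of k]] by (simp add: n2_def u_def[abs_def])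
    then have "(\<lambda>k. ennreal (LINT x|lborel. norm (u k x))) \<longlonglongrightarrow> ennreal 0"
      using \<rho>(3)[OF f(1) bf(1)] by simp
    then have "(\<lambda>k. LINT x|lborel. norm (u k x)) \<longlonglongrightarrow> 0"
      by (subst (asm) tendsto_ennreal_iff) auto
    from tendsto_L1_AE_subseq[of lborel u, OF ui this]
    obtain r :: "nat \<Rightarrow> nat" where r: "strict_mono r" "AE x in lborel. (\<lambda>k. u (r k) x) \<longlonglongrightarrow> 0" by blast
    have "AE x in lborel. (\<lambda>k. conv (\<rho> (r k)) f x) \<longlonglongrightarrow> f x"
      using r(2)
    proof eventually_elim
      case (elim x)
      have "(\<lambda>k. sqrt (u (r k) x)) \<longlonglongrightarrow> sqrt 0" by (intro tendsto_intros elim)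
      then have "(\<lambda>k. norm (conv (\<rho> (r k)) f x - f x)) \<longlonglongrightarrow> 0" by (simp add: u_def)
      then show ?case by (rule LIM_zero_cancel[OF tendsto_norm_zero_cancel])
    qed
    then show thesis using that r(1) by blast
  qed
  have "wn2 ?w f = (\<integral>\<^sup>+x. liminf (\<lambda>k. ennreal ((norm (conv (\<rho> (r k)) f x))\<^sup>2) * ?w x) \<partial>lborel)"
    unfolding wn2_def
  proof (rule nn_integral_cong_AE)
    show "AE x in lborel. ennreal ((norm (f x))\<^sup>2) * ?w x = liminf (\<lambda>k. ennreal ((norm (conv (\<rho> (r k)) f x))\<^sup>2) * ?w x)"
      using r(2)
    proof eventually_elim
      case (elim x)
      have "(\<lambda>k. ennreal ((norm (conv (\<rho> (r k)) f x))\<^sup>2 * norm (W x))) \<longlonglongrightarrow> ennreal ((norm (f x))\<^sup>2 * norm (W x))"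
        by (intro tendsto_ennrealI tendsto_intros elim)
      then have "(\<lambda>k. ennreal ((norm (conv (\<rho> (r k)) f x))\<^sup>2) * ?w x) \<longlonglongrightarrow> ennreal ((norm (f x))\<^sup>2) * ?w x"
        by (simp add: ennreal_mult)
      then show ?case by (simp add: lim_imp_Liminf)
    qed
  qed
  also have "\<dots> \<le> liminf (\<lambda>k. wn2 ?w (conv (\<rho> (r k)) f))"
    unfolding wn2_def by (rule nn_integral_liminf) measurable
  also have "\<dots> \<le> liminf (\<lambda>k. ennreal A * (ennreal (1 + \<kappa>) * wn2 ?i H + e (r k)))"
    by (intro Liminf_mono always_eventually allI step)
  also have "\<dots> = ennreal A * (ennreal (1 + \<kappa>) * wn2 ?i H + 0)"
  proof (rule lim_imp_Liminf)
    have "(\<lambda>k. e (r k)) \<longlonglongrightarrow> 0" using LIMSEQ_subseq_LIMSEQ[OF e r(1)] by (simp add: comp_def)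
    then show "(\<lambda>k. ennreal A * (ennreal (1 + \<kappa>) * wn2 ?i H + e (r k))) \<longlonglongrightarrow> ennreal A * (ennreal (1 + \<kappa>) * wn2 ?i H + 0)"
      by (intro ennreal_tendsto_cmult tendsto_add tendsto_const) auto
  qed simp
  finally show ?thesis by simp
qed

text \<open>The term a x is subtracted, which is legitimate only for finite x: for a > 0 and x =
  \<infinity> the inequality says nothing.\<close>

lemma ennreal_absorb:
  assumes "x \<le> ennreal a * x + y" "x < \<infinity>" "0 \<le> a" "a < 1"
  shows "x \<le> ennreal (1 / (1 - a)) * y"
proof (cases y)
  case (real r)
  obtain z where z: "x = ennreal z" "z \<ge> 0" using assms(2) by (cases x) auto
  have "ennreal z \<le> ennreal (a * z + r)" using assms(1,3) real z by (simp add: ennreal_mult)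
  moreover have "0 \<le> a * z + r" using real z assms(3) by simp
  ultimately have "z \<le> a * z + r" by (simp only: ennreal_le_iff)
  then have "z \<le> 1 / (1 - a) * r" using assms(4) by (simp add: field_simps)
  then show ?thesis using real z assms(4) by (simp add: ennreal_mult'[symmetric] ennreal_leI)
next
  case top
  then show ?thesis using assms(4) by (simp add: ennreal_mult_top)
qed

text \<open>The estimate is applied to \<open>X n\<close> times f, whose image is \<open>X n\<close>
  times g plus a commutator carrying a factor 1/\<open>rr n\<close>. As |g| \<le> |W||f|, the first
  part measured with 1/|W| is at most the left-hand side and is absorbed. On the support 1/|W| grows
  at most like the square of \<open>rr n\<close>, so the commutator contributes a fixed multiple of
  the squared norm of \<open>E1 n\<close>, which tends to 0. Fatou gives f weighted norm 0, and W is
  nonzero almost everywhere.\<close>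

lemma elliptic_uniqueness:
  fixes W :: "'a::euclidean_space \<Rightarrow> complex"
  assumes E: "\<And>F. test_fun F \<Longrightarrow> wn2 (\<lambda>x. inverse (ennreal (norm (W x)))) F < \<infinity> \<Longrightarrow>
      wn2 (\<lambda>x. ennreal (norm (W x))) F \<le> ennreal A * wn2 (\<lambda>x. inverse (ennreal (norm (W x)))) (\<lambda>x. lap F x + \<i> * of_real l * F x)"
    and A: "0 \<le> A" "A < 1"
    and Wm[measurable]: "W \<in> borel_measurable borel"
    and W: "\<eta> > 0" "\<And>R. R \<ge> R0 \<Longrightarrow> AE x in lborel. norm x \<le> 2 * R \<longrightarrow> \<eta> / R\<^sup>2 \<le> norm (W x)"
    and f: "L2 f" "\<And>b. b \<in> Basis \<Longrightarrow> L2 (f1 b)" "\<And>b. b \<in> Basis \<Longrightarrow> L2 (f2 b)"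
    and w1: "\<And>b \<phi>. b \<in> Basis \<Longrightarrow> test_fun \<phi> \<Longrightarrow> (LINT x|lborel. f x * pd b \<phi> x) = - (LINT x|lborel. f1 b x * \<phi> x)"
    and w2: "\<And>b \<phi>. b \<in> Basis \<Longrightarrow> test_fun \<phi> \<Longrightarrow> (LINT x|lborel. f x * pd b (pd b \<phi>) x) = (LINT x|lborel. f2 b x * \<phi> x)"
    and eq: "AE x in lborel. norm ((\<Sum>b\<in>Basis. f2 b x) + \<i> * of_real l * f x) \<le> norm (W x) * norm (f x)"
    and fin: "wn2 (\<lambda>x. ennreal (norm (W x))) f < \<infinity>"
  shows "AE x in lborel. f x = 0"
proof -
  let ?w = "\<lambda>x. ennreal (norm (W x))" and ?i = "\<lambda>x. inverse (ennreal (norm (W x)))"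
  define g where "g x = (\<Sum>b\<in>Basis. f2 b x) + \<i> * of_real l * f x" for x
  have g: "L2 g" unfolding g_def using f by (intro L2_add L2_sum L2_cmult) auto
  have [measurable]: "f \<in> borel_measurable borel" "g \<in> borel_measurable borel" using f g by (auto simp: L2_def)
  have L2t: "L2 (\<lambda>x. t x * h x)" if "test_fun t" "L2 h" for t h :: "'a \<Rightarrow> complex"
    using test_fun_bounded[OF that(1)] L2_bounded_mult[OF that(2) test_fun_measurable[OF that(1)]] by metis
  obtain \<xi> :: "'a \<Rightarrow> complex" where \<xi>: "test_fun \<xi>" "\<xi> 0 = 1" "\<And>b. b \<in> Basis \<Longrightarrow> pd b \<xi> 0 = 0"
    using cutoff_exists by blast
  obtain \<rho> :: "nat \<Rightarrow> 'a \<Rightarrow> complex" where \<rho>: "\<And>k. test_fun (\<rho> k)" "\<And>k x. \<rho> k x \<noteq> 0 \<Longrightarrow> norm x < 1"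
    "\<And>h. L2 h \<Longrightarrow> bounded {x. h x \<noteq> 0} \<Longrightarrow> (\<lambda>k. n2 (\<lambda>x. conv (\<rho> k) h x - h x)) \<longlonglongrightarrow> 0"
    using mollification by blast
  obtain B where B: "B > 0" "\<And>x. norm (\<xi> x) \<le> B" using test_fun_bounded[OF \<xi>(1)] by blast
  obtain S where S: "S \<ge> 1" "\<And>x. norm x > S \<Longrightarrow> \<xi> x = 0" "\<And>x b. b \<in> Basis \<Longrightarrow> norm x > S \<Longrightarrow> pd b \<xi> x = 0"
    "\<And>x. norm x > S \<Longrightarrow> lap \<xi> x = 0"
  proof -
    have tf: "test_fun (pd b \<xi>)" "test_fun (pd b (pd b \<xi>))" if "b \<in> Basis" for b
      using that by (auto intro!: test_fun_pd \<xi>)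
    have "bounded ({x. \<xi> x \<noteq> 0} \<union> (\<Union>b\<in>Basis. {x. pd b \<xi> x \<noteq> 0}) \<union> (\<Union>b\<in>Basis. {x. pd b (pd b \<xi>) x \<noteq> 0}))"
      using \<xi>(1) tf by (auto simp: test_fun_iff)
    then obtain S0 where S0: "\<And>x. x \<in> ({x. \<xi> x \<noteq> 0} \<union> (\<Union>b\<in>Basis. {x. pd b \<xi> x \<noteq> 0}) \<union> (\<Union>b\<in>Basis. {x. pd b (pd b \<xi>) x \<noteq> 0})) \<Longrightarrow> norm x \<le> S0"
      unfolding bounded_iff by blast
    show thesis
    proof (rule that[of "max 1 S0"])
      show "\<xi> x = 0" if "norm x > max 1 S0" for x using S0[of x] that by fastforce
      show "pd b \<xi> x = 0" if "b \<in> Basis" "norm x > max 1 S0" for x b using S0[of x] that by fastforce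
      have "pd b (pd b \<xi>) x = 0" if "b \<in> Basis" "norm x > max 1 S0" for x b using S0[of x] that by fastforce
      then show "lap \<xi> x = 0" if "norm x > max 1 S0" for x unfolding lap_def using that by (intro sum.neutral) auto
    qed simp
  qed
  \<comment> \<open>Two factors 1 + \<kappa> are lost, one to mollification and one to separating
    the commutator. As (1 + \<kappa>)^2 \<le> 1 + 3 \<kappa> for \<kappa> \<le> 1, this choice
    spends at most half of 1 - A; the case A = 0 avoids a division by 0.\<close>
  define \<kappa> where "\<kappa> = (if A = 0 then 1 else min 1 ((1 - A) / (6 * A)))"
  have \<kappa>: "\<kappa> > 0" using A by (simp add: \<kappa>_def)
  define a where "a = A * (1 + \<kappa>) * (1 + \<kappa>)"
  have a: "0 \<le> a" "a < 1"
  proof -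
    show "0 \<le> a" using A \<kappa> by (simp add: a_def)
    show "a < 1"
    proof (cases "A = 0")
      case False
      then have "A > 0" using A by simp
      have "\<kappa> \<le> 1" "\<kappa> \<le> (1 - A) / (6 * A)" using False by (auto simp: \<kappa>_def)
      then have "(1 + \<kappa>) * (1 + \<kappa>) \<le> 1 + 3 * \<kappa>" using \<kappa> by (simp add: algebra_simps mult_left_le)
      then have "a \<le> A * (1 + 3 * \<kappa>)" unfolding a_def mult.assoc using A by (intro mult_left_mono) auto
      also have "A * \<kappa> \<le> (1 - A) / 6" using \<open>\<kappa> \<le> (1 - A) / (6 * A)\<close> \<open>A > 0\<close> by (simp add: field_simps)
      then have "A * (1 + 3 * \<kappa>) < 1" using A by (simp add: algebra_simps)
      finally show ?thesis .
    qed (simp add: a_def)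
  qed
  \<comment> \<open>The dilation radii are shifted by one so that division by them is always
    allowed.\<close>
  define rr where "rr n = real n + 1" for n :: nat
  have rr: "rr n \<ge> 1" for n by (simp add: rr_def)
  define X where "X n x = \<xi> ((1 / rr n) *\<^sub>R x)" for n x
  \<comment> \<open>The commutator with one factor 1/\<open>rr n\<close> taken out: the gradient
    term has exactly one such factor, while the Laplacian of the cut-off has two and keeps
    one.\<close>
  define E1 where "E1 n x = (\<Sum>b\<in>Basis. 2 * pd b \<xi> ((1 / rr n) *\<^sub>R x) * f1 b x) + of_real (1 / rr n) * (lap \<xi> ((1 / rr n) *\<^sub>R x) * f x)" for n x
  have tX: "test_fun (X n)" for n
    unfolding X_def using test_fun_scale[OF \<xi>(1), of "1 / rr n" 0] rr[of n] by simp
  have pX: "pd b (X n) x = of_real (1 / rr n) * pd b \<xi> ((1 / rr n) *\<^sub>R x)" for b n x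
    using pd_scale[OF smooth_diff[OF test_fun_smooth[OF \<xi>(1)]], of b "1 / rr n" 0] by (simp add: X_def[abs_def] fun_eq_iff)
  have ppX: "pd b (pd b (X n)) x = of_real (1 / rr n) * (of_real (1 / rr n) * pd b (pd b \<xi>) ((1 / rr n) *\<^sub>R x))" if b: "b \<in> Basis" for b n x
  proof -
    have t: "test_fun (pd b \<xi>)" "test_fun (\<lambda>x. pd b \<xi> ((1 / rr n) *\<^sub>R x))"
      using test_fun_scale[OF test_fun_pd[OF \<xi>(1) b], of "1 / rr n" 0] test_fun_pd[OF \<xi>(1) b] rr[of n] by simp_all
    have "pd b (X n) = (\<lambda>x. of_real (1 / rr n) * pd b \<xi> ((1 / rr n) *\<^sub>R x))" using pX by blast
    then have "pd b (pd b (X n)) = (\<lambda>x. of_real (1 / rr n) * pd b (\<lambda>x. pd b \<xi> ((1 / rr n) *\<^sub>R x)) x)"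
      by (simp only: pd_cmult[OF smooth_diff[OF test_fun_smooth[OF t(2)]]])
    then show ?thesis
      using pd_scale[OF smooth_diff[OF test_fun_smooth[OF t(1)]], of b "1 / rr n" 0] by (simp add: fun_eq_iff)
  qed
  have lapX: "lap (X n) x = of_real (1 / rr n) * (of_real (1 / rr n) * lap \<xi> ((1 / rr n) *\<^sub>R x))" for n x
    unfolding lap_def sum_distrib_left by (intro sum.cong refl ppX)
  define H where "H n x = X n x * g x + of_real (1 / rr n) * E1 n x" for n x
  have tb: "test_fun (\<lambda>x. pd b \<xi> ((1 / rr n) *\<^sub>R x))" if "b \<in> Basis" for b n
    using test_fun_scale[OF test_fun_pd[OF \<xi>(1) that], of "1 / rr n" 0] rr[of n] by simp
  have tl: "test_fun (\<lambda>x. lap \<xi> ((1 / rr n) *\<^sub>R x))" for n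
  proof -
    have "test_fun (lap \<xi>)"
    proof -
      have "test_fun (\<lambda>x. \<Sum>b\<in>I. pd b (pd b \<xi>) x)" if "finite I" "I \<subseteq> Basis" for I
        using that
      proof (induction I rule: finite_induct)
        case empty show ?case by (simp add: test_fun_iff smooth_const)
      next
        case (insert b I) then show ?case by (simp add: test_fun_add test_fun_pd \<xi>(1))
      qed
      then show ?thesis by (simp add: lap_def[abs_def])
    qed
    from test_fun_scale[OF this, of "1 / rr n" 0] show ?thesis using rr[of n] by simp
  qed
  have E1: "L2 (E1 n)" for n
    unfolding E1_def mult.assoc by (intro L2_add L2_sum L2_cmult L2t tb tl f)
  have H2: "L2 (H n)" for n unfolding H_def[abs_def] by (intro L2_add L2t tX g L2_cmult E1)
  have Xf: "L2 (\<lambda>x. X n x * f x)" for n by (intro L2t tX f)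
  have [measurable]: "E1 n \<in> borel_measurable borel" "X n \<in> borel_measurable borel" for n
    using E1[of n] tX[of n] by (auto simp: L2_def intro: test_fun_measurable)
  have far: "norm ((1 / rr n) *\<^sub>R x) > S" if "norm x > S * rr n" for n and x :: 'a
    using that rr[of n] by (simp add: pos_less_divide_eq)
  have X0: "X n x = 0" if "norm x > S * rr n" for n x using S(2)[OF far[OF that]] by (simp add: X_def)
  have E10: "E1 n x = 0" if "norm x > S * rr n" for n x
    unfolding E1_def using S(3)[OF _ far[OF that]] S(4)[OF far[OF that]] by simp
  have supp: "norm x \<le> S * rr n" if "H n x \<noteq> 0 \<or> X n x * f x \<noteq> 0" for n x
    by (rule ccontr) (use that X0[of n x] E10[of n x] in \<open>auto simp: H_def\<close>)
  have lapf: "lap (conv (\<rho> k) (\<lambda>x. X n x * f x)) x + \<i> * of_real l * conv (\<rho> k) (\<lambda>x. X n x * f x) x = conv (\<rho> k) (H n) x" for k n x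
  proof -
    define h where "h y = X n y * (\<Sum>b\<in>Basis. f2 b y) + (\<Sum>b\<in>Basis. 2 * pd b (X n) y * f1 b y) + lap (X n) y * f y" for y
    have h_eq: "h y = H n y + (- (\<i> * of_real l)) * (X n y * f y)" for y
      unfolding h_def H_def E1_def g_def pX lapX by (simp add: algebra_simps sum_distrib_left)
    have bd: "bounded {x. H n x \<noteq> 0}" "bounded {x. X n x * f x \<noteq> 0}"
      using supp[of n] by (auto intro!: bounded_subset[OF bounded_cball, of _ 0 "S * rr n"])
    have "lap (conv (\<rho> k) (\<lambda>x. X n x * f x)) x = conv (\<rho> k) h x"
      unfolding h_def[abs_def] by (rule conv_lap_cutoff[OF f w1 w2 tX \<rho>(1)])
    also have "\<dots> = conv (\<rho> k) (H n) x + (- (\<i> * of_real l)) * conv (\<rho> k) (\<lambda>x. X n x * f x) x"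
      unfolding h_eq[abs_def] by (intro conv_add \<rho> L2_bounded_integrable H2 Xf bd)
    finally show ?thesis by simp
  qed
  define Z where "Z n = wn2 ?w (\<lambda>x. X n x * f x)" for n
  have ge: "wn2 ?i (\<lambda>x. X n x * g x) \<le> Z n" for n
    unfolding Z_def wn2_def
  proof (rule nn_integral_mono_AE)
    show "AE x in lborel. ennreal ((norm (X n x * g x))\<^sup>2) * ?i x \<le> ennreal ((norm (X n x * f x))\<^sup>2) * ?w x"
      using eq
    proof eventually_elim
      case (elim x)
      have gx: "norm (g x) \<le> norm (W x) * norm (f x)" using elim by (simp add: g_def)
      show ?case
      proof (cases "W x = 0")
        \<comment> \<open>Here the weight 1/|W| is infinite, but the bound on g forces g x = 0, and
          0 * \<infinity> = 0.\<close>
        case True then show ?thesis using gx by simp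
      next
        case False
        have "norm (X n x * g x) \<le> norm (X n x * f x) * norm (W x)"
          using mult_left_mono[OF gx, of "norm (X n x)"] by (simp add: norm_mult mult_ac)
        then have "(norm (X n x * g x))\<^sup>2 \<le> (norm (X n x * f x))\<^sup>2 * (norm (W x))\<^sup>2"
          using power_mono[of _ _ 2] by (simp flip: power_mult_distrib)
        then have "(norm (X n x * g x))\<^sup>2 * inverse (norm (W x)) \<le> (norm (X n x * f x))\<^sup>2 * norm (W x)"
          using False by (simp add: field_simps power2_eq_square)
        then show ?thesis using False by (simp add: inverse_ennreal ennreal_mult[symmetric] ennreal_leI)
      qed
    qed
  qed
  \<comment> \<open>Absorption below subtracts a multiple of \<open>Z n\<close>, so finiteness is
    indispensable; it is inherited from \<open>fin\<close> because the cut-offs are bounded by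
    B.\<close>
  have Zfin: "Z n < \<infinity>" for n
  proof -
    have "Z n \<le> (\<integral>\<^sup>+x. ennreal (B\<^sup>2) * (ennreal ((norm (f x))\<^sup>2) * ?w x) \<partial>lborel)"
      unfolding Z_def wn2_def
    proof (rule nn_integral_mono)
      fix x
      have "(norm (X n x * f x))\<^sup>2 \<le> B\<^sup>2 * (norm (f x))\<^sup>2"
        using mult_right_mono[OF power_mono[OF B(2)[of "(1 / rr n) *\<^sub>R x"], of 2]] by (simp add: X_def norm_mult power_mult_distrib)
      then have "ennreal ((norm (X n x * f x))\<^sup>2) \<le> ennreal (B\<^sup>2) * ennreal ((norm (f x))\<^sup>2)"
        by (simp add: ennreal_leI flip: ennreal_mult)
      from mult_right_mono[OF this, of "?w x"] show "ennreal ((norm (X n x * f x))\<^sup>2) * ?w x \<le> ennreal (B\<^sup>2) * (ennreal ((norm (f x))\<^sup>2) * ?w x)"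
        by (simp add: mult.assoc)
    qed
    also have "\<dots> = ennreal (B\<^sup>2) * wn2 ?w f" unfolding wn2_def by (simp add: nn_integral_cmult)
    also have "\<dots> < \<infinity>" using fin by (simp add: ennreal_mult_less_top)
    finally show ?thesis .
  qed
  \<comment> \<open>With R = S \<open>rr n\<close> the bound |W| \<ge> \<eta>/R^2 says that 1/|W| is
    at most c times the square of \<open>rr n\<close>; that square cancels against the squared
    factor 1/\<open>rr n\<close> of the commutator.\<close>
  define c where "c = S\<^sup>2 / \<eta>"
  have c: "c > 0" using S(1) W(1) by (simp add: c_def)
  define G where "G = ennreal (1 / (1 - a)) * (ennreal (A * (1 + \<kappa>) * (1 + 1/\<kappa>)) * ennreal c)"
  have Z_le: "Z n \<le> G * n2 (E1 n)" if n: "rr n \<ge> R0" for n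
  proof -
    have "S * rr n \<ge> 1 * rr n" using S(1) rr[of n] by (intro mult_right_mono) auto
    \<comment> \<open>R \<ge> 1 makes the ball of radius 2R contain the ball of radius R + 1 that
      mollification needs.\<close>
    then have Sn: "S * rr n \<ge> R0" "S * rr n \<ge> 1" using n rr[of n] by linarith+
    have AEi: "AE x in lborel. norm x \<le> S * rr n + 1 \<longrightarrow> ?i x \<le> ennreal (c * (rr n)\<^sup>2)"
      using W(2)[OF Sn(1)]
    proof eventually_elim
      case (elim x)
      show ?case
      proof
        assume "norm x \<le> S * rr n + 1"
        then have "\<eta> / (S * rr n)\<^sup>2 \<le> norm (W x)" using elim Sn by simp
        moreover have p: "\<eta> / (S * rr n)\<^sup>2 > 0"
          using W(1) Sn(2) by (intro divide_pos_pos zero_less_power) linarith+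
        ultimately have "inverse (norm (W x)) \<le> inverse (\<eta> / (S * rr n)\<^sup>2)" by (rule le_imp_inverse_le)
        also have "\<dots> = c * (rr n)\<^sup>2" by (simp add: c_def power_mult_distrib)
        finally have "inverse (norm (W x)) \<le> c * (rr n)\<^sup>2" .
        moreover have "norm (W x) > 0" using \<open>\<eta> / (S * rr n)\<^sup>2 \<le> norm (W x)\<close> p by linarith
        ultimately show "?i x \<le> ennreal (c * (rr n)\<^sup>2)" by (simp add: inverse_ennreal ennreal_leI)
      qed
    qed
    have iE: "wn2 ?i (\<lambda>x. of_real (1 / rr n) * E1 n x) \<le> ennreal c * n2 (E1 n)"
    proof -
      have "wn2 ?i (\<lambda>x. of_real (1 / rr n) * E1 n x) \<le> (\<integral>\<^sup>+x. ennreal c * ennreal ((norm (E1 n x))\<^sup>2) \<partial>lborel)"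
        unfolding wn2_def
      proof (rule nn_integral_mono_AE)
        show "AE x in lborel. ennreal ((norm (of_real (1 / rr n) * E1 n x))\<^sup>2) * ?i x \<le> ennreal c * ennreal ((norm (E1 n x))\<^sup>2)"
          using AEi
        proof eventually_elim
          case (elim x)
          show ?case
          proof (cases "norm x \<le> S * rr n + 1")
            case True
            have "ennreal ((norm (of_real (1 / rr n) * E1 n x))\<^sup>2) * ?i x \<le> ennreal ((norm (of_real (1 / rr n) * E1 n x))\<^sup>2) * ennreal (c * (rr n)\<^sup>2)"
              using elim True by (intro mult_left_mono) auto
            also have "\<dots> = ennreal ((norm (of_real (1 / rr n) * E1 n x))\<^sup>2 * (c * (rr n)\<^sup>2))"
              using c by (simp add: ennreal_mult)
            also have "(norm (of_real (1 / rr n) * E1 n x))\<^sup>2 * (c * (rr n)\<^sup>2) = c * (norm (E1 n x))\<^sup>2"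
              using rr[of n] by (simp add: norm_mult norm_divide power_mult_distrib power_divide)
            finally show ?thesis using c by (simp add: ennreal_mult)
          next
            case False then show ?thesis using E10[of n x] by simp
          qed
        qed
      qed
      also have "\<dots> = ennreal c * n2 (E1 n)" unfolding n2_def by (simp add: nn_integral_cmult)
      finally show ?thesis .
    qed
    have "Z n \<le> ennreal A * (ennreal (1 + \<kappa>) * wn2 ?i (H n))"
      unfolding Z_def
    proof (rule carleman_mollified[where \<rho>=\<rho> and S="S * rr n" and K="c * (rr n)\<^sup>2" and l=l])
      show "norm x \<le> S * rr n" if "X n x * f x \<noteq> 0" for x using supp that by blast
      show "norm x \<le> S * rr n" if "H n x \<noteq> 0" for x using supp that by blast
    qed (fact E Wm AEi \<rho> Xf H2 lapf \<kappa>)+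
    also have "\<dots> \<le> ennreal A * (ennreal (1 + \<kappa>) * (ennreal (1 + \<kappa>) * Z n + ennreal (1 + 1/\<kappa>) * (ennreal c * n2 (E1 n))))"
    proof (intro mult_left_mono)
      have "wn2 ?i (H n) \<le> ennreal (1 + \<kappa>) * wn2 ?i (\<lambda>x. X n x * g x) + ennreal (1 + 1/\<kappa>) * wn2 ?i (\<lambda>x. of_real (1 / rr n) * E1 n x)"
        unfolding H_def[abs_def] by (intro wn2_add \<kappa>) measurable
      also have "\<dots> \<le> ennreal (1 + \<kappa>) * Z n + ennreal (1 + 1/\<kappa>) * (ennreal c * n2 (E1 n))"
        by (intro add_mono mult_left_mono ge iE) auto
      finally show "wn2 ?i (H n) \<le> ennreal (1 + \<kappa>) * Z n + ennreal (1 + 1/\<kappa>) * (ennreal c * n2 (E1 n))" .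
    qed auto
    also have "\<dots> = (ennreal A * ennreal (1 + \<kappa>) * ennreal (1 + \<kappa>)) * Z n + (ennreal A * ennreal (1 + \<kappa>) * ennreal (1 + 1/\<kappa>)) * (ennreal c * n2 (E1 n))"
      by (simp only: distrib_left mult.assoc)
    also have "ennreal A * ennreal (1 + \<kappa>) * ennreal (1 + \<kappa>) = ennreal a"
      unfolding a_def using A \<kappa> by (subst ennreal_mult[symmetric], simp, simp)+ simp
    also have "ennreal A * ennreal (1 + \<kappa>) * ennreal (1 + 1/\<kappa>) = ennreal (A * (1 + \<kappa>) * (1 + 1/\<kappa>))"
      using A \<kappa> by (subst ennreal_mult[symmetric], simp, simp)+ simp
    finally have "Z n \<le> ennreal (1 / (1 - a)) * (ennreal (A * (1 + \<kappa>) * (1 + 1/\<kappa>)) * (ennreal c * n2 (E1 n)))"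
      by (intro ennreal_absorb Zfin a)
    then show ?thesis by (simp only: G_def mult.assoc)
  qed
  have lim_arg: "(\<lambda>n. (1 / rr n) *\<^sub>R x) \<longlonglongrightarrow> 0" for x :: 'a
  proof -
    have "(\<lambda>n. 1 / rr n) \<longlonglongrightarrow> 0" using LIMSEQ_Suc[OF lim_1_over_n] by (simp add: rr_def add.commute)
    from tendsto_scaleR[OF this tendsto_const, of x] show ?thesis by simp
  qed
  have cont0: "isCont (t :: 'a \<Rightarrow> complex) 0" if "test_fun t" for t
    using smooth_continuous[OF test_fun_smooth[OF that]] by (simp add: continuous_on_eq_continuous_at)
  have E1lim: "(\<lambda>n. n2 (E1 n)) \<longlonglongrightarrow> 0"
  proof -
    have "\<exists>C>0. \<forall>x. norm (pd b \<xi> x) \<le> C" if "b \<in> Basis" for b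
      using test_fun_bounded[OF test_fun_pd[OF \<xi>(1) that]] by metis
    then obtain C where C: "\<And>b. b \<in> Basis \<Longrightarrow> C b > 0 \<and> (\<forall>x. norm (pd b \<xi> x) \<le> C b)" by metis
    have "test_fun (lap \<xi>)" using tl[of 0] by (simp add: rr_def)
    then obtain C' where C': "C' > 0" "\<And>x. norm (lap \<xi> x) \<le> C'" using test_fun_bounded by blast
    \<comment> \<open>Dominates all \<open>E1 n\<close> at once: derivatives of the fixed cut-off
      are bounded, and dilation does not change their suprema.\<close>
    define w where "w x = (\<Sum>b\<in>Basis. 2 * C b * norm (f1 b x)) + C' * norm (f x)" for x
    have wb: "norm (E1 n x) \<le> w x" for n x
    proof -
      have "norm (E1 n x) \<le> (\<Sum>b\<in>Basis. norm (2 * pd b \<xi> ((1 / rr n) *\<^sub>R x) * f1 b x)) + norm (of_real (1 / rr n) * (lap \<xi> ((1 / rr n) *\<^sub>R x) * f x))"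
        unfolding E1_def by (intro order_trans[OF norm_triangle_ineq] add_right_mono norm_sum)
      also have "\<dots> \<le> w x"
        unfolding w_def
      proof (intro add_mono sum_mono)
        show "norm (2 * pd b \<xi> ((1 / rr n) *\<^sub>R x) * f1 b x) \<le> 2 * C b * norm (f1 b x)" if "b \<in> Basis" for b
          using C[OF that] by (simp add: norm_mult mult_right_mono)
        have "norm (of_real (1 / rr n) * (lap \<xi> ((1 / rr n) *\<^sub>R x) * f x)) = (1 / rr n) * (norm (lap \<xi> ((1 / rr n) *\<^sub>R x)) * norm (f x))"
          using rr[of n] by (simp add: norm_mult norm_divide)
        also have "\<dots> \<le> 1 * (C' * norm (f x))"
          using rr[of n] C' by (intro mult_mono) (auto simp: divide_le_eq)
        finally show "norm (of_real (1 / rr n) * (lap \<xi> ((1 / rr n) *\<^sub>R x) * f x)) \<le> C' * norm (f x)" by simp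
      qed
      finally show ?thesis .
    qed
    have L2n: "L2 (\<lambda>x. of_real (k * norm (h x)))" if "L2 h" for k and h :: "'a \<Rightarrow> complex"
      unfolding of_real_mult by (intro L2_cmult L2_bound[OF that]) (use that in \<open>auto simp: L2_def\<close>)
    have Lw: "L2 (\<lambda>x. complex_of_real (w x))"
      unfolding w_def of_real_add of_real_sum by (intro L2_add L2_sum L2n f)
    have "(\<lambda>x. Re (complex_of_real (w x))) \<in> borel_measurable borel" using L2_measurable[OF Lw] by measurable
    then have wm: "w \<in> borel_measurable borel" by simp
    have w0: "w x \<ge> 0" for x using order_trans[OF norm_ge_zero wb] by blast
    show ?thesis
    proof (rule n2_tendsto_0[where w="\<lambda>x. (w x)\<^sup>2"])
      show "(\<integral>\<^sup>+x. ennreal ((w x)\<^sup>2) \<partial>lborel) < \<infinity>" using Lw by (simp add: L2_def n2_def)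
      show "(norm (E1 n x))\<^sup>2 \<le> (w x)\<^sup>2" for n x using wb by (intro power_mono) auto
      show "AE x in lborel. (\<lambda>n. E1 n x) \<longlonglongrightarrow> 0"
      proof (rule AE_I2)
        fix x
        have 1: "(\<lambda>n. pd b \<xi> ((1 / rr n) *\<^sub>R x)) \<longlonglongrightarrow> 0" if "b \<in> Basis" for b
          using isCont_tendsto_compose[OF cont0[OF test_fun_pd[OF \<xi>(1) that]] lim_arg[of x]] \<xi>(3)[OF that] by simp
        have 2: "(\<lambda>n. lap \<xi> ((1 / rr n) *\<^sub>R x)) \<longlonglongrightarrow> lap \<xi> 0"
          using isCont_tendsto_compose[OF cont0[OF \<open>test_fun (lap \<xi>)\<close>] lim_arg[of x]] by simp
        have 3: "(\<lambda>n. complex_of_real (1 / rr n)) \<longlonglongrightarrow> of_real 0"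
          using LIMSEQ_Suc[OF lim_1_over_n] by (intro tendsto_of_real) (simp add: rr_def add.commute)
        have "(\<lambda>n. E1 n x) \<longlonglongrightarrow> (\<Sum>b\<in>Basis. 2 * 0 * f1 b x) + of_real 0 * (lap \<xi> 0 * f x)"
          unfolding E1_def by (intro tendsto_add tendsto_sum tendsto_mult tendsto_const 1 2 3)
        then show "(\<lambda>n. E1 n x) \<longlonglongrightarrow> 0" by simp
      qed
    qed (use wm in auto)
  qed
  have "G < \<infinity>" by (simp add: G_def ennreal_mult_less_top)
  then have "(\<lambda>n. G * n2 (E1 n)) \<longlonglongrightarrow> G * 0" using E1lim by (intro ennreal_tendsto_cmult) auto
  then have "(\<lambda>n. G * n2 (E1 n)) \<longlonglongrightarrow> 0" by simp
  moreover have "eventually (\<lambda>n. rr n \<ge> R0) sequentially"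
  proof -
    have "eventually (\<lambda>n. real n \<ge> R0) sequentially"
      by (rule eventually_compose_filterlim[OF eventually_ge_at_top filterlim_real_sequentially])
    then show ?thesis by eventually_elim (simp add: rr_def)
  qed
  then have "eventually (\<lambda>n. Z n \<le> G * n2 (E1 n)) sequentially" by (rule eventually_mono) (rule Z_le)
  ultimately have Zlim: "Z \<longlonglongrightarrow> 0"
    by (intro tendsto_sandwich[of "\<lambda>_. 0" Z sequentially "\<lambda>n. G * n2 (E1 n)" 0]) simp_all
  have "wn2 ?w f = (\<integral>\<^sup>+x. liminf (\<lambda>n. ennreal ((norm (X n x * f x))\<^sup>2) * ?w x) \<partial>lborel)"
    unfolding wn2_def
  proof (rule nn_integral_cong)
    fix x
    have "(\<lambda>n. X n x) \<longlonglongrightarrow> 1" unfolding X_def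
      using isCont_tendsto_compose[OF cont0[OF \<xi>(1)] lim_arg[of x]] \<xi>(2) by simp
    then have "(\<lambda>n. (norm (X n x * f x))\<^sup>2 * norm (W x)) \<longlonglongrightarrow> (norm (1 * f x))\<^sup>2 * norm (W x)"
      by (intro tendsto_intros)
    from tendsto_ennrealI[OF this] have "(\<lambda>n. ennreal ((norm (X n x * f x))\<^sup>2) * ?w x) \<longlonglongrightarrow> ennreal ((norm (f x))\<^sup>2) * ?w x"
      by (simp add: ennreal_mult)
    then show "ennreal ((norm (f x))\<^sup>2) * ?w x = liminf (\<lambda>n. ennreal ((norm (X n x * f x))\<^sup>2) * ?w x)"
      by (simp add: lim_imp_Liminf)
  qed
  also have "\<dots> \<le> liminf Z" unfolding Z_def[abs_def] wn2_def by (rule nn_integral_liminf) measurable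
  also have "\<dots> = 0" using Zlim by (simp add: lim_imp_Liminf)
  finally have "wn2 ?w f = 0" by simp
  then have z: "AE x in lborel. ennreal ((norm (f x))\<^sup>2) * ?w x = 0"
    unfolding wn2_def by (subst (asm) nn_integral_0_iff_AE) auto
  \<comment> \<open>For each radius the lower bound holds off a null set; countably many radii
    exhaust the space, so W is nonzero almost everywhere.\<close>
  have "AE x in lborel. \<forall>n. norm x \<le> 2 * max R0 (rr n) \<longrightarrow> \<eta> / (max R0 (rr n))\<^sup>2 \<le> norm (W x)"
    unfolding AE_all_countable by (intro allI W(2)) simp
  with z show ?thesis
  proof eventually_elim
    case (elim x)
    obtain n where n: "norm x \<le> real n" using real_arch_simple by blast
    have m: "max R0 (rr n) \<ge> rr n" "max R0 (rr n) > 0" using rr[of n] by auto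
    moreover have "norm x \<le> rr n" using n by (simp add: rr_def)
    ultimately have "norm x \<le> 2 * max R0 (rr n)" by linarith
    then have "\<eta> / (max R0 (rr n))\<^sup>2 \<le> norm (W x)" using elim(2) by blast
    moreover have "\<eta> / (max R0 (rr n))\<^sup>2 > 0" using W(1) m(2) by simp
    ultimately have "norm (W x) > 0" by linarith
    then show ?case using elim(1) by (simp add: ennreal_eq_0_iff)
  qed
qed

section \<open>Weights with inverse square decay\<close>

lemma one_add_powr_le:
  fixes s \<beta> :: real
  assumes "s \<ge> 0" "0 < \<beta>" "\<beta> \<le> 1" shows "(1 + s) powr \<beta> \<le> 1 + s powr \<beta>"
proof (cases "s = 0")
  case False
  then have s: "s > 0" using assms by simp
  have "(1 + s) powr \<beta> = (1 + s) * (1 + s) powr (\<beta> - 1)"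
    using powr_add[of "1 + s" 1 "\<beta> - 1"] s by simp
  also have "\<dots> = (1 + s) powr (\<beta> - 1) + s * (1 + s) powr (\<beta> - 1)" by (simp add: algebra_simps)
  also have "\<dots> \<le> 1 + s * s powr (\<beta> - 1)"
  proof (intro add_mono mult_left_mono)
    show "(1 + s) powr (\<beta> - 1) \<le> 1" using s assms powr_mono[of "\<beta> - 1" 0 "1 + s"] by simp
    show "(1 + s) powr (\<beta> - 1) \<le> s powr (\<beta> - 1)" using s assms by (intro powr_mono2') auto
  qed (use s in auto)
  also have "s * s powr (\<beta> - 1) = s powr \<beta>" using powr_add[of s 1 "\<beta> - 1"] s by simp
  finally show ?thesis .
qed simp

text \<open>The bound is uniform in the position of the interval. The part with |y| \<le> s is at
  most the integral over [-s, s], twice the one over [0, s]; where |y| > s the integrand is at most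
  s^(-\<alpha>) on a set of length at most s. These are the two summands of the constant.\<close>

lemma nn_integral_decay_1d:
  fixes a s \<alpha> :: real
  assumes s: "s > 0" and \<alpha>: "0 \<le> \<alpha>" "\<alpha> < 1"
  shows "(\<integral>\<^sup>+y. ennreal (indicator {a..a + s} y * (1 + \<bar>y\<bar>) powr (- \<alpha>)) \<partial>lborel)
    \<le> ennreal ((2 / (1 - \<alpha>) + 1) * s powr (1 - \<alpha>))"
proof -
  let ?h = "\<lambda>y. ennreal (indicator {0..s} y * (1 + y) powr (- \<alpha>))"
  have "(\<integral>\<^sup>+y. ennreal ((1 + y) powr (- \<alpha>)) * indicator {0..s} y \<partial>lborel) =
      ennreal ((1 + s) powr (1 - \<alpha>) / (1 - \<alpha>) - (1 + 0) powr (1 - \<alpha>) / (1 - \<alpha>))"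
  proof (rule nn_integral_FTC_Icc)
    show "((\<lambda>y. (1 + y) powr (1 - \<alpha>) / (1 - \<alpha>)) has_real_derivative (1 + x) powr (- \<alpha>)) (at x)" if "x \<in> {0..s}" for x
    proof -
      have "((\<lambda>y. (1 + y) powr (1 - \<alpha>)) has_real_derivative ((1 - \<alpha>) * (1 + x) powr ((1 - \<alpha>) - 1)) * 1) (at x)"
        by (rule DERIV_chain2[OF has_real_derivative_powr]) (use that in \<open>auto intro!: derivative_eq_intros\<close>)
      from DERIV_cdivide[OF this, of "1 - \<alpha>"] show ?thesis using \<alpha> by simp
    qed
  qed (use s in auto)
  also have "(1 + s) powr (1 - \<alpha>) / (1 - \<alpha>) - (1 + 0) powr (1 - \<alpha>) / (1 - \<alpha>) \<le> s powr (1 - \<alpha>) / (1 - \<alpha>)"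
    using one_add_powr_le[of s "1 - \<alpha>"] s \<alpha> by (simp flip: diff_divide_distrib add: divide_right_mono)
  finally have h: "(\<integral>\<^sup>+y. ?h y \<partial>lborel) \<le> ennreal (s powr (1 - \<alpha>) / (1 - \<alpha>))"
    by (simp add: ennreal_leI ennreal_mult' mult.commute ennreal_indicator)
  have "(\<integral>\<^sup>+y. ennreal (indicator {a..a + s} y * (1 + \<bar>y\<bar>) powr (- \<alpha>)) \<partial>lborel)
    \<le> (\<integral>\<^sup>+y. (?h y + ?h (0 - y)) + ennreal (s powr (- \<alpha>)) * indicator {a..a + s} y \<partial>lborel)"
  proof (rule nn_integral_mono)
    fix y
    show "ennreal (indicator {a..a + s} y * (1 + \<bar>y\<bar>) powr (- \<alpha>)) \<le> (?h y + ?h (0 - y)) + ennreal (s powr (- \<alpha>)) * indicator {a..a + s} y"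
    proof (cases "\<bar>y\<bar> \<le> s")
      case True
      then have "ennreal (indicator {a..a + s} y * (1 + \<bar>y\<bar>) powr (- \<alpha>)) \<le> ?h y + ?h (0 - y)"
        by (cases "y \<ge> 0") (auto simp: indicator_def intro: order_trans[OF _ add_increasing2])
      then show ?thesis by (simp add: add_increasing2)
    next
      case False
      have "(1 + \<bar>y\<bar>) powr (- \<alpha>) \<le> s powr (- \<alpha>)" using False s \<alpha> by (intro powr_mono2') auto
      then have "ennreal (indicator {a..a + s} y * (1 + \<bar>y\<bar>) powr (- \<alpha>)) \<le> ennreal (s powr (- \<alpha>)) * indicator {a..a + s} y"
        by (auto simp: indicator_def intro: ennreal_leI)
      then show ?thesis by (simp add: add_increasing)
    qed
  qed
  also have "\<dots> = ((\<integral>\<^sup>+y. ?h y \<partial>lborel) + (\<integral>\<^sup>+y. ?h (0 - y) \<partial>lborel)) + ennreal (s powr (- \<alpha>)) * ennreal s"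
    using s by (subst nn_integral_add, simp, simp, subst nn_integral_add) (simp_all add: nn_integral_cmult)
  also have "(\<integral>\<^sup>+y. ?h (0 - y) \<partial>lborel) = (\<integral>\<^sup>+y. ?h y \<partial>lborel)"
    by (rule nn_integral_reflect) measurable
  also have "(\<integral>\<^sup>+y. ?h y \<partial>lborel) + (\<integral>\<^sup>+y. ?h y \<partial>lborel) + ennreal (s powr (- \<alpha>)) * ennreal s
     \<le> ennreal (s powr (1 - \<alpha>) / (1 - \<alpha>)) + ennreal (s powr (1 - \<alpha>) / (1 - \<alpha>)) + ennreal (s powr (1 - \<alpha>))"
    using s powr_add[of s "- \<alpha>" 1] by (intro add_mono h) (simp flip: ennreal_mult)
  also have "\<dots> = ennreal ((2 / (1 - \<alpha>) + 1) * s powr (1 - \<alpha>))"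
  proof -
    have "(2 / (1 - \<alpha>) + 1) * s powr (1 - \<alpha>) = s powr (1 - \<alpha>) / (1 - \<alpha>) + s powr (1 - \<alpha>) / (1 - \<alpha>) + s powr (1 - \<alpha>)"
      by (simp add: distrib_right)
    then show ?thesis using \<alpha> by (simp only: ennreal_plus add_nonneg_nonneg divide_nonneg_nonneg powr_ge_zero diff_ge_0_iff_ge less_imp_le)
  qed
  finally show ?thesis .
qed

text \<open>A substitute for \<open>1 / |x|\<^sup>2\<close> whose integrals over cubes factorise.\<close>

definition prod_weight :: "'a::euclidean_space \<Rightarrow> real" where
  "prod_weight x = (\<Prod>b\<in>Basis. (1 + \<bar>x \<bullet> b\<bar>) powr (- 2 / DIM('a)))"

lemma prod_weight_pos: "prod_weight x > 0"
  unfolding prod_weight_def by (intro prod_pos) auto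

lemma prod_weight_le_1: "prod_weight x \<le> 1"
proof -
  have "(1 + \<bar>x \<bullet> b\<bar>) powr (- 2 / DIM('a)) \<le> 1" for b
    using powr_mono[of "- 2 / DIM('a)" 0 "1 + \<bar>x \<bullet> b\<bar>"] by (simp split: if_splits)
  then show ?thesis unfolding prod_weight_def by (intro prod_le_1) auto
qed

lemma prod_weight_measurable[measurable]: "prod_weight \<in> borel_measurable borel"
  unfolding prod_weight_def[abs_def] by measurable

text \<open>Each coordinate satisfies 1 + |x . b| \<le> 1 + 2R \<le> 3R, and the exponents of the
  factors add up to -2; this leaves 1/(3R)^2.\<close>

lemma prod_weight_lower:
  fixes x :: "'a::euclidean_space"
  assumes "norm x \<le> 2 * R" "R \<ge> 1"
  shows "(1 / 9) / R\<^sup>2 \<le> prod_weight x"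
proof -
  have "(1 / 9) / R\<^sup>2 = 1 / (3 * R)\<^sup>2" by (simp add: power_mult_distrib)
  also have "\<dots> = (3 * R) powr (- 2)" using assms(2) by (simp add: powr_minus_divide)
  also have "\<dots> = ((3 * R) powr (- 2 / DIM('a))) ^ DIM('a)"
    using assms(2) by (subst powr_realpow[symmetric]) (simp_all add: powr_powr)
  also have "\<dots> = (\<Prod>b\<in>(Basis::'a set). (3 * R) powr (- 2 / DIM('a)))" by simp
  also have "\<dots> \<le> prod_weight x"
    unfolding prod_weight_def
  proof (intro prod_mono conjI)
    fix b :: 'a assume b: "b \<in> Basis"
    have "1 + \<bar>x \<bullet> b\<bar> \<le> 3 * R" using Basis_le_norm[OF b, of x] assms by simp
    then show "(3 * R) powr (- 2 / DIM('a)) \<le> (1 + \<bar>x \<bullet> b\<bar>) powr (- 2 / DIM('a))"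
      by (intro powr_mono2') auto
  qed auto
  finally show ?thesis .
qed

lemma cube_measure:
  fixes a :: "'a::euclidean_space"
  assumes "s > 0" shows "measure lebesgue (cbox a (a + s *\<^sub>R One)) = s ^ DIM('a)"
  using assms by (simp add: measure_lborel_cbox_eq inner_simps)

text \<open>A cube is a product of intervals of equal length, so the integral factors. The
  one-dimensional exponent is \<alpha> = 2p/n, and the requirement \<alpha> < 1 is exactly p <
  n/2.\<close>

lemma nn_integral_prod_weight:
  fixes a :: "'a::euclidean_space"
  assumes s: "s > 0" and p: "0 \<le> p" "p < DIM('a) / 2"
  shows "(\<integral>\<^sup>+x. ennreal (indicator (cbox a (a + s *\<^sub>R One)) x * prod_weight x powr p) \<partial>lborel)
    \<le> ennreal ((2 / (1 - 2 * p / DIM('a)) + 1) ^ DIM('a) * (s ^ DIM('a)) powr (1 - 2 * p / DIM('a)))"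
proof -
  define \<alpha> where "\<alpha> = 2 * p / DIM('a)"
  have \<alpha>: "0 \<le> \<alpha>" "\<alpha> < 1" using p by (auto simp: \<alpha>_def field_simps)
  have "ennreal (indicator (cbox a (a + s *\<^sub>R One)) x * prod_weight x powr p) =
      (\<Prod>b\<in>Basis. ennreal (indicator {a \<bullet> b..a \<bullet> b + s} (x \<bullet> b) * (1 + \<bar>x \<bullet> b\<bar>) powr (- \<alpha>)))" for x
  proof -
    have "indicator (cbox a (a + s *\<^sub>R One)) x = (\<Prod>b\<in>Basis. indicator {a \<bullet> b..a \<bullet> b + s} (x \<bullet> b) :: real)"
    proof (cases "x \<in> cbox a (a + s *\<^sub>R One)")
      case True then show ?thesis by (auto simp: mem_box inner_simps intro!: prod.neutral[symmetric])
    next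
      case False
      then obtain b where "b \<in> Basis" "x \<bullet> b \<notin> {a \<bullet> b..a \<bullet> b + s}" by (auto simp: mem_box inner_simps)
      then show ?thesis using False by (auto intro!: prod_zero[symmetric] bexI[of _ b])
    qed
    moreover have "prod_weight x powr p = (\<Prod>b\<in>Basis. (1 + \<bar>x \<bullet> b\<bar>) powr (- \<alpha>))"
      unfolding prod_weight_def
      by (subst prod_powr_distrib) (auto simp: powr_powr \<alpha>_def mult_ac intro!: prod.cong)
    ultimately show ?thesis by (simp add: prod_ennreal flip: prod.distrib)
  qed
  then have "(\<integral>\<^sup>+x. ennreal (indicator (cbox a (a + s *\<^sub>R One)) x * prod_weight x powr p) \<partial>lborel)
     = (\<Prod>b\<in>Basis. \<integral>\<^sup>+y. ennreal (indicator {a \<bullet> b..a \<bullet> b + s} y * (1 + \<bar>y\<bar>) powr (- \<alpha>)) \<partial>lborel)"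
    by (simp only:) (rule nn_integral_lborel_prod, auto)
  also have "\<dots> \<le> (\<Prod>b\<in>(Basis::'a set). ennreal ((2 / (1 - \<alpha>) + 1) * s powr (1 - \<alpha>)))"
    by (intro prod_mono_ennreal nn_integral_decay_1d s \<alpha>)
  also have "\<dots> = ennreal (((2 / (1 - \<alpha>) + 1) * s powr (1 - \<alpha>)) ^ DIM('a))"
    using \<alpha> by (simp add: ennreal_power)
  also have "((2 / (1 - \<alpha>) + 1) * s powr (1 - \<alpha>)) ^ DIM('a) = (2 / (1 - \<alpha>) + 1) ^ DIM('a) * (s ^ DIM('a)) powr (1 - \<alpha>)"
  proof -
    have "(s powr (1 - \<alpha>)) ^ DIM('a) = (s ^ DIM('a)) powr (1 - \<alpha>)"
      using s by (subst (1 2) powr_realpow[symmetric]) (simp_all add: powr_powr mult.commute)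
    then show ?thesis by (simp add: power_mult_distrib)
  qed
  finally show ?thesis by (simp add: \<alpha>_def)
qed

section \<open>The Fefferman-Phong norm in terms of integrals over cubes\<close>

lemma cube_scaling:
  fixes m k p q :: real
  assumes "m > 0" "k \<ge> 0"
  shows "m * (k * m powr (- q)) powr p = k powr p * m powr (1 - q * p)"
proof -
  have "m * (k * m powr (- q)) powr p = k powr p * (m powr 1 * m powr (- (q * p)))"
    using assms by (simp add: powr_mult powr_powr)
  also have "m powr 1 * m powr (- (q * p)) = m powr (1 - q * p)"
    by (simp only: powr_add[symmetric] diff_conv_add_uminus)
  finally show ?thesis .
qed

text \<open>Clearing the powers in the definition turns a bound k on the norm into the bound k^p
  |Q|^(1 - 2p/n) on the integral of |W|^p over each cube Q. In this form contributions to |W|^p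
  simply add up.\<close>

lemma FP_norm_le:
  fixes W :: "'a::euclidean_space \<Rightarrow> complex"
  assumes p: "p > 0" and k: "k \<ge> 0"
    and b: "\<And>a s. s > 0 \<Longrightarrow> (LINT x:cbox a (a + s *\<^sub>R One)|lebesgue. norm (W x) powr p) \<le> k powr p * (s ^ DIM('a)) powr (1 - 2 * p / DIM('a))"
  shows "FP_norm p W \<le> ennreal k"
  unfolding FP_norm_def
proof (rule SUP_least)
  fix Q :: "'a set" assume "Q \<in> cubes"
  then obtain a s where Q: "Q = cbox a (a + s *\<^sub>R One)" "s > 0" by (auto simp: cubes_def)
  define m where "m = s ^ DIM('a)"
  have m: "m > 0" "measure lebesgue Q = m" using Q cube_measure[of s a] by (auto simp: m_def)
  have "(1 / m) * (LINT x:Q|lebesgue. norm (W x) powr p) \<le> (1 / m) * (k powr p * m powr (1 - 2 * p / DIM('a)))"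
    unfolding Q m_def using b[OF Q(2)] Q(2) by (intro mult_left_mono) auto
  also have "\<dots> = (k * m powr (- 2 / DIM('a))) powr p"
    using cube_scaling[OF m(1) k, of "2 / DIM('a)" p] m(1) by (simp add: field_simps)
  finally have le: "(1 / m) * (LINT x:Q|lebesgue. norm (W x) powr p) \<le> (k * m powr (- 2 / DIM('a))) powr p" .
  have nn: "0 \<le> (1 / m) * (LINT x:Q|lebesgue. norm (W x) powr p)"
    using m(1) unfolding set_lebesgue_integral_def by (intro mult_nonneg_nonneg integral_nonneg_AE) auto
  have "((1 / m) * (LINT x:Q|lebesgue. norm (W x) powr p)) powr (1 / p) \<le> ((k * m powr (- 2 / DIM('a))) powr p) powr (1 / p)"
    using le nn p by (intro powr_mono2) auto
  also have "\<dots> = k * m powr (- 2 / DIM('a))" using p k by (simp add: powr_powr)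
  finally have "m powr (2 / DIM('a)) * ((1 / m) * (LINT x:Q|lebesgue. norm (W x) powr p)) powr (1 / p) \<le> m powr (2 / DIM('a)) * (k * m powr (- 2 / DIM('a)))"
    by (intro mult_left_mono) auto
  also have "\<dots> = k" using m(1) by (simp add: powr_minus)
  finally show "ennreal (measure lebesgue Q powr (2 / DIM('a)) * ((1 / measure lebesgue Q) * (LINT x:Q|lebesgue. norm (W x) powr p)) powr (1 / p)) \<le> ennreal k"
    unfolding m(2) by (rule ennreal_leI)
qed

text \<open>The converse of \<open>FP_norm_le\<close>, from the supremum back to a single
  cube.\<close>

lemma FP_norm_bound:
  fixes V :: "'a::euclidean_space \<Rightarrow> complex"
  assumes p: "p > 0" and k: "k \<ge> 0" "FP_norm p V \<le> ennreal k" and s: "s > 0"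
  shows "(LINT x:cbox a (a + s *\<^sub>R One)|lebesgue. norm (V x) powr p) \<le> k powr p * (s ^ DIM('a)) powr (1 - 2 * p / DIM('a))"
proof -
  define Q where "Q = cbox a (a + s *\<^sub>R One)"
  define m where "m = s ^ DIM('a)"
  define J where "J = (LINT x:Q|lebesgue. norm (V x) powr p)"
  have m: "m > 0" "measure lebesgue Q = m" using s cube_measure[of s a] by (auto simp: m_def Q_def)
  have "Q \<in> cubes" using s by (auto simp: cubes_def Q_def)
  then have "ennreal (measure lebesgue Q powr (2 / DIM('a)) * ((1 / measure lebesgue Q) * (LINT x:Q|lebesgue. norm (V x) powr p)) powr (1 / p)) \<le> FP_norm p V"
    unfolding FP_norm_def by (rule SUP_upper)
  then have "m powr (2 / DIM('a)) * ((1 / m) * J) powr (1 / p) \<le> k"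
    using k unfolding m(2) J_def by (metis ennreal_le_iff order_trans)
  then have "((1 / m) * J) powr (1 / p) \<le> k * m powr (- 2 / DIM('a))"
    using m(1) by (simp add: powr_minus field_simps)
  then have "(((1 / m) * J) powr (1 / p)) powr p \<le> (k * m powr (- 2 / DIM('a))) powr p"
    using p by (intro powr_mono2) auto
  moreover have "0 \<le> J" unfolding J_def set_lebesgue_integral_def by (intro integral_nonneg_AE) auto
  ultimately have "(1 / m) * J \<le> (k * m powr (- 2 / DIM('a))) powr p"
    using p m(1) by (simp add: powr_powr)
  then have "J \<le> m * (k * m powr (- 2 / DIM('a))) powr p" using m(1) by (simp add: field_simps)
  also have "\<dots> = k powr p * m powr (1 - 2 * p / DIM('a))"
    using cube_scaling[OF m(1) k(1), of "2 / DIM('a)" p] by simp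
  finally show ?thesis by (simp add: J_def Q_def m_def)
qed

text \<open>The maximum, unlike the sum, makes \<open>p\<close>-th powers of norms subadditive without Minkowski's inequality.\<close>

lemma nonborderline_weight:
  fixes V :: "'a::euclidean_space \<Rightarrow> complex"
  assumes V: "V \<in> FP_class p" "V \<in> borel_measurable borel" and v: "FP_norm p V \<le> ennreal v" "0 \<le> v" "v < v'"
    and p: "p > 0" "p < DIM('a) / 2"
  obtains \<epsilon> where "\<epsilon> > 0" "\<epsilon> \<le> 1" "(\<lambda>x. complex_of_real (max (norm (V x)) (\<epsilon> * prod_weight x))) \<in> FP_class p"
    "FP_norm p (\<lambda>x. complex_of_real (max (norm (V x)) (\<epsilon> * prod_weight x))) \<le> ennreal v'"
proof -
  have [measurable]: "V \<in> borel_measurable borel" by fact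
  define K where "K = (2 / (1 - 2 * p / DIM('a)) + 1) ^ DIM('a)"
  have "2 * p / DIM('a) < 1" using p by (simp add: field_simps)
  then have K: "K > 0" unfolding K_def by (intro zero_less_power add_pos_pos divide_pos_pos) auto
  \<comment> \<open>The room between the p-th powers of v and v'. Below, \<epsilon> is chosen so
    that \<epsilon>^p K fits into it, K being the constant of
    \<open>nn_integral_prod_weight\<close>; the minimum with 1 keeps the new weight below |V| +
    1.\<close>
  define \<delta> where "\<delta> = v' powr p - v powr p"
  have \<delta>: "\<delta> > 0" using v p powr_less_mono2[of p v v'] by (simp add: \<delta>_def)
  define \<epsilon> where "\<epsilon> = min 1 ((\<delta> / K) powr (1 / p))"
  have \<epsilon>: "\<epsilon> > 0" "\<epsilon> \<le> 1" using \<delta> K by (auto simp: \<epsilon>_def)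
  have "\<epsilon> powr p \<le> ((\<delta> / K) powr (1 / p)) powr p" using \<epsilon> p by (intro powr_mono2) (auto simp: \<epsilon>_def)
  also have "\<dots> = \<delta> / K" using p \<delta> K by (simp add: powr_powr)
  finally have \<epsilon>K: "v powr p + \<epsilon> powr p * K \<le> v' powr p" using K by (simp add: \<delta>_def field_simps)
  define w where "w x = max (norm (V x)) (\<epsilon> * prod_weight x)" for x
  have [measurable]: "w \<in> borel_measurable borel" unfolding w_def[abs_def] by measurable
  have w0: "w x \<ge> 0" for x by (simp add: w_def max.coboundedI1)
  have wp: "w x powr p \<le> norm (V x) powr p + \<epsilon> powr p * prod_weight x powr p" for x
    using \<epsilon> prod_weight_pos[of x] by (auto simp: w_def max_def powr_mult)
  have Vi: "set_integrable lebesgue A (\<lambda>x. norm (V x) powr p)" if "compact A" for A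
    using V(1) that by (auto simp: FP_class_def Lp_loc_def)
  have Wi: "set_integrable lebesgue A (\<lambda>x. norm (complex_of_real (w x)) powr p)" if A: "compact A" for A
  proof -
    have Am: "A \<in> sets borel" using A by (simp add: compact_imp_closed borel_closed)
    have "emeasure lborel A < \<infinity>" using A by (intro emeasure_bounded_finite compact_imp_bounded)
    then have "integrable lebesgue (indicator A :: 'a \<Rightarrow> real)" using Am by (intro integrable_real_indicator) auto
    then have "integrable lebesgue (\<lambda>x. indicator A x *\<^sub>R (norm (V x) powr p) + indicator A x)"
      using Vi[OF A] by (intro Bochner_Integration.integrable_add) (auto simp: set_integrable_def)
    then show ?thesis unfolding set_integrable_def
    proof (rule Bochner_Integration.integrable_bound)
      have "(\<lambda>x. indicator A x *\<^sub>R norm (complex_of_real (w x)) powr p) \<in> borel_measurable lborel" using Am by measurable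
      then show "(\<lambda>x. indicator A x *\<^sub>R norm (complex_of_real (w x)) powr p) \<in> borel_measurable lebesgue"
        by (rule measurable_completion)
      have "\<epsilon> powr p * prod_weight x powr p \<le> 1" for x :: 'a
        using \<epsilon> p prod_weight_pos[of x] prod_weight_le_1[of x] by (intro mult_le_one powr_le1) auto
      then have "w x powr p \<le> norm (V x) powr p + 1" for x using wp[of x] by (meson add_left_mono order_trans)
      then show "AE x in lebesgue. norm (indicator A x *\<^sub>R norm (complex_of_real (w x)) powr p) \<le> norm (indicator A x *\<^sub>R (norm (V x) powr p) + indicator A x)"
        using w0 by (intro AE_I2) (auto simp: indicator_def)
    qed
  qed
  have "(\<lambda>x. complex_of_real (w x)) \<in> borel_measurable lborel" by simp
  then have Lp: "Lp_loc p (\<lambda>x. complex_of_real (w x))"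
    unfolding Lp_loc_def using Wi by (auto intro: measurable_completion)
  have nW: "FP_norm p (\<lambda>x. complex_of_real (w x)) \<le> ennreal v'"
  proof (rule FP_norm_le)
    show "p > 0" "v' \<ge> 0" using p v by auto
    fix a :: 'a and s :: real assume s: "s > 0"
    define Q where "Q = cbox a (a + s *\<^sub>R One)"
    define M where "M = (s ^ DIM('a)) powr (1 - 2 * p / DIM('a))"
    define J where "J = (LINT x:Q|lebesgue. norm (V x) powr p)"
    have J: "J \<le> v powr p * M" unfolding J_def Q_def M_def by (rule FP_norm_bound) (use p v s in auto)
    have J0: "0 \<le> J" unfolding J_def set_lebesgue_integral_def by (intro integral_nonneg_AE) auto
    have M0: "M \<ge> 0" by (simp add: M_def)
    have [measurable]: "Q \<in> sets borel" by (simp add: Q_def)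
    have "(\<integral>\<^sup>+x. ennreal (indicator Q x *\<^sub>R norm (complex_of_real (w x)) powr p) \<partial>lebesgue)
       = (\<integral>\<^sup>+x. ennreal (indicator Q x *\<^sub>R norm (complex_of_real (w x)) powr p) \<partial>lborel)" by (rule nn_integral_completion)
    also have "\<dots> \<le> (\<integral>\<^sup>+x. ennreal (indicator Q x * norm (V x) powr p) + ennreal (\<epsilon> powr p) * ennreal (indicator Q x * prod_weight x powr p) \<partial>lborel)"
      using w0 wp by (intro nn_integral_mono) (auto simp: indicator_def ennreal_leI simp flip: ennreal_mult ennreal_plus)
    also have "\<dots> = (\<integral>\<^sup>+x. ennreal (indicator Q x * norm (V x) powr p) \<partial>lborel) + ennreal (\<epsilon> powr p) * (\<integral>\<^sup>+x. ennreal (indicator Q x * prod_weight x powr p) \<partial>lborel)"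
      by (simp add: nn_integral_add nn_integral_cmult)
    also have "(\<integral>\<^sup>+x. ennreal (indicator Q x * norm (V x) powr p) \<partial>lborel) = ennreal J"
    proof -
      have "(\<integral>\<^sup>+x. ennreal (indicator Q x * norm (V x) powr p) \<partial>lborel) = (\<integral>\<^sup>+x. ennreal (indicator Q x *\<^sub>R norm (V x) powr p) \<partial>lebesgue)"
        by (simp add: nn_integral_completion)
      also have "\<dots> = ennreal J"
        unfolding J_def set_lebesgue_integral_def
        using Vi[of Q] by (intro nn_integral_eq_integral) (auto simp: Q_def set_integrable_def)
      finally show ?thesis .
    qed
    also have "ennreal J + ennreal (\<epsilon> powr p) * (\<integral>\<^sup>+x. ennreal (indicator Q x * prod_weight x powr p) \<partial>lborel)
       \<le> ennreal J + ennreal (\<epsilon> powr p) * ennreal (K * M)"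
      unfolding K_def M_def Q_def using nn_integral_prod_weight[OF s, of p a] p by (intro add_left_mono mult_left_mono) auto
    also have "\<dots> = ennreal (J + \<epsilon> powr p * (K * M))"
      using J0 K M0 by (simp add: ennreal_mult)
    finally have "(LINT x:Q|lebesgue. norm (complex_of_real (w x)) powr p) \<le> J + \<epsilon> powr p * (K * M)"
      unfolding set_lebesgue_integral_def using J0 K M0 by (intro integral_real_bounded) auto
    also have "\<dots> \<le> (v powr p + \<epsilon> powr p * K) * M" using J by (simp add: algebra_simps)
    also have "\<dots> \<le> v' powr p * M" using \<epsilon>K M0 by (rule mult_right_mono)
    finally show "(LINT x:cbox a (a + s *\<^sub>R One)|lebesgue. norm (complex_of_real (w x)) powr p) \<le> v' powr p * (s ^ DIM('a)) powr (1 - 2 * p / DIM('a))"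
      by (simp add: Q_def M_def)
  qed
  show thesis
  proof (rule that[OF \<epsilon>])
    show "FP_norm p (\<lambda>x. complex_of_real (max (norm (V x)) (\<epsilon> * prod_weight x))) \<le> ennreal v'"
      using nW by (simp only: w_def)
    then show "(\<lambda>x. complex_of_real (max (norm (V x)) (\<epsilon> * prod_weight x))) \<in> FP_class p"
      using Lp by (auto simp: FP_class_def w_def intro: le_less_trans)
  qed
qed

section \<open>From the heat equation to elliptic equations\<close>

lemma prod_measurable_slices:
  fixes P :: "'a::euclidean_space \<times> real \<Rightarrow> complex"
  assumes P: "P \<in> borel_measurable borel"
  shows "P \<in> borel_measurable (lborel \<Otimes>\<^sub>M lborel)" "(\<lambda>t. P (x, t)) \<in> borel_measurable borel" "(\<lambda>x. P (x, t)) \<in> borel_measurable borel"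
proof -
  show *: "P \<in> borel_measurable (lborel \<Otimes>\<^sub>M lborel)" unfolding lborel_prod using P by simp
  show "(\<lambda>t. P (x, t)) \<in> borel_measurable borel" using measurable_Pair2[OF *, of x] by simp
  show "(\<lambda>x. P (x, t)) \<in> borel_measurable borel" using measurable_Pair1[OF *, of t] by simp
qed

lemma n2_prod:
  fixes P :: "'a::euclidean_space \<times> real \<Rightarrow> complex"
  assumes P: "P \<in> borel_measurable borel"
  shows "n2 P = (\<integral>\<^sup>+x. n2 (\<lambda>t. P (x, t)) \<partial>lborel)" "n2 P = (\<integral>\<^sup>+t. n2 (\<lambda>x. P (x, t)) \<partial>lborel)"
proof -
  have m: "(\<lambda>z. ennreal ((norm (P z))\<^sup>2)) \<in> borel_measurable (lborel \<Otimes>\<^sub>M lborel)"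
    using prod_measurable_slices(1)[OF P] by measurable
  show "n2 P = (\<integral>\<^sup>+x. n2 (\<lambda>t. P (x, t)) \<partial>lborel)"
    unfolding n2_def using lborel.nn_integral_fst[OF m] by (simp add: lborel_prod)
  show "n2 P = (\<integral>\<^sup>+t. n2 (\<lambda>x. P (x, t)) \<partial>lborel)"
    unfolding n2_def using lborel_pair.nn_integral_snd[OF m] by (simp add: lborel_prod)
qed

lemma n2_slice_measurable:
  fixes P :: "'a::euclidean_space \<times> real \<Rightarrow> complex"
  assumes P: "P \<in> borel_measurable borel"
  shows "(\<lambda>x. n2 (\<lambda>t. P (x, t))) \<in> borel_measurable borel" "(\<lambda>t. n2 (\<lambda>x. P (x, t))) \<in> borel_measurable borel"
proof -
  have [measurable]: "P \<in> borel_measurable (lborel \<Otimes>\<^sub>M lborel)" by (rule prod_measurable_slices) fact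
  have "(\<lambda>x. n2 (\<lambda>t. P (x, t))) \<in> borel_measurable lborel" "(\<lambda>t. n2 (\<lambda>x. P (x, t))) \<in> borel_measurable lborel"
    unfolding n2_def by measurable
  then show "(\<lambda>x. n2 (\<lambda>t. P (x, t))) \<in> borel_measurable borel" "(\<lambda>t. n2 (\<lambda>x. P (x, t))) \<in> borel_measurable borel" by simp_all
qed

lemma L2_slices_AE:
  fixes P :: "'a::euclidean_space \<times> real \<Rightarrow> complex"
  assumes P: "L2 P" shows "AE x in lborel. L2 (\<lambda>t. P (x, t))"
proof -
  have Pm: "P \<in> borel_measurable borel" using P by (simp add: L2_def)
  have "AE x in lborel. n2 (\<lambda>t. P (x, t)) \<noteq> \<infinity>"
    using P n2_prod(1)[OF Pm] n2_slice_measurable(1)[OF Pm]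
    by (intro nn_integral_PInf_AE) (auto simp: L2_def)
  then show ?thesis by eventually_elim (simp add: L2_def prod_measurable_slices(2)[OF Pm] less_top)
qed

lemma L2_tensor:
  fixes a :: "'a::euclidean_space \<Rightarrow> complex" and m :: "real \<Rightarrow> complex"
  assumes "L2 a" "L2 m" shows "L2 (\<lambda>z. a (fst z) * m (snd z))"
proof -
  have [measurable]: "a \<in> borel_measurable borel" "m \<in> borel_measurable borel" using assms by (auto simp: L2_def)
  have me: "(\<lambda>z. a (fst z) * m (snd z)) \<in> borel_measurable (lborel \<Otimes>\<^sub>M lborel)" by measurable
  then have me': "(\<lambda>z. a (fst z) * m (snd z)) \<in> borel_measurable borel" by (simp add: lborel_prod)
  have "n2 (\<lambda>z. a (fst z) * m (snd z)) = (\<integral>\<^sup>+x. n2 (\<lambda>t. a x * m t) \<partial>lborel)"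
    using n2_prod(1)[OF me'] by simp
  also have "\<dots> = n2 a * n2 m"
    unfolding n2_def by (simp add: norm_mult power_mult_distrib ennreal_mult nn_integral_cmult nn_integral_multc)
  also have "\<dots> < \<infinity>" using assms by (simp add: L2_def ennreal_mult_less_top)
  finally show ?thesis using me' by (simp add: L2_def)
qed

lemma tensor_fubini:
  fixes P :: "'a::euclidean_space \<times> real \<Rightarrow> complex"
  assumes P: "L2 P" and a: "L2 a" and m: "L2 m"
  shows "(LINT z|lborel. P z * (a (fst z) * m (snd z))) = (LINT x|lborel. (LINT t|lborel. P (x, t) * m t) * a x)"
    "(LINT z|lborel. P z * (a (fst z) * m (snd z))) = (LINT t|lborel. (LINT x|lborel. P (x, t) * a x) * m t)"
proof -
  have i: "integrable (lborel \<Otimes>\<^sub>M lborel) (\<lambda>z. P z * (a (fst z) * m (snd z)))"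
    unfolding lborel_prod by (rule L2_mult_integrable[OF P L2_tensor[OF a m]])
  have "(LINT z|lborel. P z * (a (fst z) * m (snd z))) = (LINT x|lborel. (LINT t|lborel. (P (x, t) * m t) * a x))"
    using lborel_pair.integral_fst'[OF i] by (simp add: lborel_prod mult_ac)
  then show "(LINT z|lborel. P z * (a (fst z) * m (snd z))) = (LINT x|lborel. (LINT t|lborel. P (x, t) * m t) * a x)" by simp
  have "(LINT z|lborel. P z * (a (fst z) * m (snd z))) = (LINT t|lborel. (LINT x|lborel. (P (x, t) * a x) * m t))"
    using lborel_pair.integral_snd[of "\<lambda>x t. P (x, t) * (a x * m t)"] i by (simp add: lborel_prod mult_ac case_prod_beta')
  then show "(LINT z|lborel. P z * (a (fst z) * m (snd z))) = (LINT t|lborel. (LINT x|lborel. P (x, t) * a x) * m t)" by simp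
qed

lemma norm_integral_mult_sq_le:
  fixes f g :: "'a::euclidean_space \<Rightarrow> complex"
  assumes [measurable]: "f \<in> borel_measurable borel" "g \<in> borel_measurable borel"
  shows "ennreal ((norm (LINT t|lborel. f t * g t))\<^sup>2) \<le> n2 f * n2 g"
proof -
  have "ennreal ((norm (LINT t|lborel. f t * g t))\<^sup>2) = (ennreal (norm (LINT t|lborel. f t * g t)))\<^sup>2"
    by (simp add: ennreal_power)
  also have "\<dots> \<le> (\<integral>\<^sup>+t. norm (f t * g t) \<partial>lborel)\<^sup>2"
    by (intro power_mono ennreal_norm_integral_le) simp
  also have "\<dots> = (\<integral>\<^sup>+t. ennreal (norm (f t)) * ennreal (norm (g t)) \<partial>lborel)\<^sup>2"
    by (simp add: norm_mult ennreal_mult)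
  also have "\<dots> \<le> (\<integral>\<^sup>+t. (ennreal (norm (f t)))\<^sup>2 \<partial>lborel) * (\<integral>\<^sup>+t. (ennreal (norm (g t)))\<^sup>2 \<partial>lborel)"
    by (intro Cauchy_Schwarz_nn_integral) measurable
  finally show ?thesis by (simp add: n2_def ennreal_power)
qed

text \<open>Cauchy-Schwarz in t for each x, then Tonelli: the squared norm is at most the product of
  the squared norms of P and m.\<close>

lemma L2_time_integral:
  fixes P :: "'a::euclidean_space \<times> real \<Rightarrow> complex"
  assumes P: "L2 P" and m: "L2 m" shows "L2 (\<lambda>x. LINT t|lborel. P (x, t) * m t)"
proof -
  have Pm: "P \<in> borel_measurable borel" and [measurable]: "m \<in> borel_measurable borel" using P m by (auto simp: L2_def)
  have [measurable]: "P \<in> borel_measurable (lborel \<Otimes>\<^sub>M lborel)" by (rule prod_measurable_slices) fact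
  have "(\<lambda>x. LINT t|lborel. P (x, t) * m t) \<in> borel_measurable lborel" by measurable
  moreover have "n2 (\<lambda>x. LINT t|lborel. P (x, t) * m t) \<le> (\<integral>\<^sup>+x. n2 (\<lambda>t. P (x, t)) * n2 m \<partial>lborel)"
    unfolding n2_def[of "\<lambda>x. LINT t|lborel. P (x, t) * m t"]
    by (intro nn_integral_mono norm_integral_mult_sq_le prod_measurable_slices Pm) simp
  moreover have "\<dots> = n2 P * n2 m"
    unfolding n2_prod(1)[OF Pm] using n2_slice_measurable(1)[OF Pm] by (simp add: nn_integral_multc)
  ultimately show ?thesis using P m by (auto simp: L2_def ennreal_mult_less_top intro: le_less_trans)
qed

lemma L2_space_integral:
  fixes P :: "'a::euclidean_space \<times> real \<Rightarrow> complex"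
  assumes P: "L2 P" and a: "L2 a" shows "L2 (\<lambda>t. LINT x|lborel. P (x, t) * a x)"
proof -
  have Pm: "P \<in> borel_measurable borel" and [measurable]: "a \<in> borel_measurable borel" using P a by (auto simp: L2_def)
  have [measurable]: "P \<in> borel_measurable (lborel \<Otimes>\<^sub>M lborel)" by (rule prod_measurable_slices) fact
  have "(\<lambda>t. LINT x|lborel. P (x, t) * a x) \<in> borel_measurable lborel" by measurable
  moreover have "n2 (\<lambda>t. LINT x|lborel. P (x, t) * a x) \<le> (\<integral>\<^sup>+t. n2 (\<lambda>x. P (x, t)) * n2 a \<partial>lborel)"
    unfolding n2_def[of "\<lambda>t. LINT x|lborel. P (x, t) * a x"]
    by (intro nn_integral_mono norm_integral_mult_sq_le prod_measurable_slices Pm) simp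
  moreover have "\<dots> = n2 P * n2 a"
    unfolding n2_prod(2)[OF Pm] using n2_slice_measurable(2)[OF Pm] by (simp add: nn_integral_multc)
  ultimately show ?thesis using P a by (auto simp: L2_def ennreal_mult_less_top intro: le_less_trans)
qed

lemma L2_fundamental_lemma:
  fixes q :: "'a::euclidean_space \<Rightarrow> complex"
  assumes q: "L2 q" and z: "\<And>\<phi>. test_fun \<phi> \<Longrightarrow> (LINT x|lborel. q x * \<phi> x) = 0"
  shows "AE x in lborel. q x = 0"
proof (rule fundamental_lemma)
  show "integrable lborel (\<lambda>x. indicator (cbox a b) x *\<^sub>R q x)" for a b
  proof -
    have "L2 (\<lambda>x::'a. complex_of_real (indicator (cbox a b) x))"
      by (rule bounded_support_integrable(2)[where B=1]) (auto simp: indicator_def intro: bounded_subset[OF bounded_cbox[of a b]])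
    from L2_mult_integrable[OF this q] show ?thesis by (simp add: scaleR_conv_of_real)
  qed
qed (use q z in \<open>auto simp: L2_def mult.commute\<close>)

text \<open>Transfers a weak identity from test functions \<eta> of time to a time weight m that is
  merely in L^2. After integration in x both sides are L^2 functions of t; they agree almost
  everywhere because they agree against every \<eta>, and then both may be integrated against
  m.\<close>

lemma weak_time_integral:
  fixes P Q :: "'a::euclidean_space \<times> real \<Rightarrow> complex"
  assumes P: "L2 P" "L2 Q" and t: "L2 \<phi>1" "L2 \<phi>2" and m: "L2 m"
    and w: "\<And>\<eta>. test_fun \<eta> \<Longrightarrow> (LINT z|lborel. P z * (\<phi>1 (fst z) * \<eta> (snd z))) = (LINT z|lborel. Q z * (\<phi>2 (fst z) * \<eta> (snd z)))"
  shows "(LINT x|lborel. (LINT t|lborel. P (x, t) * m t) * \<phi>1 x) = (LINT x|lborel. (LINT t|lborel. Q (x, t) * m t) * \<phi>2 x)"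
proof -
  define p q where "p t = (LINT x|lborel. P (x, t) * \<phi>1 x)" and "q t = (LINT x|lborel. Q (x, t) * \<phi>2 x)" for t
  have pq: "L2 p" "L2 q" unfolding p_def[abs_def] q_def[abs_def] by (intro L2_space_integral P t)+
  have "AE t in lborel. p t - q t = 0"
  proof (rule L2_fundamental_lemma)
    show "L2 (\<lambda>t. p t - q t)" by (intro L2_diff pq)
    fix \<eta> :: "real \<Rightarrow> complex" assume \<eta>: "test_fun \<eta>"
    have "(LINT t|lborel. p t * \<eta> t) = (LINT t|lborel. q t * \<eta> t)"
      using w[OF \<eta>] tensor_fubini(2)[OF P(1) t(1) test_fun_L2[OF \<eta>]] tensor_fubini(2)[OF P(2) t(2) test_fun_L2[OF \<eta>]]
      by (simp add: p_def q_def)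
    then show "(LINT t|lborel. (p t - q t) * \<eta> t) = 0"
      using L2_mult_integrable[OF pq(1) test_fun_L2[OF \<eta>]] L2_mult_integrable[OF pq(2) test_fun_L2[OF \<eta>]]
      by (simp add: left_diff_distrib)
  qed
  then have "(LINT t|lborel. p t * m t) = (LINT t|lborel. q t * m t)"
    using pq m by (intro integral_cong_AE) (auto simp: L2_def)
  then show ?thesis
    using tensor_fubini[OF P(1) t(1) m] tensor_fubini[OF P(2) t(2) m] by (simp add: p_def q_def)
qed

lemma gaussian_weight_L2:
  fixes m :: "real \<Rightarrow> complex"
  assumes "m \<in> borel_measurable borel" "\<And>t. norm (m t) \<le> K * exp (- t\<^sup>2 / 2)"
  shows "L2 m"
proof -
  have "integrable lborel (\<lambda>t. K\<^sup>2 * sqrt (2 * pi) * std_normal_density t)" by (intro integrable_mult_right integrable_normal_density) simp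
  then have i: "integrable lborel (\<lambda>t. K\<^sup>2 * sqrt (2 * pi) * std_normal_density t)" .
  have b: "norm ((norm (m t))\<^sup>2) \<le> norm (K\<^sup>2 * sqrt (2 * pi) * std_normal_density t)" for t
  proof -
    have "(norm (m t))\<^sup>2 \<le> (K * exp (- t\<^sup>2 / 2))\<^sup>2" using assms(2) by (intro power_mono) auto
    also have "\<dots> = K\<^sup>2 * (exp (- t\<^sup>2 / 2) * exp (- t\<^sup>2 / 2))" by (simp add: power2_eq_square)
    also have "\<dots> \<le> K\<^sup>2 * (exp (- t\<^sup>2 / 2) * 1)" by (intro mult_left_mono) auto
    also have "\<dots> = K\<^sup>2 * sqrt (2 * pi) * std_normal_density t" by (simp add: std_normal_density_def)
    finally show ?thesis by simp
  qed
  have "(\<lambda>t. (norm (m t))\<^sup>2) \<in> borel_measurable lborel" using assms(1) by measurable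
  then have "integrable lborel (\<lambda>t. (norm (m t))\<^sup>2)"
    by (rule Bochner_Integration.integrable_bound[OF i _ AE_I2[OF b]])
  then show ?thesis using assms(1) by (simp add: L2_iff_integrable)
qed

text \<open>Space derivatives pass under the time integral in the weak sense, with no slicing. The
  time derivative is treated on slices of fixed x, because U times m' contains g' and is not known
  to be integrable over space-time.\<close>

lemma heat_uniqueness:
  fixes U Ut :: "'a::euclidean_space \<times> real \<Rightarrow> complex" and V W :: "'a \<Rightarrow> complex" and g g' :: "real \<Rightarrow> real"
  assumes E: "\<And>F l. test_fun F \<Longrightarrow> wn2 (\<lambda>x. inverse (ennreal (norm (W x)))) F < \<infinity> \<Longrightarrow>
      wn2 (\<lambda>x. ennreal (norm (W x))) F \<le> ennreal A * wn2 (\<lambda>x. inverse (ennreal (norm (W x)))) (\<lambda>x. lap F x + \<i> * of_real l * F x)"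
    and A: "0 \<le> A" "A < 1"
    and Wm: "W \<in> borel_measurable borel" and Vm: "V \<in> borel_measurable borel"
    and W: "\<eta> > 0" "\<And>R. R \<ge> R0 \<Longrightarrow> AE x in lborel. norm x \<le> 2 * R \<longrightarrow> \<eta> / R\<^sup>2 \<le> norm (W x)"
    and VW: "\<And>x. norm (V x) \<le> norm (W x)" "\<And>x. norm (W x) \<le> norm (V x) + 1"
    and U: "L2 U" "L2 Ut" "\<And>b. b \<in> Basis \<Longrightarrow> L2 (U1 b)" "\<And>b. b \<in> Basis \<Longrightarrow> L2 (U2 b)"
    and wt: "\<And>\<phi>. test_fun \<phi> \<Longrightarrow> (LINT z|lborel. U z * pd (0, 1) \<phi> z) = - (LINT z|lborel. Ut z * \<phi> z)"
    and w1: "\<And>b \<phi>. b \<in> Basis \<Longrightarrow> test_fun \<phi> \<Longrightarrow> (LINT z|lborel. U z * pd (b, 0) \<phi> z) = - (LINT z|lborel. U1 b z * \<phi> z)"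
    and w2: "\<And>b \<phi>. b \<in> Basis \<Longrightarrow> test_fun \<phi> \<Longrightarrow> (LINT z|lborel. U z * pd (b, 0) (pd (b, 0) \<phi>) z) = (LINT z|lborel. U2 b z * \<phi> z)"
    and eqn: "AE z in lborel. Ut z - (\<Sum>b\<in>Basis. U2 b z) = (of_real (g' (snd z) + snd z) + V (fst z)) * U z"
    and g: "\<And>t. (g has_real_derivative g' t) (at t)" "\<And>t. c \<le> g t"
  shows "AE z in lborel. U z = 0"
proof -
  define m where "m \<sigma> t = complex_of_real (exp (- g t - t\<^sup>2 / 2)) * iexp (\<sigma> * t)" for \<sigma> t
  \<comment> \<open>The logarithmic derivative i \<sigma> - (g' + t) is opposite to the
    time-dependent part of the potential, up to the frequency.\<close>
  define m' where "m' \<sigma> t = (\<i> * of_real \<sigma> - of_real (g' t + t)) * m \<sigma> t" for \<sigma> t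
  have md: "(m \<sigma> has_vector_derivative m' \<sigma> t) (at t)" for \<sigma> t
  proof -
    have "((\<lambda>t. exp (- g t - t\<^sup>2 / 2)) has_real_derivative (- (g' t + t)) * exp (- g t - t\<^sup>2 / 2)) (at t)"
      using g(1) by (auto intro!: derivative_eq_intros simp: algebra_simps)
    then have 1: "((\<lambda>t. complex_of_real (exp (- g t - t\<^sup>2 / 2))) has_vector_derivative of_real ((- (g' t + t)) * exp (- g t - t\<^sup>2 / 2))) (at t)"
      by (intro has_vector_derivative_of_real) (simp add: has_real_derivative_iff_has_vector_derivative)
    have 2: "((\<lambda>t. iexp (\<sigma> * t)) has_vector_derivative (\<i> * of_real \<sigma>) * iexp (\<sigma> * t)) (at t)"
    proof -
      have "((\<lambda>z. exp (\<i> * of_real \<sigma> * z)) has_field_derivative (\<i> * of_real \<sigma>) * exp (\<i> * of_real \<sigma> * of_real t)) (at (of_real t))"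
        by (auto intro!: derivative_eq_intros)
      from has_vector_derivative_real_field[OF this] show ?thesis by (simp add: mult.assoc)
    qed
    from has_vector_derivative_mult[OF 1 2] show ?thesis
      unfolding m_def[abs_def] m'_def by (simp add: algebra_simps)
  qed
  have mb: "norm (m \<sigma> t) \<le> exp (- c) * exp (- t\<^sup>2 / 2)" for \<sigma> t
  proof -
    have "norm (m \<sigma> t) = exp (- g t - t\<^sup>2 / 2)" by (simp add: m_def norm_mult)
    also have "\<dots> \<le> exp (- c + (- t\<^sup>2 / 2))" using g(2)[of t] by simp
    finally show ?thesis by (simp only: exp_add)
  qed
  have mm: "m \<sigma> \<in> borel_measurable borel" for \<sigma>
  proof (rule borel_measurable_continuous_onI)
    show "continuous_on UNIV (m \<sigma>)" using md by (intro continuous_at_imp_continuous_on ballI has_vector_derivative_continuous)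
  qed
  have mL: "L2 (m \<sigma>)" for \<sigma> by (rule gaussian_weight_L2[OF mm mb])
  define f where "f \<sigma> x = (LINT t|lborel. U (x, t) * m \<sigma> t)" for \<sigma> x
  define f1 where "f1 \<sigma> b x = (LINT t|lborel. U1 b (x, t) * m \<sigma> t)" for \<sigma> b x
  define f2 where "f2 \<sigma> b x = (LINT t|lborel. U2 b (x, t) * m \<sigma> t)" for \<sigma> b x
  have fL: "L2 (f \<sigma>)" "b \<in> Basis \<Longrightarrow> L2 (f1 \<sigma> b)" "b \<in> Basis \<Longrightarrow> L2 (f2 \<sigma> b)" for \<sigma> b
    unfolding f_def[abs_def] f1_def[abs_def] f2_def[abs_def] by (auto intro!: L2_time_integral U mL)
  have fw1: "(LINT x|lborel. f \<sigma> x * pd b \<phi> x) = - (LINT x|lborel. f1 \<sigma> b x * \<phi> x)" if b: "b \<in> Basis" and \<phi>: "test_fun \<phi>" for \<sigma> b \<phi>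
  proof -
    have "(LINT x|lborel. f \<sigma> x * pd b \<phi> x) = (LINT x|lborel. f1 \<sigma> b x * (- 1 * \<phi> x))"
      unfolding f_def f1_def
    proof (rule weak_time_integral)
      fix \<eta> :: "real \<Rightarrow> complex" assume \<eta>: "test_fun \<eta>"
      show "(LINT z|lborel. U z * (pd b \<phi> (fst z) * \<eta> (snd z))) = (LINT z|lborel. U1 b z * ((- 1 * \<phi> (fst z)) * \<eta> (snd z)))"
        using w1[OF b test_fun_tensor[OF \<phi> \<eta>]] pd_tensor_space[OF test_fun_smooth[OF \<phi>] test_fun_smooth[OF \<eta>], of b] by simp
    qed (intro U b mL test_fun_L2 test_fun_pd test_fun_cmult \<phi>)+
    then show ?thesis by simp
  qed
  have fw2: "(LINT x|lborel. f \<sigma> x * pd b (pd b \<phi>) x) = (LINT x|lborel. f2 \<sigma> b x * \<phi> x)" if b: "b \<in> Basis" and \<phi>: "test_fun \<phi>" for \<sigma> b \<phi>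
    unfolding f_def f2_def
  proof (rule weak_time_integral)
    fix \<eta> :: "real \<Rightarrow> complex" assume \<eta>: "test_fun \<eta>"
    have "pd (b, 0) (pd (b, 0) (\<lambda>z. \<phi> (fst z) * \<eta> (snd z))) = (\<lambda>z. pd b (pd b \<phi>) (fst z) * \<eta> (snd z))"
      using \<phi> \<eta> b by (simp add: pd_tensor_space smooth_pd test_fun_smooth)
    then show "(LINT z|lborel. U z * (pd b (pd b \<phi>) (fst z) * \<eta> (snd z))) = (LINT z|lborel. U2 b z * (\<phi> (fst z) * \<eta> (snd z)))"
      using w2[OF b test_fun_tensor[OF \<phi> \<eta>]] by simp
  qed (intro U b mL test_fun_L2 test_fun_pd \<phi>)+
  \<comment> \<open>For each single test function the weak derivative in t holds on almost every
    slice, with a null set depending on that function; rational a and b make the union of these sets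
    null.\<close>
  have slice_weak: "AE x in lborel. \<forall>a\<in>\<rat>. \<forall>b\<in>\<rat>. \<forall>k.
      (LINT t|lborel. U (x, t) * pd 1 (bump_primitive a b k) t) = - (LINT t|lborel. Ut (x, t) * bump_primitive a b k t)"
  proof -
    have "AE x in lborel. (LINT t|lborel. U (x, t) * pd 1 (bump_primitive a b k) t) = - (LINT t|lborel. Ut (x, t) * bump_primitive a b k t)" for a b k
    proof -
      let ?\<eta> = "bump_primitive a b k"
      have \<eta>: "test_fun ?\<eta>" "test_fun (pd 1 ?\<eta>)" by (auto intro!: bump_primitive test_fun_pd)
      define j1 j2 where "j1 x = (LINT t|lborel. U (x, t) * pd 1 ?\<eta> t)" and "j2 x = (LINT t|lborel. Ut (x, t) * ?\<eta> t)" for x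
      have j: "L2 j1" "L2 j2" unfolding j1_def[abs_def] j2_def[abs_def] by (intro L2_time_integral U test_fun_L2 \<eta>)+
      have "AE x in lborel. j1 x + j2 x = 0"
      proof (rule L2_fundamental_lemma)
        fix \<phi> :: "'a \<Rightarrow> complex" assume \<phi>: "test_fun \<phi>"
        have "(LINT x|lborel. j1 x * \<phi> x) = - (LINT x|lborel. j2 x * \<phi> x)"
          using wt[OF test_fun_tensor[OF \<phi> \<eta>(1)]] pd_tensor_time[OF test_fun_smooth[OF \<phi>] test_fun_smooth[OF \<eta>(1)]]
            tensor_fubini(1)[OF U(1) test_fun_L2[OF \<phi>] test_fun_L2[OF \<eta>(2)]] tensor_fubini(1)[OF U(2) test_fun_L2[OF \<phi>] test_fun_L2[OF \<eta>(1)]]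
          by (simp add: j1_def j2_def)
        then show "(LINT x|lborel. (j1 x + j2 x) * \<phi> x) = 0"
          using L2_mult_integrable[OF j(1) test_fun_L2[OF \<phi>]] L2_mult_integrable[OF j(2) test_fun_L2[OF \<phi>]]
          by (simp add: distrib_right)
      qed (intro L2_add j)
      then show ?thesis by eventually_elim (simp add: j1_def j2_def add_eq_0_iff2)
    qed
    then have "AE x in lborel. \<forall>k. (LINT t|lborel. U (x, t) * pd 1 (bump_primitive a b k) t) = - (LINT t|lborel. Ut (x, t) * bump_primitive a b k t)" for a b
      by (simp add: AE_all_countable)
    then show ?thesis by (intro AE_ball_countable') (auto simp: countable_rat)
  qed
  have slice_eqn: "AE x in lborel. AE t in lborel. Ut (x, t) - (\<Sum>b\<in>Basis. U2 b (x, t)) = (of_real (g' t + t) + V x) * U (x, t)"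
  proof -
    have "AE z in lborel \<Otimes>\<^sub>M lborel. Ut z - (\<Sum>b\<in>Basis. U2 b z) = (of_real (g' (snd z) + snd z) + V (fst z)) * U z"
      using eqn by (simp only: lborel_prod)
    from lborel_pair.AE_pair[OF this] show ?thesis by simp
  qed
  have slice_L2: "AE x in lborel. L2 (\<lambda>t. U (x, t)) \<and> L2 (\<lambda>t. Ut (x, t)) \<and> (\<forall>b\<in>Basis. L2 (\<lambda>t. U2 b (x, t)))"
  proof -
    have "AE x in lborel. \<forall>b\<in>Basis. L2 (\<lambda>t. U2 b (x, t))"
      by (intro AE_finite_allI finite_Basis L2_slices_AE U(4))
    with L2_slices_AE[OF U(1)] L2_slices_AE[OF U(2)] show ?thesis by eventually_elim auto
  qed
  have elliptic: "AE x in lborel. (\<Sum>b\<in>Basis. f2 \<sigma> b x) + \<i> * of_real \<sigma> * f \<sigma> x = - V x * f \<sigma> x" for \<sigma>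
    using slice_weak slice_eqn slice_L2
  proof eventually_elim
    case (elim x)
    define y y1 where "y t = U (x, t)" and "y1 t = Ut (x, t)" for t
    \<comment> \<open>In m' y + m y1 the terms with g' t + t cancel by the equation; what remains is
      a sum of L^2 functions times m, hence integrable.\<close>
    define r where "r t = ((\<Sum>b\<in>Basis. U2 b (x, t)) + (V x + \<i> * of_real \<sigma>) * y t) * m \<sigma> t" for t
    have L: "L2 y" "L2 y1" "\<And>b. b \<in> Basis \<Longrightarrow> L2 (\<lambda>t. U2 b (x, t))" using elim(3) by (auto simp: y_def[abs_def] y1_def[abs_def])
    have i1: "integrable lborel (\<lambda>t. y t * m \<sigma> t)" "\<And>b. b \<in> Basis \<Longrightarrow> integrable lborel (\<lambda>t. U2 b (x, t) * m \<sigma> t)"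
      by (intro L2_mult_integrable L mL; assumption)+
    have r0: "(LINT t|lborel. r t) = 0"
    proof (rule weak_product_integral_zero[OF L(1,2) _ md mb])
      show "(LINT t|lborel. y t * pd 1 (bump_primitive a b k) t) = - (LINT t|lborel. y1 t * bump_primitive a b k t)" if "a \<in> \<rat>" "b \<in> \<rat>" for a b k
        using elim(1) that by (simp add: y_def y1_def)
      show "AE t in lborel. m' \<sigma> t * y t + m \<sigma> t * y1 t = r t"
        using elim(2)
      proof eventually_elim
        case (elim t)
        then have "y1 t = (\<Sum>b\<in>Basis. U2 b (x, t)) + (of_real (g' t + t) + V x) * y t" by (simp add: y_def y1_def diff_eq_eq add.commute)
        then show ?case by (simp add: m'_def r_def algebra_simps)
      qed
      show "integrable lborel r"
        unfolding r_def[abs_def] by (intro L2_mult_integrable L2_add L2_sum L2_cmult L mL)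
    qed
    have "0 = (LINT t|lborel. r t)" by (simp only: r0)
    also have "(LINT t|lborel. r t) = (LINT t|lborel. (\<Sum>b\<in>Basis. U2 b (x, t) * m \<sigma> t) + (V x + \<i> * of_real \<sigma>) * (y t * m \<sigma> t))"
      by (intro Bochner_Integration.integral_cong refl) (simp add: r_def distrib_right sum_distrib_right mult.assoc)
    also have "\<dots> = (\<Sum>b\<in>Basis. f2 \<sigma> b x) + (V x + \<i> * of_real \<sigma>) * f \<sigma> x"
      using i1 by (subst Bochner_Integration.integral_add) (auto simp: f2_def f_def y_def Bochner_Integration.integral_sum)
    finally have z: "(\<Sum>b\<in>Basis. f2 \<sigma> b x) + (V x + \<i> * of_real \<sigma>) * f \<sigma> x = 0" by (rule sym)
    have "(\<Sum>b\<in>Basis. f2 \<sigma> b x) + \<i> * of_real \<sigma> * f \<sigma> x = ((\<Sum>b\<in>Basis. f2 \<sigma> b x) + (V x + \<i> * of_real \<sigma>) * f \<sigma> x) - V x * f \<sigma> x"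
      by (simp add: algebra_simps)
    then show ?case unfolding z by simp
  qed
  have f0: "AE x in lborel. f \<sigma> x = 0" for \<sigma>
  proof (rule elliptic_uniqueness[where f="f \<sigma>" and ?f1.0="f1 \<sigma>" and ?f2.0="f2 \<sigma>" and l=\<sigma> and W=W and A=A and \<eta>=\<eta> and ?R0.0=R0])
    show "AE x in lborel. norm ((\<Sum>b\<in>Basis. f2 \<sigma> b x) + \<i> * of_real \<sigma> * f \<sigma> x) \<le> norm (W x) * norm (f \<sigma> x)"
      using elliptic[of \<sigma>] by eventually_elim (simp add: norm_mult mult_right_mono VW)
    \<comment> \<open>By the elliptic equation |G| = |V||f|, so |V||f|^2 = |G||f| is integrable
      although V may be unbounded; with |W| \<le> |V| + 1 this gives the finiteness that absorption
      demands.\<close>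
    define G where "G x = (\<Sum>b\<in>Basis. f2 \<sigma> b x) + \<i> * of_real \<sigma> * f \<sigma> x" for x
    have G: "L2 G" unfolding G_def[abs_def] by (intro L2_add L2_sum L2_cmult fL)
    have "wn2 (\<lambda>x. ennreal (norm (W x))) (f \<sigma>) \<le> (\<integral>\<^sup>+x. ennreal ((norm (G x))\<^sup>2) + 2 * ennreal ((norm (f \<sigma> x))\<^sup>2) \<partial>lborel)"
      unfolding wn2_def
    proof (rule nn_integral_mono_AE)
      show "AE x in lborel. ennreal ((norm (f \<sigma> x))\<^sup>2) * ennreal (norm (W x)) \<le> ennreal ((norm (G x))\<^sup>2) + 2 * ennreal ((norm (f \<sigma> x))\<^sup>2)"
        using elliptic[of \<sigma>]
      proof eventually_elim
        case (elim x)
        have "norm (G x) = norm (V x) * norm (f \<sigma> x)" using elim by (simp add: G_def norm_mult)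
        then have "(norm (f \<sigma> x))\<^sup>2 * norm (V x) = norm (G x) * norm (f \<sigma> x)" by (simp add: power2_eq_square mult_ac)
        also have "\<dots> \<le> (norm (G x))\<^sup>2 + (norm (f \<sigma> x))\<^sup>2"
          using sum_squares_bound[of "norm (G x)" "norm (f \<sigma> x)"]
            mult_nonneg_nonneg[OF norm_ge_zero norm_ge_zero, of "G x" "f \<sigma> x"] by linarith
        finally have "(norm (f \<sigma> x))\<^sup>2 * norm (W x) \<le> (norm (G x))\<^sup>2 + 2 * (norm (f \<sigma> x))\<^sup>2"
          using mult_left_mono[OF VW(2)[of x], of "(norm (f \<sigma> x))\<^sup>2"] by (simp add: distrib_left)
        then show ?case by (simp flip: ennreal_mult ennreal_plus ennreal_numeral add: ennreal_leI)
      qed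
    qed
    also have "\<dots> = n2 G + 2 * n2 (f \<sigma>)"
    proof -
      have [measurable]: "G \<in> borel_measurable borel" "f \<sigma> \<in> borel_measurable borel"
        using G fL(1)[of \<sigma>] by (auto simp: L2_def)
      show ?thesis unfolding n2_def by (simp add: nn_integral_add nn_integral_cmult)
    qed
    also have "\<dots> < \<infinity>" using G fL(1)[of \<sigma>] by (simp add: L2_def ennreal_mult_less_top)
    finally show "wn2 (\<lambda>x. ennreal (norm (W x))) (f \<sigma>) < \<infinity>" .
  qed (fact E A Wm W fL fw1 fw2)+
  have "AE x in lborel. \<forall>\<sigma>\<in>\<rat>. f \<sigma> x = 0" by (intro AE_ball_countable' f0) (auto simp: countable_rat)
  then have "AE x in lborel. AE t in lborel. U (x, t) = 0"
    using slice_L2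
  proof eventually_elim
    case (elim x)
    have L: "L2 (\<lambda>t. U (x, t))" using elim(2) by simp
    \<comment> \<open>\<open>f \<sigma> x\<close> is the Fourier transform of t ->
      \<open>U (x, t) * m 0 t\<close> at frequency \<sigma>, and \<open>m 0\<close> has no
      zeros.\<close>
    have "AE t in lborel. U (x, t) * m 0 t = 0"
    proof (rule fourier_unique)
      show "integrable lborel (\<lambda>t. U (x, t) * m 0 t)" by (intro L2_mult_integrable L mL)
      show "(LINT t|lborel. U (x, t) * m 0 t * iexp (\<sigma> * t)) = 0" if "\<sigma> \<in> \<rat>" for \<sigma>
        using elim(1) that by (simp add: f_def m_def mult.assoc)
    qed
    then show ?case by eventually_elim (simp add: m_def)
  qed
  then have "AE z in lborel \<Otimes>\<^sub>M lborel. U z = 0"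
  proof (rule lborel_pair.AE_pair_measure[rotated])
    have [measurable]: "U \<in> borel_measurable (lborel \<Otimes>\<^sub>M lborel)" using U(1) by (intro prod_measurable_slices) (simp add: L2_def)
    show "{z \<in> space (lborel \<Otimes>\<^sub>M lborel). U z = 0} \<in> sets (lborel \<Otimes>\<^sub>M lborel)" by measurable
  qed
  then show ?thesis unfolding lborel_prod .
qed

section \<open>Borel representatives\<close>

text \<open>Slicing and Fubini are carried out with Borel functions, so every Lebesgue measurable
  datum is first replaced by one that agrees with it almost everywhere.\<close>

lemma borel_representative:
  fixes f :: "'a::euclidean_space \<Rightarrow> complex"
  assumes "f \<in> borel_measurable lebesgue"
  obtains h where "h \<in> borel_measurable borel" "AE x in lborel. f x = h x"
proof -
  have "(\<lambda>x. Re (f x)) \<in> borel_measurable lebesgue" "(\<lambda>x. Im (f x)) \<in> borel_measurable lebesgue"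
    using assms by measurable
  from this[THEN completion_ex_borel_measurable_real]
  obtain r i where h: "r \<in> borel_measurable lborel" "AE x in lborel. Re (f x) = r x"
    "i \<in> borel_measurable lborel" "AE x in lborel. Im (f x) = i x" by blast
  have "(\<lambda>x. Complex (r x) (i x)) \<in> borel_measurable borel"
    using h(1,3) unfolding Complex_eq by simp
  moreover have "AE x in lborel. f x = Complex (r x) (i x)"
    using h(2,4) by eventually_elim (simp add: complex_eq_iff)
  ultimately show thesis by (rule that)
qed

lemma L2_representative:
  assumes "L2_fun f" "h \<in> borel_measurable borel" "AE x in lborel. f x = h x"
  shows "L2 h"
proof -
  have [measurable]: "f \<in> borel_measurable lebesgue" using assms(1) by (simp add: L2_fun_def)
  have [measurable]: "h \<in> borel_measurable lebesgue" using assms(2) by (intro measurable_completion) simp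
  have "AE x in lebesgue. (norm (f x))\<^sup>2 = (norm (h x))\<^sup>2"
    using AE_completion[OF assms(3)] by eventually_elim simp
  moreover have "integrable lebesgue (\<lambda>x. (norm (f x))\<^sup>2)" using assms(1) by (simp add: L2_fun_def)
  ultimately have "integrable lebesgue (\<lambda>x. (norm (h x))\<^sup>2)"
    using integrable_cong_AE_imp[of lebesgue "\<lambda>x. (norm (f x))\<^sup>2" "\<lambda>x. (norm (h x))\<^sup>2"] by simp
  then show ?thesis using assms(2) by (simp add: L2_iff_integrable integrable_completion)
qed

lemma lebesgue_integral_representative:
  fixes f h \<phi> :: "'a::euclidean_space \<Rightarrow> complex"
  assumes "f \<in> borel_measurable lebesgue" "h \<in> borel_measurable borel" "AE x in lborel. f x = h x" "\<phi> \<in> borel_measurable borel"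
  shows "(LINT x|lebesgue. f x * \<phi> x) = (LINT x|lborel. h x * \<phi> x)"
proof -
  have m: "\<phi> \<in> borel_measurable lebesgue" "h \<in> borel_measurable lebesgue" using assms by (auto intro: measurable_completion)
  have "(LINT x|lebesgue. f x * \<phi> x) = (LINT x|lebesgue. h x * \<phi> x)"
  proof (rule integral_cong_AE)
    show "AE x in lebesgue. f x * \<phi> x = h x * \<phi> x" using AE_completion[OF assms(3)] by eventually_elim simp
  qed (use assms(1) m in measurable)
  also have "\<dots> = (LINT x|lborel. h x * \<phi> x)" using assms by (intro integral_completion) simp
  finally show ?thesis .
qed

lemma weak_deriv_representative:
  assumes w: "has_weak_deriv f bs h" and bs: "set bs \<subseteq> Basis"
    and F: "F \<in> borel_measurable borel" "AE x in lborel. f x = F x"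
    and H: "H \<in> borel_measurable borel" "AE x in lborel. h x = H x"
    and \<phi>: "test_fun \<phi>"
  shows "(LINT x|lborel. F x * pds bs \<phi> x) = (-1) ^ length bs * (LINT x|lborel. H x * \<phi> x)"
proof -
  have m: "f \<in> borel_measurable lebesgue" "h \<in> borel_measurable lebesgue" using w by (auto simp: has_weak_deriv_def Lp_loc_def)
  have "(LINT x|lebesgue. f x * pds bs \<phi> x) = (-1) ^ length bs * (LINT x|lebesgue. h x * \<phi> x)"
    using w \<phi> by (auto simp: has_weak_deriv_def)
  moreover have "pds bs \<phi> \<in> borel_measurable borel"
    using smooth_measurable[OF smooth_pds[OF test_fun_smooth[OF \<phi>] bs]] .
  ultimately show ?thesis
    using lebesgue_integral_representative[OF m(1) F] lebesgue_integral_representative[OF m(2) H test_fun_measurable[OF \<phi>]] by simp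
qed

text \<open>Identifies the derivatives occurring in the equation, which by definition are only
  locally integrable, with the L^2 derivatives provided by membership in \<open>H1t\<close> and
  \<open>H2x\<close>.\<close>

lemma weak_deriv_unique:
  fixes f :: "'a::euclidean_space \<Rightarrow> complex"
  assumes w: "has_weak_deriv f bs h1" "has_weak_deriv f bs h2" and bs: "set bs \<subseteq> Basis"
  shows "AE x in lborel. h1 x = h2 x"
proof -
  have m: "f \<in> borel_measurable lebesgue" "h1 \<in> borel_measurable lebesgue" "h2 \<in> borel_measurable lebesgue"
    using w by (auto simp: has_weak_deriv_def Lp_loc_def)
  obtain F where F: "F \<in> borel_measurable borel" "AE x in lborel. f x = F x" using borel_representative[OF m(1)] .
  obtain H1 where H1: "H1 \<in> borel_measurable borel" "AE x in lborel. h1 x = H1 x" using borel_representative[OF m(2)] .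
  obtain H2 where H2: "H2 \<in> borel_measurable borel" "AE x in lborel. h2 x = H2 x" using borel_representative[OF m(3)] .
  have loc: "integrable lborel (\<lambda>x. indicator K x *\<^sub>R H x)"
    if K: "compact K" and h: "Lp_loc 1 h" and H: "H \<in> borel_measurable borel" "AE x in lborel. h x = H x" for h H and K :: "'a set"
  proof -
    have Kb: "K \<in> sets borel" using K by (simp add: compact_imp_closed borel_closed)
    have hm: "h \<in> borel_measurable lebesgue" and hi: "integrable lebesgue (\<lambda>x. indicator K x *\<^sub>R (norm (h x) powr 1))"
      using h K by (auto simp: Lp_loc_def set_integrable_def)
    have "integrable lebesgue (\<lambda>x. indicator K x *\<^sub>R H x)"
    proof (rule Bochner_Integration.integrable_bound[OF hi])
      have "(\<lambda>x. indicator K x *\<^sub>R H x) \<in> borel_measurable lborel" using H Kb by simp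
      then show "(\<lambda>x. indicator K x *\<^sub>R H x) \<in> borel_measurable lebesgue" by (rule measurable_completion)
      show "AE x in lebesgue. norm (indicator K x *\<^sub>R H x) \<le> norm (indicator K x *\<^sub>R (norm (h x) powr 1))"
        using AE_completion[OF H(2)] by eventually_elim simp
    qed
    then show ?thesis using H Kb by (subst (asm) integrable_completion) auto
  qed
  define q where "q x = H1 x - H2 x" for x
  have K: "integrable lborel (\<lambda>x. indicator A x *\<^sub>R H1 x)" "integrable lborel (\<lambda>x. indicator A x *\<^sub>R H2 x)" if "compact A" for A
    using loc[OF that _ H1] loc[OF that _ H2] w by (auto simp: has_weak_deriv_def)
  have "AE x in lborel. q x = 0"
  proof (rule fundamental_lemma)
    show "integrable lborel (\<lambda>x. indicator (cbox a b) x *\<^sub>R q x)" for a b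
      using K[of "cbox a b"] by (simp add: q_def scaleR_diff_right)
    show "q \<in> borel_measurable borel" unfolding q_def[abs_def] using H1 H2 by simp
    fix \<phi> :: "'a \<Rightarrow> complex" assume \<phi>: "test_fun \<phi>"
    obtain R where R: "{x. \<phi> x \<noteq> 0} \<subseteq> cball 0 R"
      using \<phi> bounded_subset_ballD ball_subset_cball unfolding test_fun_iff by (metis subset_trans)
    obtain B where B: "\<And>x. norm (\<phi> x) \<le> B" using test_fun_bounded[OF \<phi>] by blast
    have i: "integrable lborel (\<lambda>x. H x * \<phi> x)"
      if "integrable lborel (\<lambda>x. indicator (cball 0 R) x *\<^sub>R H x)" "H \<in> borel_measurable borel" for H
    proof (rule Bochner_Integration.integrable_bound[OF integrable_mult_right[OF integrable_norm[OF that(1)], of B]])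
      show "(\<lambda>x. H x * \<phi> x) \<in> borel_measurable lborel" using that(2) test_fun_measurable[OF \<phi>] by simp
      have "norm (H x * \<phi> x) \<le> B * norm (indicator (cball 0 R) x *\<^sub>R H x)" for x
        using R B[of x] by (cases "\<phi> x = 0") (auto simp: norm_mult mult.commute[of B] mult_left_mono indicator_def split: if_splits)
      then show "AE x in lborel. norm (H x * \<phi> x) \<le> norm (B * norm (indicator (cball 0 R) x *\<^sub>R H x))"
        unfolding real_norm_def by (intro AE_I2) (rule order_trans[OF _ abs_ge_self])
    qed
    have "(-1) ^ length bs * (LINT x|lborel. H1 x * \<phi> x) = (-1 :: complex) ^ length bs * (LINT x|lborel. H2 x * \<phi> x)"
      using weak_deriv_representative[OF w(1) bs F H1 \<phi>] weak_deriv_representative[OF w(2) bs F H2 \<phi>] by simp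
    then have "(LINT x|lborel. H1 x * \<phi> x) = (LINT x|lborel. H2 x * \<phi> x)" by simp
    then show "(LINT x|lborel. \<phi> x * q x) = 0"
      using i[OF K(1)[of "cball 0 R"] H1(1)] i[OF K(2)[of "cball 0 R"] H2(1)]
      by (simp add: q_def right_diff_distrib mult.commute[of "\<phi> _"])
  qed
  with H1(2) H2(2) show ?thesis by eventually_elim (simp add: q_def)
qed

lemma FP_representative:
  fixes V V' :: "'a::euclidean_space \<Rightarrow> complex"
  assumes V: "V \<in> FP_class p" and V': "V' \<in> borel_measurable borel" "AE x in lborel. V x = V' x"
  shows "V' \<in> FP_class p" "FP_norm p V' = FP_norm p V"
proof -
  have [measurable]: "V \<in> borel_measurable lebesgue" using V by (simp add: FP_class_def Lp_loc_def)
  have [measurable]: "V' \<in> borel_measurable lebesgue" using V'(1) by (intro measurable_completion) simp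
  have ae: "AE x in lebesgue. indicator K x *\<^sub>R (norm (V' x) powr p) = indicator K x *\<^sub>R (norm (V x) powr p)" for K
    using AE_completion[OF V'(2)] by eventually_elim simp
  have m: "(\<lambda>x. indicator K x *\<^sub>R (norm (V' x) powr p)) \<in> borel_measurable lebesgue"
    "(\<lambda>x. indicator K x *\<^sub>R (norm (V x) powr p)) \<in> borel_measurable lebesgue" if "closed K" for K
  proof -
    have [measurable]: "K \<in> sets lebesgue" using that by (simp add: borel_closed)
    show "(\<lambda>x. indicator K x *\<^sub>R (norm (V' x) powr p)) \<in> borel_measurable lebesgue"
      "(\<lambda>x. indicator K x *\<^sub>R (norm (V x) powr p)) \<in> borel_measurable lebesgue" by measurable
  qed
  have I: "(LINT x:K|lebesgue. norm (V' x) powr p) = (LINT x:K|lebesgue. norm (V x) powr p)" if "closed K" for K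
    unfolding set_lebesgue_integral_def by (rule integral_cong_AE[OF m[OF that] ae])
  have "set_integrable lebesgue K (\<lambda>x. norm (V' x) powr p)" if "compact K" for K
    using V that integrable_cong_AE[OF m[OF compact_imp_closed[OF that]] ae]
    by (auto simp: FP_class_def Lp_loc_def set_integrable_def)
  then have L: "Lp_loc p V'" by (simp add: Lp_loc_def)
  show e: "FP_norm p V' = FP_norm p V"
    unfolding FP_norm_def by (intro SUP_cong refl) (auto simp: cubes_def I closed_cbox)
  show "V' \<in> FP_class p" using L V e by (simp add: FP_class_def)
qed

section \<open>Choice of the weight and passage to Borel representatives\<close>

theorem corollary1p3:
  fixes p C :: real
    and V :: "real ^ 'n \<Rightarrow> complex"
    and g :: "real \<Rightarrow> real"
    and D :: "(real ^ 'n) set"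
    and u :: "(real ^ 'n) \<times> real \<Rightarrow> complex"
  assumes n: "CARD('n) \<ge> 3"
    and p: "(real CARD('n) - 1) / 2 < p" "p \<le> real CARD('n) / 2"
    and C: "C > 0"
    and carleman:
      "\<And>(W :: real ^ 'n \<Rightarrow> complex) (\<beta> :: real) (\<nu> :: (real ^ 'n) \<times> real)
         (v :: (real ^ 'n) \<times> real \<Rightarrow> complex).
         W \<in> FP_class p \<Longrightarrow> test_fun v \<Longrightarrow>
         L2_weight_norm (\<lambda>x. ennreal (norm (W x))) (\<lambda>z. exp (\<beta> * (z \<bullet> \<nu>)) *\<^sub>R v z)
         \<le> ennreal C * FP_norm p W *
           L2_weight_norm (\<lambda>x. inverse (ennreal (norm (W x))))
             (\<lambda>z. exp (\<beta> * (z \<bullet> \<nu>)) *\<^sub>R schroedinger_op v z)"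
    and V: "V \<in> FP_class p" "FP_norm p V < ennreal (1 / C)"
    and V_lower: "p = real CARD('n) / 2 \<Longrightarrow>
      \<exists>\<delta>>0. \<forall>\<^sub>F R in at_top. AE x in lebesgue.
        norm x \<le> 2 * R \<longrightarrow> norm (V x) \<ge> \<delta> / R\<^sup>2"
    and g: "\<And>t. g differentiable (at t)" "bdd_below (range g)" "filterlim g at_top at_infinity"
    and D: "D \<in> half_spaces"
    and u: "u \<in> H1t \<inter> H2x"
    and equation: "heat_solution (\<lambda>(x, t). complex_of_real (deriv g t + t) + V x) u"
    and vanish: "AE z in lebesgue. z \<in> D \<times> UNIV \<longrightarrow> u z = 0"
  shows "AE z in lebesgue. u z = 0"
proof -
  have p0: "p > 0" using p n by simp
  have Vl: "V \<in> borel_measurable lebesgue" using V(1) by (simp add: FP_class_def Lp_loc_def)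
  obtain V' where V': "V' \<in> borel_measurable borel" "AE x in lborel. V x = V' x" using borel_representative[OF Vl] .
  note V'FP = FP_representative[OF V(1) V']
  define v where "v = enn2real (FP_norm p V)"
  have v: "FP_norm p V' = ennreal v" "0 \<le> v"
    using V'FP(2) less_trans[OF V(2) ennreal_less_top] by (auto simp: v_def)
  have vC: "v < 1 / C"
  proof -
    have "ennreal v < ennreal (1 / C)" using V(2) V'FP(2) v(1) by simp
    then show ?thesis using v(2) by (simp only: ennreal_less_iff)
  qed

  \<comment> \<open>The weight must dominate |V|, have norm below 1/C and decay no faster than an
    inverse square. In the borderline case V itself qualifies by \<open>V_lower\<close>; below it
    |V| is raised to a small multiple of \<open>prod_weight\<close>, whose Fefferman-Phong norm is
    finite for p < n/2.\<close>
  have "\<exists>W q \<eta> R0. W \<in> borel_measurable borel \<and> W \<in> FP_class p \<and> FP_norm p W \<le> ennreal q \<and> 0 \<le> q \<and> q < 1 / C \<and>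
    (\<forall>x. norm (V' x) \<le> norm (W x)) \<and> (\<forall>x. norm (W x) \<le> norm (V' x) + 1) \<and> \<eta> > 0 \<and>
    (\<forall>R\<ge>R0. AE x in lborel. norm x \<le> 2 * R \<longrightarrow> \<eta> / R\<^sup>2 \<le> norm (W x))"
  proof (cases "p = real CARD('n) / 2")
    case True
    then obtain \<delta> R0 where \<delta>: "\<delta> > 0" "\<And>R. R \<ge> R0 \<Longrightarrow> AE x in lebesgue. norm x \<le> 2 * R \<longrightarrow> norm (V x) \<ge> \<delta> / R\<^sup>2"
      using V_lower unfolding eventually_at_top_linorder by blast
    have "AE x in lborel. norm x \<le> 2 * R \<longrightarrow> \<delta> / R\<^sup>2 \<le> norm (V' x)" if "R \<ge> R0" for R
      using \<delta>(2)[OF that, unfolded AE_completion_iff] V'(2) by eventually_elim simp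
    then show ?thesis using V' V'FP v vC \<delta>(1) by (intro exI[of _ V'] exI[of _ v] exI[of _ \<delta>] exI[of _ R0]) auto
  next
    case False
    \<comment> \<open>The strict inequality v < 1/C leaves room for the enlarged weight.\<close>
    obtain v' where v': "v < v'" "v' < 1 / C" using dense[OF vC] by blast
    have "p < DIM(real ^ 'n) / 2" using False p by simp
    then obtain \<epsilon> where \<epsilon>: "\<epsilon> > 0" "\<epsilon> \<le> 1" "(\<lambda>x. complex_of_real (max (norm (V' x)) (\<epsilon> * prod_weight x))) \<in> FP_class p"
      "FP_norm p (\<lambda>x. complex_of_real (max (norm (V' x)) (\<epsilon> * prod_weight x))) \<le> ennreal v'"
      using nonborderline_weight[OF V'FP(1) V'(1), of v v'] v v' p0 by auto
    define W where "W x = complex_of_real (max (norm (V' x)) (\<epsilon> * prod_weight x))" for x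
    have nW: "norm (W x) = max (norm (V' x)) (\<epsilon> * prod_weight x)" for x by (simp add: W_def max.coboundedI1)
    have "\<epsilon> * prod_weight x \<le> 1" for x :: "real ^ 'n"
      using \<epsilon> prod_weight_le_1[of x] prod_weight_pos[of x] by (intro mult_le_one) auto
    then have "norm (W x) \<le> norm (V' x) + 1" for x unfolding nW by (simp add: add_increasing)
    moreover have "AE x in lborel. norm x \<le> 2 * R \<longrightarrow> (\<epsilon> / 9) / R\<^sup>2 \<le> norm (W x)" if "R \<ge> 1" for R
    proof (intro AE_I2 impI)
      fix x :: "real ^ 'n" assume "norm x \<le> 2 * R"
      then have "\<epsilon> * ((1 / 9) / R\<^sup>2) \<le> \<epsilon> * prod_weight x" using prod_weight_lower[OF _ that] \<epsilon> by (intro mult_left_mono) auto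
      then show "(\<epsilon> / 9) / R\<^sup>2 \<le> norm (W x)" unfolding nW by (simp add: le_max_iff_disj)
    qed
    moreover have "W \<in> borel_measurable borel" unfolding W_def[abs_def] using V'(1) by measurable
    moreover have "W \<in> FP_class p" "FP_norm p W \<le> ennreal v'" using \<epsilon> by (simp_all add: W_def[abs_def])
    ultimately show ?thesis using v v' \<epsilon>(1) nW
      by (intro exI[of _ W] exI[of _ v'] exI[of _ "\<epsilon> / 9"] exI[of _ 1]) auto
  qed
  then obtain W q \<eta> R0 where W: "W \<in> borel_measurable borel" "W \<in> FP_class p" "FP_norm p W \<le> ennreal q" "0 \<le> q" "q < 1 / C"
    "\<And>x. norm (V' x) \<le> norm (W x)" "\<And>x. norm (W x) \<le> norm (V' x) + 1" "\<eta> > 0"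
    "\<And>R. R \<ge> R0 \<Longrightarrow> AE x in lborel. norm x \<le> 2 * R \<longrightarrow> \<eta> / R\<^sup>2 \<le> norm (W x)" by blast

  define Q where "Q = C * q"
  have Q: "0 \<le> Q" "Q < 1" using W(4,5) C by (auto simp: Q_def field_simps)
  \<comment> \<open>This gives Q^2 (1 + \<kappa>) = 1 - \<kappa>^2, so the constant of
    \<open>elliptic_carleman\<close> stays below 1.\<close>
  define \<kappa> where "\<kappa> = 1 - Q\<^sup>2"
  have Q2: "Q\<^sup>2 < 1" using Q by (simp add: power_less_one_iff)
  then have \<kappa>: "\<kappa> > 0" by (simp add: \<kappa>_def)
  have "Q\<^sup>2 * (1 + \<kappa>) = 1 - \<kappa>\<^sup>2" by (simp add: \<kappa>_def power2_eq_square algebra_simps)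
  moreover have "\<kappa>\<^sup>2 > 0" using \<kappa> by simp
  ultimately have "Q\<^sup>2 * (1 + \<kappa>) < 1" by linarith
  moreover have "0 \<le> Q\<^sup>2 * (1 + \<kappa>)" using \<kappa> by simp
  ultimately have A: "0 \<le> Q\<^sup>2 * (1 + \<kappa>)" "Q\<^sup>2 * (1 + \<kappa>) < 1" by simp_all
  have car: "L2_weight_norm (\<lambda>x. ennreal (norm (W x))) (\<lambda>z. exp (\<beta> * (z \<bullet> \<nu>)) *\<^sub>R v z)
       \<le> ennreal Q * L2_weight_norm (\<lambda>x. inverse (ennreal (norm (W x)))) (\<lambda>z. exp (\<beta> * (z \<bullet> \<nu>)) *\<^sub>R schroedinger_op v z)"
    if "test_fun v" for \<beta> \<nu> v
  proof -
    have "ennreal C * FP_norm p W \<le> ennreal Q"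
      using mult_left_mono[OF W(3), of "ennreal C"] C W(4) by (simp add: Q_def ennreal_mult)
    then show ?thesis by (intro order_trans[OF carleman[OF W(2) that]] mult_right_mono) simp_all
  qed
  note E = elliptic_carleman[OF car Q(1) W(1) _ _ \<kappa>]

  have uL: "L2_fun u" using u by (simp add: H1t_def)
  obtain ht where ht: "has_weak_deriv u [(0, 1)] ht" "L2_fun ht" using u by (auto simp: H1t_def)
  have "\<forall>b\<in>Basis. \<exists>h. has_weak_deriv u [(b, 0)] h \<and> L2_fun h" "\<forall>b\<in>Basis. \<exists>h. has_weak_deriv u [(b, 0), (b, 0)] h \<and> L2_fun h"
    using u by (auto simp: H2x_def)
  then obtain h1 h2 where h1: "\<And>b. b \<in> Basis \<Longrightarrow> has_weak_deriv u [(b, 0)] (h1 b) \<and> L2_fun (h1 b)"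
    and h2: "\<And>b. b \<in> Basis \<Longrightarrow> has_weak_deriv u [(b, 0), (b, 0)] (h2 b) \<and> L2_fun (h2 b)" by metis
  obtain ut uxx where eq: "has_weak_deriv u [(0, 1)] ut" "\<And>b. b \<in> Basis \<Longrightarrow> has_weak_deriv u [(b, 0), (b, 0)] (uxx b)"
    "AE z in lebesgue. ut z - (\<Sum>b\<in>Basis. uxx b z) = (case z of (x, t) \<Rightarrow> complex_of_real (deriv g t + t) + V x) * u z"
    using equation by (auto simp: heat_solution_def)
  have rep: "\<exists>H. H \<in> borel_measurable borel \<and> (AE z in lborel. h z = H z)" if "L2_fun h" for h :: "(real ^ 'n) \<times> real \<Rightarrow> complex"
    using borel_representative[of h] that by (auto simp: L2_fun_def)
  obtain U where U: "U \<in> borel_measurable borel" "AE z in lborel. u z = U z" using rep[OF uL] by blast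
  obtain Ut where Ut: "Ut \<in> borel_measurable borel" "AE z in lborel. ht z = Ut z" using rep[OF ht(2)] by blast
  have "\<forall>b\<in>Basis. \<exists>H. H \<in> borel_measurable borel \<and> (AE z in lborel. h1 b z = H z)"
    by (intro ballI rep h1[THEN conjunct2])
  from bchoice[OF this] obtain U1 where U1: "\<And>b. b \<in> Basis \<Longrightarrow> U1 b \<in> borel_measurable borel \<and> (AE z in lborel. h1 b z = U1 b z)"
    by blast
  have "\<forall>b\<in>Basis. \<exists>H. H \<in> borel_measurable borel \<and> (AE z in lborel. h2 b z = H z)"
    by (intro ballI rep h2[THEN conjunct2])
  from bchoice[OF this] obtain U2 where U2: "\<And>b. b \<in> Basis \<Longrightarrow> U2 b \<in> borel_measurable borel \<and> (AE z in lborel. h2 b z = U2 b z)"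
    by blast
  have bas: "(b, 0) \<in> Basis" if "b \<in> Basis" for b :: "real ^ 'n" using that by (simp add: Basis_prod_def)
  have bas0: "(0, 1) \<in> (Basis :: ((real ^ 'n) \<times> real) set)" by (simp add: Basis_prod_def)
  \<comment> \<open>The product of a null set of space with the whole time axis is null, so V may be
    replaced by its Borel representative in the space-time equation.\<close>
  have VV: "AE z in lborel. V (fst z) = V' (fst (z :: (real ^ 'n) \<times> real))"
  proof -
    have "AE z in lborel \<Otimes>\<^sub>M (lborel :: real measure). V (fst z) = V' (fst z)"
    proof -
      obtain N where N: "\<And>x. x \<notin> N \<Longrightarrow> V x = V' x" "N \<in> null_sets lborel"
        using AE_E3[OF V'(2)] by auto
      have Nb: "N \<in> sets borel" using N(2) by (auto simp: null_sets_def)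
      have "AE z in lborel \<Otimes>\<^sub>M (lborel :: real measure). fst z \<notin> N"
      proof (rule lborel_pair.AE_pair_measure)
        show "{z \<in> space (lborel \<Otimes>\<^sub>M (lborel :: real measure)). fst z \<notin> N} \<in> sets (lborel \<Otimes>\<^sub>M lborel)"
          using Nb by measurable
        show "AE x in lborel. AE y in (lborel :: real measure). fst (x, y) \<notin> N"
          using AE_not_in[OF N(2)] by eventually_elim simp
      qed
      then show ?thesis by eventually_elim (rule N(1))
    qed
    then show ?thesis by (simp only: lborel_prod)
  qed
  have "AE z in lborel. ut z = ht z" using weak_deriv_unique[OF eq(1) ht(1)] bas0 by simp
  then have "AE z in lborel. ut z = Ut z" using Ut(2) by eventually_elim simp
  moreover have "AE z in lborel. \<forall>b\<in>Basis. uxx b z = U2 b z"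
  proof (intro AE_finite_allI finite_Basis)
    fix b :: "real ^ 'n" assume b: "b \<in> Basis"
    have "AE z in lborel. uxx b z = h2 b z" using weak_deriv_unique[OF eq(2)[OF b] h2[OF b, THEN conjunct1]] bas[OF b] by simp
    with U2[OF b, THEN conjunct2] show "AE z in lborel. uxx b z = U2 b z" by eventually_elim simp
  qed
  ultimately have eqn: "AE z in lborel. Ut z - (\<Sum>b\<in>Basis. U2 b z) = (of_real (deriv g (snd z) + snd z) + V' (fst z)) * U z"
    using eq(3)[unfolded AE_completion_iff] U(2) VV by eventually_elim (simp add: case_prod_beta')
  obtain c where c: "\<And>t. c \<le> g t" using g(2) by (auto simp: bdd_below_def)
  have "AE z in lborel. U z = 0"
  proof (rule heat_uniqueness[OF E A W(1) V'(1) W(8,9,6,7) _ _ _ _ _ _ _ eqn _ c])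
    show "L2 U" "L2 Ut" using L2_representative uL ht(2) U Ut by blast+
    show "L2 (U1 b)" "L2 (U2 b)" if "b \<in> Basis" for b using L2_representative h1[OF that] h2[OF that] U1[OF that] U2[OF that] by blast+
    show "(LINT z|lborel. U z * pd (0, 1) \<phi> z) = - (LINT z|lborel. Ut z * \<phi> z)" if "test_fun \<phi>" for \<phi>
      using weak_deriv_representative[OF ht(1) _ U Ut that] bas0 by simp
    show "(LINT z|lborel. U z * pd (b, 0) \<phi> z) = - (LINT z|lborel. U1 b z * \<phi> z)" if "b \<in> Basis" "test_fun \<phi>" for b \<phi>
      using weak_deriv_representative[OF h1[OF that(1), THEN conjunct1] _ U U1[OF that(1), THEN conjunct1]
          U1[OF that(1), THEN conjunct2] that(2)] bas[OF that(1)] by simp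
    show "(LINT z|lborel. U z * pd (b, 0) (pd (b, 0) \<phi>) z) = (LINT z|lborel. U2 b z * \<phi> z)" if "b \<in> Basis" "test_fun \<phi>" for b \<phi>
      using weak_deriv_representative[OF h2[OF that(1), THEN conjunct1] _ U U2[OF that(1), THEN conjunct1]
          U2[OF that(1), THEN conjunct2] that(2)] bas[OF that(1)] by simp
    show "(g has_real_derivative deriv g t) (at t)" for t
      using g(1) by (simp add: DERIV_deriv_iff_real_differentiable)
  qed
  with U(2) have "AE z in lborel. u z = 0" by eventually_elim simp
  then show ?thesis by (rule AE_completion)
qed

end
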